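(* Let $A$ be a unital $C^*$-algebra such that $(\mathrm{Cu}(A),[1])$ has locally bounded comparison amplitude for uniformly full elements, that is: for every $\gamma\in(0,1)$ and $d\in\mathbb N$ there exists $N\in\mathbb N$ such that $\widehat{x}\le\gamma\widehat{y}$ implies $x\le_N y$, for all $x,y\in\mathrm{Cu}(A)$ with $x,y\le d[1]$ and $[1]\le dy$. Then the set $\mathrm{LDF}(A)$ of lower semicontinuous normalized dimension functions is dense in the set $\mathrm{DF}(A)$ of normalized dimension functions.
   Context: Cuntz semigroup: for positive $a,b$ in a $C^*$-algebra, $a\precsim b$ means $\|a-r_nbr_n^*\|\to0$ for some sequence $(r_n)$ in the algebra; $a\sim b$ means $a\precsim b$ and $b\precsim a$. $\mathrm{Cu}(A)=(A\otimes\mathcal K)_+/{\sim}$ ($\mathcal K$ the compact operators on $\ell^2(\mathbb N)$), with order induced by $\precsim$ and addition induced by addition of orthogonal positive elements; $[a]$ is the class of $a$ and $[1]$ the class of the unit of $A$. Increasing sequences in $\mathrm{Cu}(A)$ have suprema. $x\le_N y$ means $nx\le ny$ for all $n\ge N$. A functional on $S=\mathrm{Cu}(A)$ is an order-preserving monoid homomorphism $\lambda\colon S\to[0,\infty]$ preserving suprema of increasing sequences; $F(S)$ is the set of functionals; $\widehat x\colon F(S)\to[0,\infty]$ is $\widehat x(\lambda)=\lambda(x)$, and inequalities between such functions are pointwise. Dimension functions: $M_\infty(A)=\bigcup_nM_n(A)$ (upper-left corner embeddings). A normalized dimension function is a map $\delta\colon M_\infty(A)_+\to[0,\infty)$ with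 $\delta(a\oplus b)=\delta(a)+\delta(b)$ for all $a,b$, $\delta(a)\le \delta(b)$ whenever $a\precsim b$, and $\delta(1_A)=1$. $\mathrm{DF}(A)$ is the set of normalized dimension functions with the topology of pointwise convergence, and $\mathrm{LDF}(A)$ is the subset of those that are lower semicontinuous (with respect to the norm). *)

theory Defs
  imports "HOL-Analysis.Analysis"
begin

section \<open>C*-algebras\<close>

text \<open>
  The underlying real Banach algebra comes from the library; complex scalars and the involution
  are added. No unit is assumed, and the unital subclass does not require \<open>0 \<noteq> 1\<close>, so the zero
  algebra is admitted.
\<close>

class cstar_algebra = banach + real_normed_algebra +
  fixes scaleC :: "complex \<Rightarrow> 'a \<Rightarrow> 'a"
    and star :: "'a \<Rightarrow> 'a"
  assumes scaleC_add_right: "scaleC c (x + y) = scaleC c x + scaleC c y"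
    and scaleC_add_left: "scaleC (c + d) x = scaleC c x + scaleC d x"
    and scaleC_scaleC: "scaleC c (scaleC d x) = scaleC (c * d) x"
    and scaleC_complex_of_real: "scaleC (complex_of_real r) x = scaleR r x"
    and mult_scaleC_left: "scaleC c x * y = scaleC c (x * y)"
    and mult_scaleC_right: "x * scaleC c y = scaleC c (x * y)"
    and norm_scaleC: "norm (scaleC c x) = cmod c * norm x"
    and star_add: "star (x + y) = star x + star y"
    and star_scaleC: "star (scaleC c x) = scaleC (cnj c) (star x)"
    and star_mult: "star (x * y) = star y * star x"
    and star_star: "star (star x) = x"
    and norm_star_mult_self: "norm (star x * x) = (norm x)\<^sup>2"

class unital_cstar_algebra = cstar_algebra + monoid_mult

instantiation complex :: unital_cstar_algebra
begin

definition "scaleC (c :: complex) (x :: complex) = c * x"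
definition "star (x :: complex) = cnj x"

instance
  by standard
    (simp_all add: scaleC_complex_def star_complex_def algebra_simps norm_mult scaleR_conv_of_real
      power2_eq_square)

end

section \<open>\<open>M\<^sub>\<infinity>(A)\<close> and the stabilization \<open>A \<otimes> K\<close>\<close>

text \<open>
  Elements of \<open>A \<otimes> K\<close> are represented by their infinite matrices of entries: \<open>A \<otimes> K\<close> is the
  completion of \<open>M\<^sub>\<infinity>(A)\<close>, the union of the \<open>M\<^sub>n(A)\<close>, in the C*-norm, and the elementary tensor
  \<open>a \<otimes> e\<^bsub>ij\<^esub>\<close> is the matrix with single entry \<open>a\<close> at \<open>(i, j)\<close>.
\<close>

type_synonym 'a mat = "nat \<Rightarrow> nat \<Rightarrow> 'a"

definition mat_zero :: "'a::cstar_algebra mat" where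
  "mat_zero = (\<lambda>i j. 0)"

definition mat_add :: "'a::cstar_algebra mat \<Rightarrow> 'a mat \<Rightarrow> 'a mat" where
  "mat_add a b = (\<lambda>i j. a i j + b i j)"

definition mat_diff :: "'a::cstar_algebra mat \<Rightarrow> 'a mat \<Rightarrow> 'a mat" where
  "mat_diff a b = (\<lambda>i j. a i j - b i j)"

text \<open>The series converges in norm whenever both factors lie in \<open>A \<otimes> K\<close>.\<close>

definition mat_mult :: "'a::cstar_algebra mat \<Rightarrow> 'a mat \<Rightarrow> 'a mat" where
  "mat_mult a b = (\<lambda>i j. \<Sum>k. a i k * b k j)"

definition mat_adj :: "'a::cstar_algebra mat \<Rightarrow> 'a mat" where
  "mat_adj a = (\<lambda>i j. star (a j i))"

definition corner :: "nat \<Rightarrow> 'a::cstar_algebra mat \<Rightarrow> 'a mat" where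
  "corner n a = (\<lambda>i j. if i < n \<and> j < n then a i j else 0)"

text \<open>
  The norm of the Hilbert C*-module \<open>A\<^sup>n\<close>, with inner product
  \<open>\<langle>v, w\<rangle> = \<Sum>i<n. (v i)\<^sup>* w i\<close>. Only the entries \<open>v 0, \<dots>, v (n - 1)\<close> matter.
\<close>

definition vec_norm :: "nat \<Rightarrow> (nat \<Rightarrow> 'a::cstar_algebra) \<Rightarrow> real" where
  "vec_norm n v = sqrt (norm (\<Sum>i<n. star (v i) * v i))"

text \<open>
  The C*-norm of \<open>M\<^sub>n(A)\<close> is the operator norm of its faithful action on \<open>A\<^sup>n\<close>. The norm of an
  infinite matrix is the supremum of the norms of its upper-left corners; it is infinite when the
  corners are unbounded.
\<close>

definition mat_norm :: "'a::cstar_algebra mat \<Rightarrow> ennreal" where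
  "mat_norm a =
     (SUP n. SUP v\<in>{v. vec_norm n v \<le> 1}. ennreal (vec_norm n (\<lambda>i. \<Sum>j<n. a i j * v j)))"

definition matrices :: "nat \<Rightarrow> 'a::cstar_algebra mat set" where
  "matrices n = {a. \<forall>i j. n \<le> i \<or> n \<le> j \<longrightarrow> a i j = 0}"

definition finite_matrices :: "'a::cstar_algebra mat set" where
  "finite_matrices = (\<Union>n. matrices n)"

definition stabilization :: "'a::cstar_algebra mat set" where
  "stabilization = {a. (\<lambda>n. mat_norm (mat_diff a (corner n a))) \<longlonglongrightarrow> 0}"

definition mat_unit :: "'a::unital_cstar_algebra mat" where
  "mat_unit = (\<lambda>i j. if i = 0 \<and> j = 0 then 1 else 0)"

section \<open>Cuntz comparison\<close>

text \<open>
  Positivity and Cuntz subequivalence are relative to the algebra \<open>S\<close> of matrices under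
  consideration, here \<open>M\<^sub>n(A)\<close>, \<open>M\<^sub>\<infinity>(A)\<close> or \<open>A \<otimes> K\<close>.
\<close>

definition positives :: "'a::cstar_algebra mat set \<Rightarrow> 'a mat set" where
  "positives S = {mat_mult (mat_adj x) x | x. x \<in> S}"

definition cuntz_le :: "'a::cstar_algebra mat set \<Rightarrow> 'a mat \<Rightarrow> 'a mat \<Rightarrow> bool" where
  "cuntz_le S a b \<longleftrightarrow>
     (\<exists>r :: nat \<Rightarrow> 'a mat. (\<forall>n. r n \<in> S) \<and>
        (\<lambda>n. mat_norm (mat_diff a (mat_mult (mat_mult (r n) b) (mat_adj (r n))))) \<longlonglongrightarrow> 0)"

definition cuntz_equiv :: "'a::cstar_algebra mat rel" where
  "cuntz_equiv =
     {(a, b). a \<in> positives stabilization \<and> b \<in> positives stabilization \<and>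
        cuntz_le stabilization a b \<and> cuntz_le stabilization b a}"

section \<open>The Cuntz semigroup\<close>

definition Cu :: "'a::cstar_algebra mat set set" where
  "Cu = positives stabilization // cuntz_equiv"

definition cu_class :: "'a::cstar_algebra mat \<Rightarrow> 'a mat set" where
  "cu_class a = cuntz_equiv `` {a}"

definition cu_le :: "'a::cstar_algebra mat set \<Rightarrow> 'a mat set \<Rightarrow> bool" where
  "cu_le x y \<longleftrightarrow> (\<exists>a\<in>x. \<exists>b\<in>y. cuntz_le stabilization a b)"

text \<open>
  The class of \<open>a + b\<close> for orthogonal representatives \<open>a\<close> of \<open>x\<close> and \<open>b\<close> of \<open>y\<close>; all such pairs
  give the same class, so that the union below consists of a single class.
\<close>

definition cu_add :: "'a::cstar_algebra mat set \<Rightarrow> 'a mat set \<Rightarrow> 'a mat set" where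
  "cu_add x y = \<Union>{cu_class (mat_add a b) | a b. a \<in> x \<and> b \<in> y \<and> mat_mult a b = mat_zero}"

primrec cu_multiple :: "nat \<Rightarrow> 'a::cstar_algebra mat set \<Rightarrow> 'a mat set" where
  "cu_multiple 0 x = cu_class mat_zero"
| "cu_multiple (Suc n) x = cu_add x (cu_multiple n x)"

definition cu_is_sup :: "(nat \<Rightarrow> 'a::cstar_algebra mat set) \<Rightarrow> 'a mat set \<Rightarrow> bool" where
  "cu_is_sup x s \<longleftrightarrow>
     s \<in> Cu \<and> (\<forall>n. cu_le (x n) s) \<and> (\<forall>t\<in>Cu. (\<forall>n. cu_le (x n) t) \<longrightarrow> cu_le s t)"

text \<open>Only the values on \<open>Cu\<close> are relevant; \<open>f\<close> is arbitrary elsewhere.\<close>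

definition functionals :: "('a::cstar_algebra mat set \<Rightarrow> ennreal) set" where
  "functionals =
     {f. (\<forall>x\<in>Cu. \<forall>y\<in>Cu. cu_le x y \<longrightarrow> f x \<le> f y) \<and>
         f (cu_class mat_zero) = 0 \<and>
         (\<forall>x\<in>Cu. \<forall>y\<in>Cu. f (cu_add x y) = f x + f y) \<and>
         (\<forall>x s. (\<forall>n. x n \<in> Cu) \<and> (\<forall>n. cu_le (x n) (x (Suc n))) \<and> cu_is_sup x s \<longrightarrow>
            f s = (SUP n. f (x n)))}"

definition cu_hat :: "'a::cstar_algebra mat set \<Rightarrow> ('a mat set \<Rightarrow> ennreal) \<Rightarrow> ennreal" where
  "cu_hat x f = f x"

definition cu_le_from :: "nat \<Rightarrow> 'a::cstar_algebra mat set \<Rightarrow> 'a mat set \<Rightarrow> bool" where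
  "cu_le_from N x y \<longleftrightarrow> (\<forall>n\<ge>N. cu_le (cu_multiple n x) (cu_multiple n y))"

definition locally_bounded_comparison_amplitude_uniformly_full ::
  "'a::unital_cstar_algebra itself \<Rightarrow> bool" where
  "locally_bounded_comparison_amplitude_uniformly_full (A :: 'a itself) \<longleftrightarrow>
     (\<forall>(\<gamma>::real) (d::nat). 0 < \<gamma> \<and> \<gamma> < 1 \<longrightarrow>
        (\<exists>N::nat. \<forall>x\<in>(Cu :: 'a mat set set). \<forall>y\<in>Cu.
           cu_le x (cu_multiple d (cu_class mat_unit)) \<and>
           cu_le y (cu_multiple d (cu_class mat_unit)) \<and>
           cu_le (cu_class mat_unit) (cu_multiple d y) \<and>
           (\<forall>f\<in>functionals. cu_hat x f \<le> ennreal \<gamma> * cu_hat y f) \<longrightarrow>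
           cu_le_from N x y))"

section \<open>Dimension functions\<close>

text \<open>The block-diagonal sum of \<open>a \<in> M\<^sub>n(A)\<close> and \<open>b\<close>.\<close>

definition direct_sum :: "nat \<Rightarrow> 'a::cstar_algebra mat \<Rightarrow> 'a mat \<Rightarrow> 'a mat" where
  "direct_sum n a b =
     (\<lambda>i j. if i < n \<and> j < n then a i j else if n \<le> i \<and> n \<le> j then b (i - n) (j - n) else 0)"

text \<open>
  An element of \<open>M\<^sub>\<infinity>(A)\<close> lies in \<open>M\<^sub>n(A)\<close> for all large \<open>n\<close>, and additivity is required for the
  sum formed with any such \<open>n\<close>. Dimension functions are extensional, as elements of the
  product space over \<open>M\<^sub>\<infinity>(A)\<^sub>+\<close>.
\<close>

definition DF :: "('a::unital_cstar_algebra mat \<Rightarrow> real) set" where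
  "DF =
     {\<delta> \<in> positives finite_matrices \<rightarrow>\<^sub>E {0..}.
        (\<forall>n. \<forall>a\<in>positives (matrices n). \<forall>b\<in>positives finite_matrices.
           \<delta> (direct_sum n a b) = \<delta> a + \<delta> b) \<and>
        (\<forall>a\<in>positives finite_matrices. \<forall>b\<in>positives finite_matrices.
           cuntz_le finite_matrices a b \<longrightarrow> \<delta> a \<le> \<delta> b) \<and>
        \<delta> mat_unit = 1}"

definition DF_topology :: "('a::unital_cstar_algebra mat \<Rightarrow> real) topology" where
  "DF_topology =
     subtopology (product_topology (\<lambda>_. euclideanreal) (positives finite_matrices)) DF"

definition LDF :: "('a::unital_cstar_algebra mat \<Rightarrow> real) set" where
  "LDF =
     {\<delta> \<in> DF. \<forall>a\<in>positives finite_matrices. \<forall>t. t < \<delta> a \<longrightarrow>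
        (\<exists>\<epsilon>>0. \<forall>b\<in>positives finite_matrices.
           mat_norm (mat_diff b a) < ennreal \<epsilon> \<longrightarrow> t < \<delta> b)}"

end

theory Submission
  imports Defs
begin

text \<open>
  Suppose that \<open>\<delta> \<in> DF(A)\<close> is not in the closure of \<open>LDF(A)\<close>, which is convex. A finite-dimensional
  separation argument with integer coefficients yields \<open>x, y \<in> M\<^sub>\<infinity>(A)\<^sub>+\<close>, after adding copies of the
  unit to both sides, with \<open>\<lambda>(x) + 1 \<le> \<lambda>(y)\<close> for all \<open>\<lambda> \<in> LDF(A)\<close> but \<open>\<delta>(x) > \<delta>(y)\<close>, and with \<open>1\<close>
  Cuntz below \<open>y\<close>. Every functional that is finite and nonzero at \<open>[1]\<close> restricts, once normalized,
  to an element of \<open>LDF(A)\<close>; as \<open>\<lambda>(y) \<le> d\<close> for a fixed \<open>d\<close>, the gap \<open>1\<close> gives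
  \<open>\<lambda>(x) \<le> \<gamma> \<lambda>(y)\<close> for all functionals, with \<open>\<gamma> = 1 - 1/d\<close>. The comparison hypothesis then gives
  \<open>n [x] \<le> n [y]\<close> for large \<open>n\<close>, and applying \<open>\<delta>\<close> contradicts \<open>\<delta>(x) > \<delta>(y)\<close>.
\<close>

section \<open>Square roots in a C*-algebra\<close>

text \<open>The analytic weight lies in showing that a functional restricts to a lower
  semicontinuous function on matrices. For each positive a this takes an increasing sequence in
  Cu(A) with supremum [a], every term of which stays below [b] for all b close to a. It is built
  from square roots and positive parts alone, and these rest on norm estimates and one convergent
  iteration. To compare positive elements of M_n(A), M_infty(A) and A tensor K without changing
  type, all three are placed in one unital C*-algebra of infinite matrices. The separating
  coefficients must be integers because matrices can only be added as direct sums. Balancing the two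
  sides by whole copies of the unit costs a rounding by at most 1, so the separation is first scaled
  to a gap of 2; the remaining gap 1 is what the factor \<gamma> < 1 consumes. Functionals that are
  0 or infinite at [1] have no normalization; they are settled by x lying below a multiple of [1]
  and by [1] lying below y.\<close>

lemma norm_star [simp]: "norm (star x) = norm (x::'a::cstar_algebra)"
proof -
  have le: "norm x \<le> norm (star x)" for x :: 'a
  proof (cases "norm x = 0")
    case False
    have "norm x * norm x \<le> norm (star x) * norm x"
      using norm_mult_ineq[of "star x" x] by (simp add: norm_star_mult_self power2_eq_square)
    with False show ?thesis by simp
  qed simp
  from le[of x] le[of "star x"] show ?thesis by (simp add: star_star)
qed

lemma star_scaleR: "star (r *\<^sub>R x) = r *\<^sub>R star (x::'a::cstar_algebra)"
  by (metis complex_cnj_complex_of_real scaleC_complex_of_real star_scaleC)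

lemma bounded_linear_star: "bounded_linear (star :: 'a \<Rightarrow> 'a::cstar_algebra)"
  by (rule bounded_linear_intro[of _ 1]) (simp_all add: star_add star_scaleR)

lemmas star_zero [simp] = linear_0[OF bounded_linear.linear[OF bounded_linear_star]]
lemmas star_minus = linear_neg[OF bounded_linear.linear[OF bounded_linear_star]]
lemmas star_diff = linear_diff[OF bounded_linear.linear[OF bounded_linear_star]]
lemmas star_sum = linear_sum[OF bounded_linear.linear[OF bounded_linear_star]]
lemmas tendsto_star = bounded_linear.tendsto[OF bounded_linear_star]

declare star_star [simp]

lemma star_one [simp]: "star 1 = (1::'a::unital_cstar_algebra)"
  by (metis mult_1_right star_mult star_star)

lemma norm_one_le: "norm (1::'a::unital_cstar_algebra) \<le> 1"
proof -
  have "norm (1::'a) = (norm (1::'a))\<^sup>2"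
    using norm_star_mult_self[of "1::'a"] by simp
  thus ?thesis by (cases "norm (1::'a) = 0") (auto simp: power2_eq_square)
qed

lemma norm_scaleR_one_le: "0 \<le> t \<Longrightarrow> norm (t *\<^sub>R (1::'a::unital_cstar_algebra)) \<le> t"
  using mult_left_mono[OF norm_one_le, of t] by simp

lemma norm_self_adjoint_square:
  "star x = x \<Longrightarrow> norm (x * x) = norm (x::'a::cstar_algebra) * norm x"
  using norm_star_mult_self[of x] by (simp add: power2_eq_square)

lemma self_adjoint_square_eq_0: "star x = x \<Longrightarrow> x * x = 0 \<Longrightarrow> x = (0::'a::cstar_algebra)"
  using norm_self_adjoint_square[of x] by simp

lemma scaleC_ii_twice: "scaleC \<i> (scaleC \<i> x) = - (x::'a::cstar_algebra)"
proof -
  have "scaleC \<i> (scaleC \<i> x) = scaleC (complex_of_real (-1)) x"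
    by (simp add: scaleC_scaleC)
  also have "\<dots> = - x" by (subst scaleC_complex_of_real) simp
  finally show ?thesis .
qed

lemma scaleC_minus_left: "scaleC (- c) x = - scaleC c (x::'a::cstar_algebra)"
  by (metis add.right_inverse add_eq_0_iff scaleC_add_left scaleC_complex_of_real of_real_0
      scaleR_zero_left)

text \<open>Membership of b in the commutant of the commutant of a. It stands in for "b is a
  continuous function of a": the roots, positive parts and approximate units below carry it, and
  their commutation relations are derived from it.\<close>

definition bicomm :: "'a::times \<Rightarrow> 'a \<Rightarrow> bool" where
  "bicomm a b \<longleftrightarrow> (\<forall>x. a * x = x * a \<longrightarrow> b * x = x * b)"

lemma bicommD: "bicomm a b \<Longrightarrow> a * x = x * a \<Longrightarrow> b * x = x * b"
  by (simp add: bicomm_def)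

lemma bicomm_self_commute: "bicomm a b \<Longrightarrow> b * a = a * b"
  by (simp add: bicomm_def)

text \<open>
  The iteration \<open>w\<^sub>n\<^sub>+\<^sub>1 = (h + w\<^sub>n\<^sup>2) / 2\<close> converges to \<open>1 - (1 - h)\<^sup>1\<^sup>/\<^sup>2\<close>; on the
  boundary \<open>\<parallel>h\<parallel> = 1\<close> it is dominated by the monotone scalar iteration with \<open>h = 1\<close>.
\<close>

primrec sqrt_iter :: "'a::real_normed_algebra \<Rightarrow> nat \<Rightarrow> 'a" where
  "sqrt_iter h 0 = 0"
| "sqrt_iter h (Suc n) = (1/2) *\<^sub>R (h + sqrt_iter h n * sqrt_iter h n)"

lemma sqrt_iter_one: "0 \<le> sqrt_iter (1::real) n \<and> sqrt_iter (1::real) n \<le> 1"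
proof (induction n)
  case (Suc n)
  then have "sqrt_iter (1::real) n * sqrt_iter 1 n \<le> 1 * 1" by (intro mult_mono) auto
  with Suc show ?case by simp
qed simp

lemma sqrt_iter_commute:
  assumes "h * x = x * h"
  shows "sqrt_iter h n * x = x * sqrt_iter h n"
proof (induction n)
  case (Suc n)
  have "sqrt_iter h n * sqrt_iter h n * x = x * (sqrt_iter h n * sqrt_iter h n)"
    by (metis Suc mult.assoc)
  with assms show ?case by (simp add: distrib_left distrib_right)
qed simp

lemma sqrt_iter_self_commute: "sqrt_iter h m * sqrt_iter h n = sqrt_iter h n * sqrt_iter h m"
  using sqrt_iter_commute by metis

lemma norm_sqrt_iter:
  assumes "norm (h::'a::real_normed_algebra) \<le> 1"
  shows "norm (sqrt_iter h n) \<le> sqrt_iter 1 n"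
proof (induction n)
  case (Suc n)
  have "norm (sqrt_iter h n * sqrt_iter h n) \<le> sqrt_iter 1 n * sqrt_iter 1 n"
    using norm_mult_ineq[of "sqrt_iter h n" "sqrt_iter h n"] Suc
      mult_mono[OF Suc Suc] sqrt_iter_one[of n] by fastforce
  with assms norm_triangle_ineq[of h "sqrt_iter h n * sqrt_iter h n"] show ?case by simp
qed simp

text \<open>The iterates commute, so an increment is half the product of a difference and a sum of
  earlier iterates; both factors are dominated by their scalar counterparts.\<close>

lemma norm_sqrt_iter_diff:
  assumes h: "norm (h::'a::real_normed_algebra) \<le> 1"
  shows "norm (sqrt_iter h (Suc n) - sqrt_iter h n) \<le> sqrt_iter 1 (Suc n) - sqrt_iter 1 n"
proof (induction n)
  case 0
  show ?case using h by simp
next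
  case (Suc n)
  let ?w = "sqrt_iter h" and ?o = "sqrt_iter (1::real)"
  have "?w (Suc (Suc n)) - ?w (Suc n) =
      (1/2) *\<^sub>R ((?w (Suc n) - ?w n) * (?w (Suc n) + ?w n))"
    using sqrt_iter_self_commute[of h "Suc n" n]
    by (simp only: sqrt_iter.simps(2)[of h "Suc n"] sqrt_iter.simps(2)[of h n])
       (simp add: algebra_simps)
  also have "norm \<dots> \<le> (1/2) * ((?o (Suc n) - ?o n) * (?o (Suc n) + ?o n))"
  proof -
    have "norm (?w (Suc n) + ?w n) \<le> ?o (Suc n) + ?o n"
      using norm_triangle_mono norm_sqrt_iter[OF h] by blast
    then have "norm (?w (Suc n) - ?w n) * norm (?w (Suc n) + ?w n)
        \<le> (?o (Suc n) - ?o n) * (?o (Suc n) + ?o n)"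
      by (intro mult_mono Suc.IH order_trans[OF norm_ge_zero Suc.IH]) auto
    then have "norm ((?w (Suc n) - ?w n) * (?w (Suc n) + ?w n))
        \<le> (?o (Suc n) - ?o n) * (?o (Suc n) + ?o n)"
      using norm_mult_ineq order_trans by blast
    then show ?thesis by (simp del: sqrt_iter.simps)
  qed
  also have "\<dots> = ?o (Suc (Suc n)) - ?o (Suc n)"
    by (simp only: sqrt_iter.simps(2)[of 1 "Suc n"] sqrt_iter.simps(2)[of 1 n])
       (simp add: algebra_simps)
  finally show ?case .
qed

lemma convergent_sqrt_iter:
  assumes h: "norm (h::'a::{banach,real_normed_algebra}) \<le> 1"
  shows "convergent (sqrt_iter h)"
proof -
  \<comment> \<open>The scalar increments dominate norms, hence are nonnegative.\<close>
  have inc: "incseq (sqrt_iter (1::real))"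
  proof (rule incseq_SucI)
    fix n show "sqrt_iter (1::real) n \<le> sqrt_iter 1 (Suc n)"
      using order_trans[OF norm_ge_zero norm_sqrt_iter_diff[OF h, of n]] by (simp del:
          sqrt_iter.simps)
  qed
  have "convergent (sqrt_iter (1::real))"
  proof (rule Bseq_monoseq_convergent)
    show "Bseq (sqrt_iter (1::real))" using sqrt_iter_one by (intro BseqI'[of _ 1]) auto
    show "monoseq (sqrt_iter (1::real))" using inc by (simp add: monoseq_iff)
  qed
  then have "summable (\<lambda>n. sqrt_iter (1::real) (Suc n) - sqrt_iter 1 n)"
    unfolding convergent_def using telescope_summable by blast
  then have "summable (\<lambda>n. sqrt_iter h (Suc n) - sqrt_iter h n)"
    by (rule summable_comparison_test'[where N = 0]) (rule norm_sqrt_iter_diff[OF h])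
  then have "convergent (\<lambda>n. \<Sum>k<n. sqrt_iter h (Suc k) - sqrt_iter h k)"
    by (simp add: summable_iff_convergent)
  then show ?thesis by (simp add: sum_lessThan_telescope del: sqrt_iter.simps(2))
qed

text \<open>The algebra may lack a unit, so the root of 1 - h is carried by its complement w; the
  equation is (1 - w)^2 = 1 - h with the unit cancelled.\<close>

lemma sqrt_one_minus:
  assumes h: "norm (h::'a::cstar_algebra) \<le> 1" and sa: "star h = h"
  obtains w where "norm w \<le> 1" "star w = w" "2 *\<^sub>R w = h + w * w"
    "bicomm h w"
proof
  define w where "w = lim (sqrt_iter h)"
  have lim: "sqrt_iter h \<longlonglongrightarrow> w"
    unfolding w_def using convergent_sqrt_iter[OF h] by (simp add: convergent_LIMSEQ_iff)
  have "norm (sqrt_iter h n) \<le> 1" for n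
    using norm_sqrt_iter[OF h, of n] sqrt_iter_one[of n] by linarith
  then show "norm w \<le> 1" by (intro LIMSEQ_le_const2[OF tendsto_norm[OF lim]]) auto
  have "star (sqrt_iter h n) = sqrt_iter h n" for n
    by (induction n) (simp_all add: star_scaleR star_add star_mult sa)
  then have "sqrt_iter h \<longlonglongrightarrow> star w" using tendsto_star[OF lim] by simp
  then show "star w = w" using LIMSEQ_unique[OF lim] by metis
  have "(\<lambda>n. (1/2) *\<^sub>R (h + sqrt_iter h n * sqrt_iter h n)) \<longlonglongrightarrow> (1/2) *\<^sub>R (h + w * w)"
    by (intro tendsto_intros lim)
  then have "w = (1/2) *\<^sub>R (h + w * w)"
    by (rule LIMSEQ_unique[OF LIMSEQ_Suc[OF lim, unfolded sqrt_iter.simps]])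
  then have "2 *\<^sub>R w = 2 *\<^sub>R ((1/2) *\<^sub>R (h + w * w))" by (rule arg_cong)
  then show "2 *\<^sub>R w = h + w * w" by simp
  have "w * x = x * w" if "h * x = x * h" for x
  proof (rule LIMSEQ_unique)
    show "(\<lambda>n. sqrt_iter h n * x) \<longlonglongrightarrow> w * x" by (intro tendsto_intros lim)
    show "(\<lambda>n. sqrt_iter h n * x) \<longlonglongrightarrow> x * w"
      unfolding sqrt_iter_commute[OF that] by (intro tendsto_intros lim)
  qed
  then show "bicomm h w" by (simp add: bicomm_def)
qed

section \<open>Positive elements\<close>

text \<open>For self-adjoint a the norm bound says that the spectrum lies in [0, 2t]. In this form
  sums are handled by the triangle inequality, and 1 - a/t is at once in the domain of the square
  root iteration.\<close>

definition pos_elem :: "'a::unital_cstar_algebra \<Rightarrow> bool" where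
  "pos_elem a \<longleftrightarrow> star a = a \<and> (\<exists>t\<ge>0. norm (t *\<^sub>R 1 - a) \<le> t)"

lemma scaleC_diff_right: "scaleC c (x - y) = scaleC c x - scaleC c (y::'a::cstar_algebra)"
  using scaleC_add_right[of c "x - y" y] by simp

lemma pos_elem_self_adjoint: "pos_elem a \<Longrightarrow> star a = a"
  by (simp add: pos_elem_def)

lemma pos_elem_add: "pos_elem a \<Longrightarrow> pos_elem b \<Longrightarrow> pos_elem (a + b)"
proof -
  assume a: "pos_elem a" and b: "pos_elem b"
  then obtain s t where st: "s \<ge> 0" "norm (s *\<^sub>R 1 - a) \<le> s" "t \<ge> 0" "norm (t *\<^sub>R 1 - b) \<le> t"
    unfolding pos_elem_def by blast
  have "norm ((s + t) *\<^sub>R 1 - (a + b)) \<le> s + t"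
    using norm_triangle_mono[OF st(2) st(4)] by (simp add: algebra_simps)
  with a b st show ?thesis unfolding pos_elem_def by (metis add_nonneg_nonneg star_add)
qed

lemma pos_elem_scaleR: "pos_elem a \<Longrightarrow> 0 \<le> r \<Longrightarrow> pos_elem (r *\<^sub>R a)"
proof -
  assume a: "pos_elem a" and r: "0 \<le> r"
  then obtain t where t: "t \<ge> 0" "norm (t *\<^sub>R 1 - a) \<le> t"
    unfolding pos_elem_def by blast
  have "norm ((r * t) *\<^sub>R 1 - r *\<^sub>R a) = r * norm (t *\<^sub>R 1 - a)"
  proof -
    have "(r * t) *\<^sub>R 1 - r *\<^sub>R a = r *\<^sub>R (t *\<^sub>R 1 - a)" by (simp add: scaleR_diff_right)
    then show ?thesis using r by simp
  qed
  then have "norm ((r * t) *\<^sub>R 1 - r *\<^sub>R a) \<le> r * t" using t(2) r by (simp add: mult_left_mono)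
  with a r t show ?thesis unfolding pos_elem_def by (metis mult_nonneg_nonneg star_scaleR)
qed

lemma pos_elem_zero [simp]: "pos_elem 0"
  by (auto simp: pos_elem_def intro!: exI[of _ 0])

lemma pos_elem_one [simp]: "pos_elem 1"
  by (auto simp: pos_elem_def intro!: exI[of _ 1])

lemma pos_elem_sqrt:
  assumes "pos_elem (a::'a::unital_cstar_algebra)"
  obtains b where "pos_elem b" "b * b = a" "bicomm a b"
proof -
  from assms obtain t where t: "t \<ge> 0" "norm (t *\<^sub>R 1 - a) \<le> t" and sa: "star a = a"
    unfolding pos_elem_def by blast
  show thesis
  proof (cases "t = 0")
    case True
    with t have "a = 0" by simp
    then show thesis using that[of 0] by (simp add: bicomm_def)
  next
    case False
    \<comment> \<open>Positivity with radius t puts h in the unit ball; the root of a is then sqrt t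
      times 1 - w.\<close>
    define h where "h = 1 - (1/t) *\<^sub>R a"
    have "h = (1/t) *\<^sub>R (t *\<^sub>R 1 - a)" using False by (simp add: h_def algebra_simps)
    then have "norm h = (1/t) * norm (t *\<^sub>R 1 - a)" using t(1) by simp
    also have "\<dots> \<le> (1/t) * t" using t by (intro mult_left_mono) auto
    finally have nh: "norm h \<le> 1" using False by simp
    have "star h = h" using sa by (simp add: h_def star_diff star_scaleR)
    then obtain w where w: "norm w \<le> 1" "star w = w" "2 *\<^sub>R w = h + w * w"
      "bicomm h w" by (rule sqrt_one_minus[OF nh])
    define b where "b = sqrt t *\<^sub>R (1 - w)"
    have "(1 - w) * (1 - w) = 1 - 2 *\<^sub>R w + w * w" by (simp add: algebra_simps scaleR_2)
    also have "\<dots> = (1/t) *\<^sub>R a" unfolding w(3) by (simp add: h_def)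
    finally have "b * b = a" using t(1) False by (simp add: b_def)
    moreover have "pos_elem b"
    proof -
      have "norm (sqrt t *\<^sub>R 1 - b) = sqrt t * norm w" using t(1) by (simp add: b_def algebra_simps)
      then have "norm (sqrt t *\<^sub>R 1 - b) \<le> sqrt t" using w(1) t(1) by (simp add: mult_left_le)
      moreover have "star b = b" using w(2) by (simp add: b_def star_scaleR star_diff)
      ultimately show ?thesis using t(1) unfolding pos_elem_def by (metis real_sqrt_ge_zero)
    qed
    moreover have "bicomm a b" unfolding bicomm_def
    proof (intro allI impI)
      fix x assume that: "a * x = x * a"
      have "h * x = x * h" using that by (simp add: h_def algebra_simps)
      then have "w * x = x * w" by (rule bicommD[OF w(4)])
      then show "b * x = x * b" by (simp add: b_def algebra_simps)
    qed
    ultimately show thesis using that by blast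
  qed
qed

text \<open>With \<open>z = (1 - b\<^sup>2)\<^sup>1\<^sup>/\<^sup>2\<close>, the element \<open>b + \<i>z\<close> is unitary.\<close>

lemma complementary_sqrt:
  assumes b: "star b = (b::'a::unital_cstar_algebra)" "norm b \<le> 1"
  obtains z where "star z = z" "b * b + z * z = 1" "norm z \<le> 1"
    "bicomm b z"
proof -
  have nb: "norm (b * b) \<le> 1"
    using b by (simp add: norm_self_adjoint_square mult_le_one)
  have "star (b * b) = b * b" using b by (simp add: star_mult)
  then obtain w where "norm w \<le> 1" and w: "star w = w" "2 *\<^sub>R w = b * b + w * w"
    "bicomm (b * b) w" by (rule sqrt_one_minus[OF nb])
  define z where "z = 1 - w"
  have sa: "star z = z" using w by (simp add: z_def star_diff)
  have "z * z = 1 - 2 *\<^sub>R w + w * w" by (simp add: z_def algebra_simps scaleR_2)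
  then have sum: "b * b + z * z = 1" unfolding w(2) by simp
  have comm: "bicomm b z" unfolding bicomm_def
  proof (intro allI impI)
    fix x assume that: "b * x = x * b"
    have "b * b * x = x * (b * b)" by (metis that mult.assoc)
    then have "w * x = x * w" by (rule bicommD[OF w(3)])
    then show "z * x = x * z" by (simp add: z_def algebra_simps)
  qed
  define u where "u = b + scaleC \<i> z"
  have su: "star u = b - scaleC \<i> z"
    using b sa by (simp add: u_def star_add star_scaleC scaleC_minus_left)
  have zb: "z * b = b * z" by (rule bicomm_self_commute[OF comm])
  have "star u * u = b * b + z * z"
    unfolding su unfolding u_def
    by (simp add: algebra_simps mult_scaleC_left mult_scaleC_right zb scaleC_ii_twice
        scaleC_diff_right)
  then have "norm u * norm u \<le> 1"
    using norm_star_mult_self[of u] norm_one_le[where ?'a = 'a] sum by (simp add: power2_eq_square)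
  then have nu: "norm u \<le> 1" by (simp add: abs_square_le_1 flip: power2_eq_square)
  \<comment> \<open>z is recovered as the imaginary part of the contraction u, which gives the bound
    1; the formula z = 1 - w alone would only give 2.\<close>
  have "u - star u = scaleC \<i> (2 *\<^sub>R z)"
    unfolding su by (simp add: u_def scaleR_2 scaleC_add_right)
  then have "2 * norm z = norm (u - star u)" by (simp add: norm_scaleC)
  also have "\<dots> \<le> norm u + norm (star u)" by (rule norm_triangle_ineq4)
  finally have "norm z \<le> 1" using nu by simp
  then show thesis using that sa sum comm by blast
qed

text \<open>Since t - b^2 = z^2 with norm at most t, the element z certifies positivity of b^2, and
  for positive a = b^2 also positivity of t - a.\<close>

lemma square_bounds:
  assumes b: "star b = (b::'a::unital_cstar_algebra)" and t: "norm (b * b) \<le> t"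
  obtains z where "star z = z" "b * b + z * z = t *\<^sub>R 1" "norm (z * z) \<le> t"
    "bicomm b z"
proof (cases "t = 0")
  case True
  with t have "b = 0" using self_adjoint_square_eq_0[OF b] by simp
  then show thesis using that[of 0] True by (simp add: bicomm_def)
next
  case False
  with t have t0: "t > 0" using norm_ge_zero[of "b * b"] by linarith
  define c where "c = (1 / sqrt t) *\<^sub>R b"
  have "norm b \<le> sqrt t"
    using t by (simp add: norm_self_adjoint_square[OF b] real_le_rsqrt power2_eq_square)
  then have nc: "norm c \<le> 1" using t0 by (simp add: c_def)
  have "star c = c" using b by (simp add: c_def star_scaleR)
  then obtain z where z: "star z = z" "c * c + z * z = 1" "norm z \<le> 1"
    "bicomm c z" using nc by (rule complementary_sqrt)
  show thesis
  proof (rule that[of "sqrt t *\<^sub>R z"])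
    show "star (sqrt t *\<^sub>R z) = sqrt t *\<^sub>R z" using z by (simp add: star_scaleR)
    have "b * b = t *\<^sub>R (c * c)" using t0 by (simp add: c_def)
    then have "b * b + sqrt t *\<^sub>R z * sqrt t *\<^sub>R z = t *\<^sub>R (c * c + z * z)"
      using t0 by (simp add: scaleR_add_right)
    then show "b * b + sqrt t *\<^sub>R z * sqrt t *\<^sub>R z = t *\<^sub>R 1" unfolding z(2) .
    have "norm (z * z) \<le> 1" using z by (simp add: norm_self_adjoint_square mult_le_one)
    then show "norm (sqrt t *\<^sub>R z * sqrt t *\<^sub>R z) \<le> t" using t0 by (simp add: mult_left_le)
    show "bicomm b (sqrt t *\<^sub>R z)" using z(4) by (simp add: bicomm_def c_def)
  qed
qed

lemma pos_elem_square: "star b = b \<Longrightarrow> pos_elem (b * b)"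
proof -
  assume b: "star b = b"
  obtain z where z: "star z = z" "b * b + z * z = norm (b * b) *\<^sub>R 1" "norm (z * z) \<le> norm (b * b)"
    using square_bounds[OF b order_refl] by metis
  then have "norm (norm (b * b) *\<^sub>R 1 - b * b) \<le> norm (b * b)"
    by (metis add_diff_cancel_left')
  then show ?thesis using b unfolding pos_elem_def by (metis norm_ge_zero star_mult)
qed

lemma pos_elem_diff_norm: "pos_elem a \<Longrightarrow> norm a \<le> t \<Longrightarrow> pos_elem (t *\<^sub>R 1 - a)"
proof -
  assume a: "pos_elem a" "norm a \<le> t"
  obtain b where b: "pos_elem b" "b * b = a" using pos_elem_sqrt[OF a(1)] by metis
  then obtain z where "star z = z" "b * b + z * z = t *\<^sub>R 1"
    using square_bounds[OF pos_elem_self_adjoint[OF b(1)], of t] a(2) by metis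
  then show ?thesis using pos_elem_square[of z] b(2) by (metis add_diff_cancel_left')
qed

text \<open>With commuting roots b of a and z of t - a, the element u = b + iz satisfies
  \<open>star u * u\<close> = t, so its real part b has norm at most sqrt t.\<close>

lemma norm_le_of_pos_elem_diff:
  assumes "pos_elem a" "pos_elem (t *\<^sub>R 1 - (a::'a::unital_cstar_algebra))" "0 \<le> t"
  shows "norm a \<le> t"
proof -
  obtain b where b: "pos_elem b" "b * b = a" "bicomm a b"
    by (rule pos_elem_sqrt[OF assms(1)])
  obtain z where z: "pos_elem z" "z * z = t *\<^sub>R 1 - a"
    "bicomm (t *\<^sub>R 1 - a) z"
    by (rule pos_elem_sqrt[OF assms(2)])
  have sb: "star b = b" "star z = z" using b z pos_elem_self_adjoint by auto
  have "a * b = b * a" using b(2) by (metis mult.assoc)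
  then have zb: "z * b = b * z" by (intro bicommD[OF z(3)]) (simp add: algebra_simps)
  define u where "u = b + scaleC \<i> z"
  have su: "star u = b - scaleC \<i> z"
    using sb by (simp add: u_def star_add star_scaleC scaleC_minus_left)
  have "star u * u = b * b + z * z"
    unfolding su unfolding u_def
    by (simp add: algebra_simps mult_scaleC_left mult_scaleC_right zb scaleC_ii_twice
        scaleC_diff_right)
  also have "\<dots> = t *\<^sub>R 1" using b z by simp
  finally have "(norm u)\<^sup>2 \<le> t"
    using norm_star_mult_self[of u] norm_scaleR_one_le[OF assms(3), where ?'a = 'a] by simp
  then have nu: "norm u \<le> sqrt t" using real_le_rsqrt by blast
  have "u + star u = 2 *\<^sub>R b" unfolding su by (simp add: u_def scaleR_2)
  then have "2 * norm b = norm (u + star u)" by simp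
  also have "\<dots> \<le> norm u + norm (star u)" by (rule norm_triangle_ineq)
  finally have "norm b \<le> sqrt t" using nu by simp
  then have "norm b * norm b \<le> sqrt t * sqrt t" using assms(3) by (intro mult_mono) auto
  then show ?thesis using norm_self_adjoint_square[OF sb(1)] b(2) assms(3) by simp
qed

lemma norm_mono:
  assumes "pos_elem a" "pos_elem (b - (a::'a::unital_cstar_algebra))"
  shows "norm a \<le> norm b"
proof (rule norm_le_of_pos_elem_diff[OF assms(1)])
  have "pos_elem b" using pos_elem_add[OF assms] by simp
  then have "pos_elem (norm b *\<^sub>R 1 - b)" by (rule pos_elem_diff_norm) simp
  from pos_elem_add[OF this assms(2)] show "pos_elem (norm b *\<^sub>R 1 - a)" by simp
qed simp

lemma pos_elem_antisym: "pos_elem a \<Longrightarrow> pos_elem (- a) \<Longrightarrow> a = (0::'a::unital_cstar_algebra)"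
  using norm_mono[of a 0] by simp

text \<open>The roots x and y commute by \<open>bicomm\<close>, so the product is the square of the
  self-adjoint element x y.\<close>

lemma pos_elem_mult_commute:
  assumes "pos_elem a" "pos_elem b" "a * b = b * a"
  shows "pos_elem (a * b)"
proof -
  obtain x where x: "pos_elem x" "x * x = a" "bicomm a x"
    by (rule pos_elem_sqrt[OF assms(1)])
  obtain y where y: "pos_elem y" "y * y = b" "bicomm b y"
    by (rule pos_elem_sqrt[OF assms(2)])
  have "x * b = b * x" by (rule bicommD[OF x(3)]) fact
  then have xy: "y * x = x * y" using bicommD[OF y(3)] by metis
  then have "star (x * y) = x * y" using x y by (simp add: star_mult pos_elem_self_adjoint)
  then have "pos_elem ((x * y) * (x * y))" by (rule pos_elem_square)
  also have "(x * y) * (x * y) = a * b" using x(2) y(2) xy by (metis mult.assoc)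
  finally show ?thesis .
qed

section \<open>Orthogonal decomposition and positivity of \<open>star x * x\<close>\<close>

lemma pos_neg_parts:
  assumes s: "star s = (s::'a::unital_cstar_algebra)"
  obtains u v where "star u = u" "star v = v" "s = u - v" "u * v = 0" "v * u = 0"
    "pos_elem (u + v)" "bicomm s u" "bicomm s v"
proof -
  obtain r where r: "pos_elem r" "r * r = s * s" "bicomm (s * s) r"
    by (rule pos_elem_sqrt[OF pos_elem_square[OF s]])
  have rs: "r * s = s * r" by (rule bicommD[OF r(3)]) (simp add: mult.assoc)
  have sr: "star r = r" using r by (simp add: pos_elem_self_adjoint)
  \<comment> \<open>These are (|s| + s)/2 and (|s| - s)/2 with r = |s|. Only their sum is known to
    be positive so far, which suffices for \<open>pos_elem_star_mult_self\<close>; positivity of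
    each part follows in \<open>pos_part_properties\<close>.\<close>
  let ?u = "(1/2) *\<^sub>R (r + s)" and ?v = "(1/2) *\<^sub>R (r - s)"
  show thesis
  proof (rule that[of ?u ?v])
    show "star ?u = ?u" "star ?v = ?v" by (simp_all add: star_scaleR star_add star_diff s sr)
    show "s = ?u - ?v" by (simp add: scaleR_add_right scaleR_diff_right flip: scaleR_add_left)
    show "?u * ?v = 0" "?v * ?u = 0" by (simp_all add: algebra_simps rs r(2))
    have "?u + ?v = r" by (simp add: scaleR_add_right scaleR_diff_right flip: scaleR_add_left)
    then show "pos_elem (?u + ?v)" using r by simp
    have *: "r * x = x * r" if "s * x = x * s" for x
      by (rule bicommD[OF r(3)]) (metis that mult.assoc)
    then show "bicomm s ?u" "bicomm s ?v"
      by (simp_all add: bicomm_def distrib_left distrib_right left_diff_distrib right_diff_distrib)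
  qed
qed

lemma pos_elem_sandwich: "pos_elem a \<Longrightarrow> star x = x \<Longrightarrow> a * x = x * a \<Longrightarrow> pos_elem (x * a * x)"
proof -
  assume a: "pos_elem a" and x: "star x = x" "a * x = x * a"
  have "pos_elem (a * (x * x))"
    by (rule pos_elem_mult_commute[OF a pos_elem_square[OF x(1)]]) (metis mult.assoc x(2))
  then show ?thesis by (metis mult.assoc x(2))
qed

lemma scaleC_scaleR: "scaleC c (r *\<^sub>R x) = r *\<^sub>R scaleC c (x::'a::cstar_algebra)"
  by (metis mult.commute scaleC_complex_of_real scaleC_scaleC)

text \<open>Writing x = p - iq with p and q self-adjoint, the mixed terms of the two products cancel
  and 2p^2 + 2q^2 remains.\<close>

lemma pos_elem_sum_conj: "pos_elem (x * star x + star x * (x::'a::unital_cstar_algebra))"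
proof -
  define p q where "p = (1/2) *\<^sub>R (x + star x)" and "q = (1/2) *\<^sub>R scaleC \<i> (x - star x)"
  have p: "star p = p" by (simp add: p_def star_scaleR star_add add.commute)
  have q: "star q = q"
    by (simp add: q_def star_scaleC star_scaleR star_diff scaleC_minus_left scaleR_diff_right
        scaleC_diff_right)
  have "2 *\<^sub>R (p * p) = (1/2) *\<^sub>R ((x + star x) * (x + star x))" by (simp add: p_def)
  moreover have "2 *\<^sub>R (q * q) = - (1/2) *\<^sub>R ((x - star x) * (x - star x))"
    by (simp add: q_def mult_scaleC_left mult_scaleC_right scaleC_ii_twice scaleC_scaleR)
  moreover have "(1/2) *\<^sub>R ((x + star x) * (x + star x)) + - (1/2) *\<^sub>R ((x - star x) * (x - star x))
      = x * star x + star x * x"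
    by (simp add: algebra_simps flip: scaleR_add_left)
  ultimately have "x * star x + star x * x = 2 *\<^sub>R (p * p) + 2 *\<^sub>R (q * q)" by simp
  then show ?thesis
    using p q by (simp add: pos_elem_add pos_elem_scaleR pos_elem_square)
qed

text \<open>
  Taking \<open>p = w w\<^sup>*\<close> and \<open>s = - w\<^sup>* w\<close>, the element \<open>v = w s\<^sup>1\<^sup>/\<^sup>2\<close> satisfies
  \<open>v v\<^sup>* = - p\<^sup>2\<close> and \<open>v\<^sup>* v = - s\<^sup>2\<close>, although \<open>v v\<^sup>* + v\<^sup>* v\<close> is positive.
\<close>

lemma star_mult_self_neg_eq_0:
  assumes s: "pos_elem (- (star w * w))"
  shows "w = (0::'a::unital_cstar_algebra)"
proof -
  define s where "s = - (star w * w)"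
  define p where "p = w * star w"
  have "pos_elem (p + star w * w + s)"
    unfolding p_def s_def by (rule pos_elem_add[OF pos_elem_sum_conj s])
  then have p: "pos_elem p" by (simp add: s_def)
  obtain r where r: "pos_elem r" "r * r = s" using pos_elem_sqrt[OF s] unfolding s_def by metis
  have sr: "star r = r" using r by (simp add: pos_elem_self_adjoint)
  define v where "v = w * r"
  have "v * star v = w * s * star w" by (simp add: v_def star_mult sr mult.assoc r(2)[symmetric])
  then have v1: "v * star v = - (p * p)" by (simp add: s_def p_def mult.assoc)
  have "star v * v = r * (star w * w) * r" by (simp add: v_def star_mult sr mult.assoc)
  also have "star w * w = - (r * r)" by (simp add: r(2) s_def)
  also have "r * - (r * r) * r = - (s * s)" unfolding r(2)[symmetric] by (simp add: mult.assoc)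
  finally have v2: "star v * v = - (s * s)" .
  have sp: "star p = p" "star s = s" by (simp_all add: p_def s_def star_mult star_minus)
  have "pos_elem (- (p * p + s * s))" using pos_elem_sum_conj[of v] unfolding v1 v2 by simp
  moreover have "pos_elem (p * p + s * s)" using sp by (simp add: pos_elem_add pos_elem_square)
  ultimately have "p * p + s * s = 0" by (rule pos_elem_antisym[rotated])
  moreover have "norm (s * s) \<le> norm (p * p + s * s)"
    by (rule norm_mono[OF pos_elem_square[OF sp(2)]]) (simp add: pos_elem_square sp)
  ultimately have "norm (s * s) \<le> 0" by simp
  then have "s = 0" using self_adjoint_square_eq_0[OF sp(2)] by simp
  then have "star w * w = 0" by (simp add: s_def)
  then show ?thesis using norm_star_mult_self[of w] by simp
qed

text \<open>Let v be the negative part of s = \<open>star x * x\<close>. Then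
  \<open>star (x * v) * (x * v)\<close> equals - v^3, so \<open>star_mult_self_neg_eq_0\<close>
  kills x v as soon as v^3 is known to be positive, and v = 0 follows.\<close>

theorem pos_elem_star_mult_self: "pos_elem (star x * (x::'a::unital_cstar_algebra))"
proof -
  define s where "s = star x * x"
  have ss: "star s = s" by (simp add: s_def star_mult)
  obtain u v where uv: "star u = u" "star v = v" "s = u - v" "u * v = 0" "v * u = 0" "pos_elem (u
      + v)"
    using pos_neg_parts[OF ss] by metis
  have "star (x * v) * (x * v) = v * s * v" by (simp add: s_def star_mult uv mult.assoc)
  also have "\<dots> = - (v * v * v)" by (simp add: uv(3) algebra_simps uv(4,5))
  finally have e: "star (x * v) * (x * v) = - (v * v * v)" .
  \<comment> \<open>v^3 is obtained by compressing u + v = |s|, because positivity of v itself is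
    not yet available.\<close>
  have "pos_elem (v * (u + v) * v)"
    by (rule pos_elem_sandwich[OF uv(6) uv(2)]) (simp add: algebra_simps uv)
  then have "pos_elem (v * v * v)" by (simp add: algebra_simps uv)
  then have "x * v = 0" using star_mult_self_neg_eq_0[of "x * v"] e by simp
  then have "v * v * v = 0" using e by simp
  then have "(v * v) * (v * v) = 0" by (simp flip: mult.assoc)
  then have "v * v = 0" by (rule self_adjoint_square_eq_0[rotated]) (simp add: star_mult uv)
  then have "v = 0" by (rule self_adjoint_square_eq_0[OF uv(2)])
  then show ?thesis using uv(3,6) by (simp add: s_def)
qed

lemma pos_elem_iff: "pos_elem a \<longleftrightarrow> (\<exists>x. a = star x * x)"
  using pos_elem_star_mult_self pos_elem_sqrt pos_elem_self_adjoint by metis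

lemma pos_elem_conj: "pos_elem a \<Longrightarrow> pos_elem (star x * a * x)"
proof -
  assume "pos_elem a"
  then obtain y where "a = star y * y" unfolding pos_elem_iff by blast
  then have "star x * a * x = star (y * x) * (y * x)" by (simp add: star_mult mult.assoc)
  then show ?thesis using pos_elem_star_mult_self by metis
qed

lemma pos_elem_conj': "pos_elem a \<Longrightarrow> pos_elem (x * a * star x)"
  using pos_elem_conj[of a "star x"] by simp

lemma pos_elem_sum: "(\<And>i. i \<in> I \<Longrightarrow> pos_elem (f i)) \<Longrightarrow> pos_elem (sum f I)"
  by (induction I rule: infinite_finite_induct) (auto intro: pos_elem_add)

lemma self_adjoint_le_norm:
  assumes "star s = (s::'a::unital_cstar_algebra)" "norm s \<le> t"
  shows "pos_elem (t *\<^sub>R 1 - s)"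
proof -
  have "t \<ge> 0" using assms(2) norm_ge_zero order_trans by blast
  then show ?thesis unfolding pos_elem_def
    using assms by (intro conjI exI[of _ t]) (simp_all add: star_diff star_scaleR)
qed

lemma pos_part_properties:
  assumes s: "star s = (s::'a::unital_cstar_algebra)"
  obtains u v where "pos_elem u" "pos_elem v" "s = u - v" "u * v = 0" "v * u = 0"
    "bicomm s u" "bicomm s v"
proof -
  \<comment> \<open>If n is the negative part of y, then y^3 = y (x + y) y is positive and its
    compression by n is - n^5, whereas n^2 (p + n) n^2 = n^5 is positive as well. So n^5 = 0 and n =
    0.\<close>
  have pos: "pos_elem y" if xy: "star x = x" "star y = y" "x * y = 0" "y * x = 0" "pos_elem (x + y)"
    for x y :: 'a
  proof -
    obtain p n where pn: "star p = p" "star n = n" "y = p - n" "p * n = 0" "n * p = 0" "pos_elem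
        (p + n)"
        "bicomm y n"
      using pos_neg_parts[OF xy(2)] by metis
    have yn: "n * y = y * n" using bicomm_self_commute[OF pn(7)] .
    have "pos_elem (y * (x + y) * y)"
      by (rule pos_elem_sandwich[OF xy(5) xy(2)]) (simp add: algebra_simps xy)
    then have "pos_elem (y * y * y)" by (simp add: algebra_simps xy)
    then have "pos_elem (n * (y * y * y) * n)"
      by (rule pos_elem_sandwich[OF _ pn(2)]) (metis mult.assoc yn)
    moreover have "n * (y * y * y) * n = - (n * n * n * n * n)"
    proof -
      have "n * y = - (n * n)" by (simp add: pn(3) algebra_simps pn)
      then show ?thesis by (metis (no_types, lifting) mult.assoc mult_minus_left mult_minus_right
          minus_minus yn)
    qed
    ultimately have 1: "pos_elem (- (n * n * n * n * n))" by simp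
    have "pos_elem ((n * n) * (p + n) * (n * n))"
      by (rule pos_elem_sandwich[OF pn(6)])
        (simp_all add: star_mult pn algebra_simps, metis mult.assoc mult_zero_left pn(4))
    moreover have "(n * n) * (p + n) * (n * n) = n * n * n * n * n"
      by (simp add: algebra_simps pn)
    ultimately have "n * n * n * n * n = 0" using 1 pos_elem_antisym by metis
    then have "(n * n * (n * n)) * (n * n * (n * n)) = 0" by (metis mult.assoc mult_zero_left)
    then have "n * n * (n * n) = 0" by (rule self_adjoint_square_eq_0[rotated]) (simp add:
        star_mult pn)
    then have "n * n = 0" by (rule self_adjoint_square_eq_0[rotated]) (simp add: star_mult pn)
    then have "n = 0" by (rule self_adjoint_square_eq_0[OF pn(2)])
    then show ?thesis using pn by simp
  qed
  obtain u v where uv: "star u = u" "star v = v" "s = u - v" "u * v = 0" "v * u = 0"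
    "pos_elem (u + v)" "bicomm s u" "bicomm s v" by (rule pos_neg_parts[OF s])
  moreover have "pos_elem v" by (rule pos[OF uv(1,2,4,5,6)])
  moreover have "pos_elem u" using pos[OF uv(2,1,5,4)] uv(6) by (simp add: add.commute)
  ultimately show thesis using that by blast
qed

section \<open>Cut-downs and approximate units\<close>

lemma cutdown:
  assumes a: "pos_elem (a::'a::unital_cstar_algebra)" and e: "\<epsilon> \<ge> 0"
  obtains u where "pos_elem u" "bicomm a u" "norm (a - u) \<le> \<epsilon>"
    "u * (a - \<epsilon> *\<^sub>R 1) * u = u * u * u"
proof -
  have "star (a - \<epsilon> *\<^sub>R 1) = a - \<epsilon> *\<^sub>R 1"
    using a by (simp add: star_diff star_scaleR pos_elem_self_adjoint)
  then obtain u v where uv: "pos_elem u" "pos_elem v" "a - \<epsilon> *\<^sub>R 1 = u - v" "u * v = 0" "v * u = 0"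
    "bicomm (a - \<epsilon> *\<^sub>R 1) u" "bicomm (a - \<epsilon> *\<^sub>R 1) v" by (rule pos_part_properties)
  have bi: "bicomm a u" "bicomm a v" using uv(6,7) by (auto simp: bicomm_def algebra_simps)
  have va: "v * a = a * v" using bicomm_self_commute[OF bi(2)] .
  have ea: "a = u - v + \<epsilon> *\<^sub>R 1" using uv(3) by (simp add: algebra_simps)
  \<comment> \<open>Here a - u = \<epsilon> - v. Adding (\<epsilon> - v)^2 to the positive element v
    a = v (\<epsilon> - v) gives \<epsilon> (\<epsilon> - v), hence v \<le> \<epsilon>. Dividing by
    \<epsilon> is what forces the case split on \<epsilon> = 0.\<close>
  have "pos_elem (v * a)" using pos_elem_mult_commute[OF uv(2) a va] .
  moreover have "v * a = v * (\<epsilon> *\<^sub>R 1 - v)" unfolding ea by (simp add: algebra_simps uv)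
  moreover have "pos_elem ((\<epsilon> *\<^sub>R 1 - v) * (\<epsilon> *\<^sub>R 1 - v))"
    using uv(2) by (intro pos_elem_square) (simp add: star_diff star_scaleR pos_elem_self_adjoint)
  ultimately have "pos_elem (v * (\<epsilon> *\<^sub>R 1 - v) + (\<epsilon> *\<^sub>R 1 - v) * (\<epsilon> *\<^sub>R 1 - v))"
    by (simp add: pos_elem_add)
  also have "v * (\<epsilon> *\<^sub>R 1 - v) + (\<epsilon> *\<^sub>R 1 - v) * (\<epsilon> *\<^sub>R 1 - v) = \<epsilon> *\<^sub>R (\<epsilon> *\<^sub>R 1 - v)"
    by (simp add: algebra_simps)
  finally have *: "pos_elem (\<epsilon> *\<^sub>R (\<epsilon> *\<^sub>R 1 - v))" .
  have "norm (\<epsilon> *\<^sub>R 1 - v) \<le> \<epsilon>"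
  proof (cases "\<epsilon> = 0")
    case True
    then have "pos_elem (- (v * v))" using \<open>pos_elem (v * a)\<close> \<open>v * a = v * (\<epsilon> *\<^sub>R 1 - v)\<close> by simp
    then have "v * v = 0" using pos_elem_antisym[OF pos_elem_square[of v]] uv(2)
        pos_elem_self_adjoint by blast
    then have "v = 0" using self_adjoint_square_eq_0 uv(2) pos_elem_self_adjoint by blast
    then show ?thesis using True by simp
  next
    case False
    then have "pos_elem (\<epsilon> *\<^sub>R 1 - v)" using pos_elem_scaleR[OF *, of "1 / \<epsilon>"] e by simp
    then show ?thesis using uv(2) e by (intro norm_le_of_pos_elem_diff) simp_all
  qed
  moreover have "a - u = \<epsilon> *\<^sub>R 1 - v" unfolding ea by simp
  ultimately have "norm (a - u) \<le> \<epsilon>" by simp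
  moreover have "u * (a - \<epsilon> *\<^sub>R 1) * u = u * u * u" unfolding uv(3) by (simp add: algebra_simps uv)
  ultimately show thesis using that uv(1) bi(1) by blast
qed

lemma pos_elem_power: "pos_elem a \<Longrightarrow> pos_elem (a ^ n)"
  by (induction n) (auto intro!: pos_elem_mult_commute simp: power_commutes)

lemma pos_elem_one_minus_power:
  assumes "pos_elem (z::'a::unital_cstar_algebra)" "pos_elem (1 - z)"
  shows "pos_elem (1 - z ^ n)"
proof (induction n)
  case (Suc n)
  have "pos_elem (z * (1 - z ^ n))"
    using assms(1) Suc by (rule pos_elem_mult_commute) (simp add: algebra_simps power_commutes)
  from pos_elem_add[OF assms(2) this] show ?case by (simp add: algebra_simps)
qed simp

text \<open>
  For \<open>0 \<le> a \<le> 1\<close> and \<open>z = 1 - a\<close>, the bound \<open>\<parallel>a z\<^sup>m\<parallel> \<le> 1 / (m + 1)\<close> comes from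
  \<open>(m + 1) a z\<^sup>m \<le> \<Sum>\<^sub>i\<^sub>\<le>\<^sub>m a z\<^sup>i = 1 - z\<^sup>m\<^sup>+\<^sup>1 \<le> 1\<close>.
\<close>

lemma norm_mult_one_minus_power:
  assumes a: "pos_elem (a::'a::unital_cstar_algebra)" "pos_elem (1 - a)"
  shows "norm (a * (1 - a) ^ m) \<le> 1 / (real m + 1)"
proof -
  define z where "z = 1 - a"
  have z: "pos_elem z" "pos_elem (1 - z)" using a by (simp_all add: z_def)
  have az: "a * z = z * a" by (simp add: z_def algebra_simps)
  have azn: "a * z ^ n = z ^ n * a" for n
    by (induction n) (simp_all add: az, metis az mult.assoc)
  have sum: "(\<Sum>i\<le>m. a * z ^ i) = 1 - z ^ Suc m"
    by (induction m) (simp_all add: z_def algebra_simps power_commutes)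
  have mono: "pos_elem (a * z ^ i - a * z ^ m)" if "i \<le> m" for i
  proof -
    have "pos_elem (a * z ^ i)"
      by (rule pos_elem_mult_commute[OF a(1) pos_elem_power[OF z(1)] azn])
    moreover have "pos_elem (1 - z ^ (m - i))" by (rule pos_elem_one_minus_power[OF z])
    moreover have "a * z ^ i * (1 - z ^ (m - i)) = (1 - z ^ (m - i)) * (a * z ^ i)"
    proof -
      have "a * z ^ i * z ^ (m - i) = z ^ (m - i) * (a * z ^ i)"
        by (metis azn mult.assoc power_add add.commute)
      then show ?thesis by (simp add: algebra_simps)
    qed
    ultimately have "pos_elem (a * z ^ i * (1 - z ^ (m - i)))" by (rule pos_elem_mult_commute)
    also have "a * z ^ i * (1 - z ^ (m - i)) = a * z ^ i - a * z ^ m"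
      using that by (simp add: right_diff_distrib mult.assoc flip: power_add)
    finally show ?thesis .
  qed
  have "pos_elem ((\<Sum>i\<le>m. a * z ^ i - a * z ^ m) + z ^ Suc m)"
    by (intro pos_elem_add pos_elem_sum mono pos_elem_power z) simp
  also have "(\<Sum>i\<le>m. a * z ^ i - a * z ^ m) + z ^ Suc m = 1 - (real m + 1) *\<^sub>R (a * z ^ m)"
    unfolding sum_subtractf sum by (simp add: sum_constant_scaleR algebra_simps)
  finally have "pos_elem (1 *\<^sub>R 1 - (real m + 1) *\<^sub>R (a * z ^ m))" by simp
  moreover have "pos_elem ((real m + 1) *\<^sub>R (a * z ^ m))"
    by (intro pos_elem_scaleR pos_elem_mult_commute[OF a(1) pos_elem_power[OF z(1)] azn]) simp
  ultimately have "norm ((real m + 1) *\<^sub>R (a * z ^ m)) \<le> 1"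
    by (intro norm_le_of_pos_elem_diff) auto
  then have "(real m + 1) * norm (a * z ^ m) \<le> 1" by (simp only: norm_scaleR)
  then show ?thesis by (simp add: z_def field_simps)
qed

text \<open>The element a q is an approximate unit for a. Keeping the polynomial q apart matters: q
  has a constant term, but a q stays in the subalgebras that contain a.\<close>

lemma approx_unit:
  assumes a: "pos_elem (a::'a::unital_cstar_algebra)" and e: "\<epsilon> > 0"
  obtains q where "pos_elem q" "bicomm a q" "pos_elem (1 - a * q)" "norm (1 - a * q) \<le> 1"
    "norm (a * (1 - a * q)) \<le> \<epsilon>"
proof -
  define t where "t = norm a + 1"
  have t: "t > 0" "norm a \<le> t" by (simp_all add: t_def add_nonneg_pos)
  define b where "b = (1 / t) *\<^sub>R a"
  have b: "pos_elem b" using a t by (simp add: b_def pos_elem_scaleR)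
  have "pos_elem ((1/t) *\<^sub>R (t *\<^sub>R 1 - a))"
    using pos_elem_diff_norm[OF a t(2)] t by (intro pos_elem_scaleR) auto
  then have b1: "pos_elem (1 - b)" using t by (simp add: b_def scaleR_diff_right)
  obtain m :: nat where m: "t / \<epsilon> < real m" using reals_Archimedean2 by blast
  \<comment> \<open>Truncated geometric series for the inverse of a, so that 1 - a q collapses to (1
    - b)^m; the choice m > t/\<epsilon> makes t/(m + 1) at most \<epsilon>. The 1 added in t keeps t
    positive when a = 0.\<close>
  define q where "q = (1 / t) *\<^sub>R (\<Sum>i<m. (1 - b) ^ i)"
  have "b * (\<Sum>i<m. (1 - b) ^ i) = 1 - (1 - b) ^ m"
    by (induction m) (simp_all add: algebra_simps power_commutes)
  then have aq: "1 - a * q = (1 - b) ^ m" by (simp add: q_def b_def)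
  show thesis
  proof (rule that[of q])
    show "pos_elem q" unfolding q_def using t
      by (intro pos_elem_scaleR pos_elem_sum pos_elem_power b1) auto
    have "(1 - b) ^ i * x = x * (1 - b) ^ i" if "a * x = x * a" for x i
    proof (induction i)
      case (Suc i)
      have "(1 - b) * x = x * (1 - b)" using that by (simp add: b_def algebra_simps)
      then show ?case using Suc by (metis mult.assoc power_Suc)
    qed simp
    then show "bicomm a q"
      by (simp add: bicomm_def q_def sum_distrib_left sum_distrib_right)
    show p: "pos_elem (1 - a * q)" unfolding aq by (rule pos_elem_power[OF b1])
    have "pos_elem (1 *\<^sub>R 1 - (1 - b) ^ m)"
      using pos_elem_one_minus_power[OF b1, of m] b by simp
    then show "norm (1 - a * q) \<le> 1"
      using p unfolding aq by (intro norm_le_of_pos_elem_diff) auto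
    have "norm (a * (1 - a * q)) = t * norm (b * (1 - b) ^ m)"
      unfolding aq using t by (simp add: b_def)
    also have "\<dots> \<le> t * (1 / (real m + 1))"
      using norm_mult_one_minus_power[OF b b1] t by (intro mult_left_mono) auto
    also have "\<dots> \<le> \<epsilon>"
    proof -
      have "t < \<epsilon> * real m" using m e by (simp add: field_simps)
      then have "t \<le> \<epsilon> * (real m + 1)" using e by (simp add: algebra_simps)
      then show ?thesis by (simp add: field_simps)
    qed
    finally show "norm (a * (1 - a * q)) \<le> \<epsilon>" .
  qed
qed

section \<open>Matrices as operators on the Hilbert modules \<open>A\<^sup>n\<close>\<close>

definition ip :: "nat \<Rightarrow> (nat \<Rightarrow> 'a) \<Rightarrow> (nat \<Rightarrow> 'a) \<Rightarrow> 'a::cstar_algebra" where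
  "ip n v w = (\<Sum>i<n. star (v i) * w i)"

lemma vec_norm_square: "(vec_norm n v)\<^sup>2 = norm (ip n v v)"
  by (simp add: vec_norm_def ip_def)

lemma vec_norm_nonneg [simp]: "0 \<le> vec_norm n v"
  by (simp add: vec_norm_def)

lemma vec_norm_cong: "(\<And>i. i < n \<Longrightarrow> v i = w i) \<Longrightarrow> vec_norm n v = vec_norm n w"
  by (simp add: vec_norm_def)

lemma vec_norm_zero [simp]: "vec_norm n (\<lambda>i. 0) = 0"
  by (simp add: vec_norm_def)

lemma vec_norm_leI: "norm (ip n v v) \<le> C\<^sup>2 \<Longrightarrow> 0 \<le> C \<Longrightarrow> vec_norm n v \<le> C"
  by (metis power2_le_imp_le vec_norm_square)

lemma pos_elem_ip: "pos_elem (ip n v v)"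
  unfolding ip_def by (intro pos_elem_sum pos_elem_star_mult_self)

lemma ip_add_left: "ip n (\<lambda>i. v i + v' i) w = ip n v w + ip n v' w"
  by (simp add: ip_def star_add distrib_right sum.distrib)

lemma ip_add_right: "ip n w (\<lambda>i. v i + v' i) = ip n w v + ip n w v'"
  by (simp add: ip_def distrib_left sum.distrib)

lemma star_ip: "star (ip n v w) = ip n w v"
  by (simp add: ip_def star_sum star_mult)

lemma ip_scaleR_left: "ip n (\<lambda>i. r *\<^sub>R v i) w = r *\<^sub>R ip n v w"
  by (simp add: ip_def star_scaleR scaleR_sum_right)

lemma ip_scaleR_right: "ip n v (\<lambda>i. r *\<^sub>R w i) = r *\<^sub>R ip n v w"
  by (simp add: ip_def scaleR_sum_right)

lemma ip_mult_right: "ip n v (\<lambda>i. w i * c) = ip n v w * c"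
  by (simp add: ip_def sum_distrib_right mult.assoc)

lemma ip_mult_left: "ip n (\<lambda>i. v i * c) w = star c * ip n v w"
  by (simp add: ip_def sum_distrib_left mult.assoc star_mult)

lemma vec_norm_scaleR: "vec_norm n (\<lambda>i. r *\<^sub>R v i) = \<bar>r\<bar> * vec_norm n v"
proof -
  have "(vec_norm n (\<lambda>i. r *\<^sub>R v i))\<^sup>2 = (\<bar>r\<bar> * vec_norm n v)\<^sup>2"
  proof -
    have "(vec_norm n (\<lambda>i. r *\<^sub>R v i))\<^sup>2 = norm (r *\<^sub>R r *\<^sub>R ip n v v)"
      by (simp only: vec_norm_square ip_scaleR_left ip_scaleR_right)
    also have "\<dots> = \<bar>r\<bar>\<^sup>2 * (vec_norm n v)\<^sup>2"
      by (simp only: norm_scaleR vec_norm_square) (simp add: power2_eq_square)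
    finally show ?thesis by (simp only: power_mult_distrib)
  qed
  then show ?thesis by (simp add: power2_eq_iff_nonneg)
qed

text \<open>Deleting entries or truncating removes from the inner product a sum of terms
  \<open>star (w i) * w i\<close>, which is positive.\<close>

lemma vec_norm_mono:
  fixes v :: "nat \<Rightarrow> 'a::unital_cstar_algebra"
  assumes "\<And>i. i < n \<Longrightarrow> v i = 0 \<or> v i = w i" "n \<le> m"
  shows "vec_norm n v \<le> vec_norm m w"
proof -
  have "pos_elem ((\<Sum>i<m. if i < n \<and> v i \<noteq> 0 then 0 else star (w i) * w i))"
    by (intro pos_elem_sum) (simp add: pos_elem_star_mult_self)
  also have "(\<Sum>i<m. if i < n \<and> v i \<noteq> 0 then 0 else star (w i) * w i)
      = (\<Sum>i<m. star (w i) * w i - (if i < n then star (v i) * v i else 0))"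
    using assms(1) by (intro sum.cong) force+
  also have "\<dots> = ip m w w - ip n v v"
    using assms(2)
    by (simp add: sum_subtractf ip_def sum.If_cases Int_absorb1 lessThan_def[symmetric]
        lessThan_subset_iff
        flip: lessThan_def)
  finally have "norm (ip n v v) \<le> norm (ip m w w)"
    by (intro norm_mono pos_elem_ip)
  then show ?thesis by (simp add: vec_norm_def ip_def)
qed

lemma norm_le_vec_norm:
  fixes v :: "nat \<Rightarrow> 'a::unital_cstar_algebra"
  assumes "i < n"
  shows "norm (v i) \<le> vec_norm n v"
proof -
  have "ip n (\<lambda>j. if j = i then v j else 0) (\<lambda>j. if j = i then v j else 0)
      = (\<Sum>j<n. if j = i then star (v j) * v j else 0)"
    unfolding ip_def by (rule sum.cong) auto
  also have "\<dots> = star (v i) * v i" using assms by (simp add: sum.delta)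
  finally have "(vec_norm n (\<lambda>j. if j = i then v j else 0))\<^sup>2 = (norm (v i))\<^sup>2"
    by (simp add: vec_norm_square norm_star_mult_self)
  then have "vec_norm n (\<lambda>j. if j = i then v j else 0) = norm (v i)" by simp
  moreover have "vec_norm n (\<lambda>j. if j = i then v j else 0) \<le> vec_norm n v"
    by (rule vec_norm_mono) auto
  ultimately show ?thesis by simp
qed

lemma Cauchy_Schwarz:
  fixes v w :: "nat \<Rightarrow> 'a::unital_cstar_algebra"
  shows "norm (ip n v w) \<le> vec_norm n v * vec_norm n w"
proof -
  \<comment> \<open>With b = <v, w>, expand the inner square of v b - w and add the positive element
    \<open>star b\<close> (1 - <v, v>) b; what remains is <w, w> -
    \<open>star b * b\<close>.\<close>
  have unit: "norm (ip n v w) \<le> vec_norm n w" if v: "norm (ip n v v) \<le> 1"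
    for v w :: "nat \<Rightarrow> 'a"
  proof -
    define b where "b = ip n v w"
    let ?d = "\<lambda>i. v i * b + (- 1) *\<^sub>R w i"
    have "ip n ?d ?d = star b * ip n v v * b - star b * b - star b * b + ip n w w"
      unfolding ip_add_left ip_add_right ip_mult_left ip_mult_right ip_scaleR_left ip_scaleR_right
        b_def[symmetric] star_ip[of n v w, symmetric]
      by (simp add: algebra_simps)
    moreover have "pos_elem (ip n ?d ?d)" by (rule pos_elem_ip)
    moreover have "pos_elem (star b * (1 *\<^sub>R 1 - ip n v v) * b)"
      by (intro pos_elem_conj pos_elem_diff_norm pos_elem_ip v)
    ultimately have "pos_elem (star b * ip n v v * b - star b * b - star b * b + ip n w w
        + star b * (1 *\<^sub>R 1 - ip n v v) * b)"
      using pos_elem_add by metis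
    then have "pos_elem (ip n w w - star b * b)" by (simp add: algebra_simps)
    then have "norm (star b * b) \<le> norm (ip n w w)"
      by (intro norm_mono pos_elem_star_mult_self)
    then have "(norm b)\<^sup>2 \<le> (vec_norm n w)\<^sup>2" by (simp add: norm_star_mult_self vec_norm_square)
    then show ?thesis unfolding b_def by (rule power2_le_imp_le) simp
  qed
  show ?thesis
  proof (cases "vec_norm n v = 0")
    case True
    then have "v i = 0" if "i < n" for i using norm_le_vec_norm[OF that, of v] by simp
    then have "ip n v w = 0" by (simp add: ip_def)
    then show ?thesis by simp
  next
    case False
    let ?s = "vec_norm n v"
    have s: "?s > 0" using False by (simp add: order_less_le)
    have "norm (ip n (\<lambda>i. (1 / ?s) *\<^sub>R v i) (\<lambda>i. (1 / ?s) *\<^sub>R v i)) = (vec_norm n (\<lambda>i. (1 / ?s)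
        *\<^sub>R v i))\<^sup>2"
      by (simp only: vec_norm_square)
    also have "\<dots> = 1" using s by (simp add: vec_norm_scaleR)
    finally have "norm (ip n (\<lambda>i. (1 / ?s) *\<^sub>R v i) w) \<le> vec_norm n w" by (intro unit) simp
    then show ?thesis using s by (simp add: ip_scaleR_left field_simps)
  qed
qed

lemma vec_norm_triangle:
  fixes v w :: "nat \<Rightarrow> 'a::unital_cstar_algebra"
  shows "vec_norm n (\<lambda>i. v i + w i) \<le> vec_norm n v + vec_norm n w"
proof (rule vec_norm_leI)
  have "norm (ip n (\<lambda>i. v i + w i) (\<lambda>i. v i + w i))
      \<le> norm (ip n v v) + norm (ip n v w) + norm (ip n w v) + norm (ip n w w)"
    unfolding ip_add_left ip_add_right
    using norm_triangle_ineq[of "ip n v v" "ip n v w"] norm_triangle_ineq[of "ip n w v" "ip n w w"]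
      norm_triangle_ineq[of "ip n v v + ip n v w" "ip n w v + ip n w w"]
    by linarith
  also have "\<dots> \<le> (vec_norm n v)\<^sup>2 + vec_norm n v * vec_norm n w + vec_norm n w * vec_norm n v +
      (vec_norm n w)\<^sup>2"
    by (intro add_mono Cauchy_Schwarz) (simp_all add: vec_norm_square)
  also have "\<dots> = (vec_norm n v + vec_norm n w)\<^sup>2" by (simp add: power2_eq_square algebra_simps)
  finally show "norm (ip n (\<lambda>i. v i + w i) (\<lambda>i. v i + w i)) \<le> (vec_norm n v + vec_norm n w)\<^sup>2" .
qed simp

lemma tendsto_vec_norm:
  assumes "\<And>i. (\<lambda>k. V k i) \<longlonglongrightarrow> v i"
  shows "(\<lambda>k. vec_norm n (V k)) \<longlonglongrightarrow> vec_norm n (v :: nat \<Rightarrow> 'a::cstar_algebra)"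
  unfolding vec_norm_def by (intro tendsto_intros tendsto_star assms)

section \<open>Bounded matrices and their products\<close>

definition mat_vec :: "nat \<Rightarrow> 'a mat \<Rightarrow> (nat \<Rightarrow> 'a) \<Rightarrow> nat \<Rightarrow> 'a::cstar_algebra" where
  "mat_vec n a v = (\<lambda>i. \<Sum>j<n. a i j * v j)"

text \<open>Homogeneous real form of a bound on \<open>mat_norm\<close>, equivalent to it by
  \<open>mat_bound_iff\<close>, so that estimates stay in the reals.\<close>

definition mat_bound :: "'a::cstar_algebra mat \<Rightarrow> real \<Rightarrow> bool" where
  "mat_bound a C \<longleftrightarrow> 0 \<le> C \<and> (\<forall>n v. vec_norm n (mat_vec n a v) \<le> C * vec_norm n v)"

lemma mat_bound_iff:
  fixes a :: "'a::unital_cstar_algebra mat"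
  shows "mat_bound a C \<longleftrightarrow> 0 \<le> C \<and> mat_norm a \<le> ennreal C"
proof (intro iffI conjI)
  assume b: "mat_bound a C"
  then show "0 \<le> C" by (simp add: mat_bound_def)
  show "mat_norm a \<le> ennreal C"
    unfolding mat_norm_def
  proof (intro SUP_least)
    fix n and v :: "nat \<Rightarrow> 'a" assume "v \<in> {v. vec_norm n v \<le> 1}"
    then have "vec_norm n (mat_vec n a v) \<le> C * 1"
      using b order_trans[OF _ mult_left_mono] unfolding mat_bound_def by blast
    then show "ennreal (vec_norm n (\<lambda>i. \<Sum>j<n. a i j * v j)) \<le> ennreal C"
      by (simp add: mat_vec_def ennreal_leI)
  qed
next
  assume C: "0 \<le> C \<and> mat_norm a \<le> ennreal C"
  have unit: "vec_norm n (mat_vec n a v) \<le> C" if "vec_norm n v \<le> 1" for n v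
  proof -
    have "ennreal (vec_norm n (mat_vec n a v)) \<le> mat_norm a"
      unfolding mat_norm_def mat_vec_def using that by (intro SUP_upper2[of n] SUP_upper2[of v])
          auto
    then have "ennreal (vec_norm n (mat_vec n a v)) \<le> ennreal C" using C order_trans by blast
    with C show ?thesis by (simp only: ennreal_le_iff)
  qed
  have "vec_norm n (mat_vec n a v) \<le> C * vec_norm n v" for n v
  proof (cases "vec_norm n v = 0")
    case True
    then have "v i = 0" if "i < n" for i using norm_le_vec_norm[OF that, of v] by simp
    then have "mat_vec n a v = (\<lambda>i. 0)" by (simp add: mat_vec_def)
    then show ?thesis by (simp add: True)
  next
    case False
    let ?s = "vec_norm n v"
    have s: "?s > 0" using False by (simp add: order_less_le)
    have "vec_norm n (mat_vec n a (\<lambda>i. (1 / ?s) *\<^sub>R v i)) \<le> C"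
      using s by (intro unit) (simp add: vec_norm_scaleR)
    also have "mat_vec n a (\<lambda>i. (1 / ?s) *\<^sub>R v i) = (\<lambda>i. (1 / ?s) *\<^sub>R mat_vec n a v i)"
      by (simp add: mat_vec_def scaleR_sum_right)
    finally show ?thesis using s by (simp add: vec_norm_scaleR field_simps)
  qed
  with C show "mat_bound a C" by (simp add: mat_bound_def)
qed

lemma mat_bound_nonneg: "mat_bound a C \<Longrightarrow> 0 \<le> C"
  by (simp add: mat_bound_def)

lemma mat_bound_mono: "mat_bound a C \<Longrightarrow> C \<le> D \<Longrightarrow> mat_bound a D"
  unfolding mat_bound_def by (meson mult_right_mono order_trans vec_norm_nonneg)

text \<open>Padding v by zeros up to \<open>max n m\<close> turns a rectangular block into a
  corner.\<close>

lemma vec_norm_mat_vec: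
  fixes a :: "'a::unital_cstar_algebra mat"
  assumes "mat_bound a C"
  shows "vec_norm n (mat_vec m a v) \<le> C * vec_norm m v"
proof -
  let ?N = "max n m" and ?v = "\<lambda>j. if j < m then v j else 0"
  have "mat_vec ?N a ?v = mat_vec m a v"
    unfolding mat_vec_def by (intro ext sum.mono_neutral_cong_right) auto
  then have "vec_norm n (mat_vec m a v) \<le> vec_norm ?N (mat_vec ?N a ?v)"
    by (intro vec_norm_mono) auto
  also have "\<dots> \<le> C * vec_norm ?N ?v" using assms by (simp add: mat_bound_def)
  also have "ip ?N ?v ?v = ip m v v"
    unfolding ip_def by (intro sum.mono_neutral_cong_right) auto
  then have "vec_norm ?N ?v = vec_norm m v" by (simp add: vec_norm_def ip_def)
  finally show ?thesis .
qed

lemma vec_norm_single_one: "vec_norm n (\<lambda>k. if k = j then 1 else 0 :: 'a::unital_cstar_algebra) \<le> 1"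
proof (rule vec_norm_leI)
  have "ip n (\<lambda>k. if k = j then 1 else 0 :: 'a) (\<lambda>k. if k = j then 1 else 0) = (\<Sum>k<n. if k = j
      then 1 else 0)"
    unfolding ip_def by (rule sum.cong) auto
  also have "norm \<dots> \<le> 1" by (simp add: sum.delta norm_one_le)
  finally show "norm (ip n (\<lambda>k. if k = j then 1 else 0 :: 'a) (\<lambda>k. if k = j then 1 else 0)) \<le> 1\<^sup>2"
      by simp
qed simp

lemma vec_norm_column:
  fixes a :: "'a::unital_cstar_algebra mat"
  assumes "mat_bound a C"
  shows "vec_norm n (\<lambda>i. a i j) \<le> C"
proof -
  have "mat_vec (Suc j) a (\<lambda>k. if k = j then 1 else 0) i = a i j" for i
  proof -
    have "mat_vec (Suc j) a (\<lambda>k. if k = j then 1 else 0) i = (\<Sum>k<Suc j. if k = j then a i k else 0)"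
      unfolding mat_vec_def by (rule sum.cong) auto
    then show ?thesis by simp
  qed
  then have "mat_vec (Suc j) a (\<lambda>k. if k = j then 1 else 0) = (\<lambda>i. a i j)" by auto
  then have "vec_norm n (\<lambda>i. a i j) \<le> C * vec_norm (Suc j) (\<lambda>k. if k = j then 1 else 0 :: 'a)"
    using vec_norm_mat_vec[OF assms] by metis
  also have "\<dots> \<le> C * 1" by (intro mult_left_mono vec_norm_single_one mat_bound_nonneg[OF assms])
  finally show ?thesis by simp
qed

lemma norm_entry_le:
  fixes a :: "'a::unital_cstar_algebra mat"
  shows "mat_bound a C \<Longrightarrow> norm (a i j) \<le> C"
  using vec_norm_column[of a C "Suc i" j] norm_le_vec_norm[of i "Suc i" "\<lambda>i. a i j"] by auto

lemma mat_bound_add: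
  fixes a :: "'a::unital_cstar_algebra mat"
  assumes "mat_bound a C" "mat_bound b D"
  shows "mat_bound (mat_add a b) (C + D)"
  unfolding mat_bound_def
proof (intro conjI allI)
  show "0 \<le> C + D" using assms by (simp add: mat_bound_def)
  fix n v
  have "mat_vec n (mat_add a b) v = (\<lambda>i. mat_vec n a v i + mat_vec n b v i)"
    by (simp add: mat_vec_def mat_add_def distrib_right sum.distrib)
  then have "vec_norm n (mat_vec n (mat_add a b) v) \<le> vec_norm n (mat_vec n a v) + vec_norm n
      (mat_vec n b v)"
    using vec_norm_triangle by metis
  also have "\<dots> \<le> C * vec_norm n v + D * vec_norm n v"
    using assms by (intro add_mono) (simp_all add: mat_bound_def)
  finally show "vec_norm n (mat_vec n (mat_add a b) v) \<le> (C + D) * vec_norm n v"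
    by (simp add: algebra_simps)
qed

lemma vec_norm_scaleC: "vec_norm n (\<lambda>i. scaleC c (v i)) = cmod c * vec_norm n v"
proof -
  have "ip n (\<lambda>i. scaleC c (v i)) (\<lambda>i. scaleC c (v i)) = (\<Sum>i<n. (cmod c)\<^sup>2 *\<^sub>R (star (v i) * v i))"
    unfolding ip_def
  proof (rule sum.cong)
    fix i
    have "star (scaleC c (v i)) * scaleC c (v i) = scaleC (cnj c * c) (star (v i) * v i)"
      by (simp add: star_scaleC mult_scaleC_left mult_scaleC_right scaleC_scaleC mult.commute)
    also have "cnj c * c = complex_of_real ((cmod c)\<^sup>2)"
      by (metis complex_norm_square mult.commute)
    finally show "star (scaleC c (v i)) * scaleC c (v i) = (cmod c)\<^sup>2 *\<^sub>R (star (v i) * v i)"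
      by (simp only: scaleC_complex_of_real)
  qed simp
  then have "(vec_norm n (\<lambda>i. scaleC c (v i)))\<^sup>2 = (cmod c * vec_norm n v)\<^sup>2"
    by (simp add: vec_norm_square power_mult_distrib ip_def flip: scaleR_sum_right)
  then show ?thesis by (simp add: power2_eq_iff_nonneg)
qed

lemma mat_bound_scaleC:
  assumes "mat_bound a C"
  shows "mat_bound (\<lambda>i j. scaleC c (a i j)) (cmod c * C)"
  unfolding mat_bound_def
proof (intro conjI allI)
  show "0 \<le> cmod c * C" using assms by (simp add: mat_bound_def)
  fix n v
  have "scaleC c (\<Sum>j<n. f j) = (\<Sum>j<n. scaleC c (f j))" for f :: "nat \<Rightarrow> 'a"
  proof (induction n)
    case 0
    have "scaleC c (0::'a) = scaleC c (0 *\<^sub>R 0)" by simp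
    also have "\<dots> = 0" by (simp only: scaleC_scaleR) simp
    finally show ?case by simp
  qed (simp add: scaleC_add_right)
  then have "mat_vec n (\<lambda>i j. scaleC c (a i j)) v = (\<lambda>i. scaleC c (mat_vec n a v i))"
    by (simp add: mat_vec_def mult_scaleC_left)
  then show "vec_norm n (mat_vec n (\<lambda>i j. scaleC c (a i j)) v) \<le> cmod c * C * vec_norm n v"
    using assms by (simp add: vec_norm_scaleC mat_bound_def mult_left_mono mult.assoc)
qed

lemma mat_bound_zero: "mat_bound (\<lambda>i j. 0) 0"
  by (simp add: mat_bound_def mat_vec_def)

lemma ip_mat_adj: "ip m (mat_vec n (mat_adj a) v) w = ip n v (mat_vec m a w)"
proof -
  have "ip m (mat_vec n (mat_adj a) v) w = (\<Sum>i<m. \<Sum>j<n. star (v j) * a j i * w i)"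
    by (simp add: ip_def mat_vec_def mat_adj_def star_sum star_mult sum_distrib_right)
  also have "\<dots> = (\<Sum>j<n. \<Sum>i<m. star (v j) * a j i * w i)" by (rule sum.swap)
  finally show ?thesis by (simp add: ip_def mat_vec_def sum_distrib_left mult.assoc)
qed

text \<open>For w the image of v under the adjoint, <w, w> = <v, a w>, and one factor of the norm of
  w cancels.\<close>

lemma mat_bound_adj:
  fixes a :: "'a::unital_cstar_algebra mat"
  assumes "mat_bound a C"
  shows "mat_bound (mat_adj a) C"
  unfolding mat_bound_def
proof (intro conjI allI)
  show C: "0 \<le> C" using assms by (simp add: mat_bound_def)
  fix n v
  define w where "w = mat_vec n (mat_adj a) v"
  have "ip n w w = ip n v (mat_vec n a w)" unfolding w_def by (rule ip_mat_adj)
  then have "(vec_norm n w)\<^sup>2 \<le> vec_norm n v * vec_norm n (mat_vec n a w)"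
    unfolding vec_norm_square using Cauchy_Schwarz by metis
  also have "\<dots> \<le> vec_norm n v * (C * vec_norm n w)"
    using assms by (intro mult_left_mono) (simp_all add: mat_bound_def)
  finally have "vec_norm n w * vec_norm n w \<le> (C * vec_norm n v) * vec_norm n w"
    by (simp add: power2_eq_square algebra_simps)
  then show "vec_norm n w \<le> C * vec_norm n v"
    using C by (cases "vec_norm n w = 0") (auto simp: order_less_le)
qed

lemma mat_bound_limit:
  fixes a :: "'a::unital_cstar_algebra mat"
  assumes "\<And>i j. (\<lambda>k. A k i j) \<longlonglongrightarrow> a i j" "\<And>k. N \<le> k \<Longrightarrow> mat_bound (A k) C"
  shows "mat_bound a C"
  unfolding mat_bound_def
proof (intro conjI allI)
  show "0 \<le> C" using assms(2) mat_bound_nonneg by blast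
  fix n v
  have "(\<lambda>k. vec_norm n (mat_vec n (A k) v)) \<longlonglongrightarrow> vec_norm n (mat_vec n a v)"
    unfolding mat_vec_def by (intro tendsto_vec_norm tendsto_intros assms)
  then show "vec_norm n (mat_vec n a v) \<le> C * vec_norm n v"
    by (rule LIMSEQ_le_const2) (use assms(2) in \<open>auto simp: mat_bound_def\<close>)
qed

text \<open>Cutting the inner sum at K makes the product a composition through A^K; bounds are
  proved there and pass to the entrywise limit by \<open>mat_bound_limit\<close>.\<close>

definition partial_mult :: "nat \<Rightarrow> 'a mat \<Rightarrow> 'a mat \<Rightarrow> 'a::cstar_algebra mat" where
  "partial_mult K a b = (\<lambda>i j. \<Sum>k<K. a i k * b k j)"

lemma mat_vec_partial_mult: "mat_vec n (partial_mult K a b) v = mat_vec K a (mat_vec n b v)"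
proof
  fix i
  have "mat_vec n (partial_mult K a b) v i = (\<Sum>j<n. \<Sum>k<K. a i k * b k j * v j)"
    by (simp add: mat_vec_def partial_mult_def sum_distrib_right)
  also have "\<dots> = (\<Sum>k<K. \<Sum>j<n. a i k * b k j * v j)" by (rule sum.swap)
  finally show "mat_vec n (partial_mult K a b) v i = mat_vec K a (mat_vec n b v) i"
    by (simp add: mat_vec_def sum_distrib_left mult.assoc)
qed

lemma partial_mult_limit:
  assumes "\<And>i j. summable (\<lambda>k. a i k * b k j)"
  shows "(\<lambda>K. partial_mult K a b i j) \<longlonglongrightarrow> mat_mult a b i j"
  unfolding partial_mult_def mat_mult_def by (rule summable_LIMSEQ[OF assms])

lemma mat_bound_mult:
  fixes a :: "'a::unital_cstar_algebra mat"
  assumes a: "mat_bound a C" and b: "mat_bound b D"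
    and s: "\<And>i j. summable (\<lambda>k. a i k * b k j)"
  shows "mat_bound (mat_mult a b) (C * D)"
proof (rule mat_bound_limit[OF partial_mult_limit[OF s]])
  fix K
  have "vec_norm n (mat_vec n (partial_mult K a b) v) \<le> C * D * vec_norm n v" for n v
  proof -
    have "vec_norm n (mat_vec n (partial_mult K a b) v) \<le> C * vec_norm K (mat_vec n b v)"
      unfolding mat_vec_partial_mult by (rule vec_norm_mat_vec[OF a])
    also have "\<dots> \<le> C * (D * vec_norm n v)"
      by (intro mult_left_mono vec_norm_mat_vec b mat_bound_nonneg[OF a])
    finally show ?thesis by simp
  qed
  then show "mat_bound (partial_mult K a b) (C * D)"
    using mat_bound_nonneg[OF a] mat_bound_nonneg[OF b] by (simp add: mat_bound_def)
qed

text \<open>With the inner sum cut at K \<ge> n, the quadratic form of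
  \<open>mat_mult (mat_adj a) a\<close> at v is the inner square of the first K entries of a v,
  which dominates that of the first n. Letting K grow gives the nontrivial half of the
  C*-identity.\<close>

lemma mat_bound_cstar:
  fixes a :: "'a::unital_cstar_algebra mat"
  assumes E: "mat_bound (mat_mult (mat_adj a) a) E"
    and s: "\<And>i j. summable (\<lambda>k. mat_adj a i k * a k j)"
  shows "mat_bound a (sqrt E)"
  unfolding mat_bound_def
proof (intro conjI allI)
  have E0: "0 \<le> E" by (rule mat_bound_nonneg[OF E])
  then show "0 \<le> sqrt E" by simp
  fix n v
  let ?p = "mat_vec n (mat_mult (mat_adj a) a) v"
  have "norm (ip n (mat_vec n a v) (mat_vec n a v)) \<le> norm (ip n v ?p)"
  proof (rule LIMSEQ_le_const)
    have "(\<lambda>K. ip n v (mat_vec n (partial_mult K (mat_adj a) a) v)) \<longlonglongrightarrow> ip n v ?p"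
      unfolding ip_def mat_vec_def by (intro tendsto_intros partial_mult_limit[OF s])
    then show "(\<lambda>K. norm (ip n v (mat_vec n (partial_mult K (mat_adj a) a) v))) \<longlonglongrightarrow> norm (ip n v ?p)"
      by (rule tendsto_norm)
    have "norm (ip n (mat_vec n a v) (mat_vec n a v)) \<le> norm (ip n v (mat_vec n (partial_mult K
        (mat_adj a) a) v))"
      if "n \<le> K" for K
    proof -
      have "ip n v (mat_vec K (mat_adj a) (mat_vec n a v)) = ip K (mat_vec n a v) (mat_vec n a v)"
        using ip_mat_adj[of K n "mat_adj a" v "mat_vec n a v"] by (simp add: mat_adj_def)
      then show ?thesis
        unfolding mat_vec_partial_mult vec_norm_square[symmetric]
        using vec_norm_mono[of n "mat_vec n a v" "mat_vec n a v" K] that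
        by (simp flip: vec_norm_square)
    qed
    then show "\<exists>N. \<forall>K\<ge>N. norm (ip n (mat_vec n a v) (mat_vec n a v))
        \<le> norm (ip n v (mat_vec n (partial_mult K (mat_adj a) a) v))" by blast
  qed
  also have "\<dots> \<le> vec_norm n v * vec_norm n ?p" by (rule Cauchy_Schwarz)
  also have "\<dots> \<le> vec_norm n v * (E * vec_norm n v)"
    using E by (intro mult_left_mono) (simp_all add: mat_bound_def)
  also have "\<dots> = (sqrt E * vec_norm n v)\<^sup>2" using E0 by (simp add: power2_eq_square)
  finally show "vec_norm n (mat_vec n a v) \<le> sqrt E * vec_norm n v"
    using E0 by (intro vec_norm_leI) auto
qed

section \<open>Norm limits of row- and column-finite matrices\<close>

definition core_mat :: "'a::unital_cstar_algebra mat set" where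
  "core_mat = {a. (\<exists>C. mat_bound a C) \<and> (\<forall>i. finite {j. a i j \<noteq> 0}) \<and> (\<forall>j. finite {i. a i j \<noteq> 0})}"

text \<open>For arbitrary bounded matrices the series for an entry of a product need not converge in
  norm. In \<open>core_mat\<close> it is a finite sum, and convergence survives the norm closure,
  which also supplies completeness.\<close>

definition adjointable_mat :: "'a::unital_cstar_algebra mat set" where
  "adjointable_mat = {a. \<forall>\<epsilon>>0. \<exists>g\<in>core_mat. mat_bound (mat_diff a g) \<epsilon>}"

lemma mat_bound_uminus: "mat_bound a C \<Longrightarrow> mat_bound (\<lambda>i j. - a i j ::
    'a::cstar_algebra) C"
  unfolding mat_bound_def mat_vec_def by (simp add: sum_negf vec_norm_def star_minus)

lemma mat_bound_diff:
  fixes a :: "'a::unital_cstar_algebra mat"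
  assumes "mat_bound a C" "mat_bound b D"
  shows "mat_bound (mat_diff a b) (C + D)"
proof -
  have "mat_diff a b = mat_add a (\<lambda>i j. - b i j)" by (simp add: mat_diff_def mat_add_def)
  then show ?thesis using mat_bound_add[OF assms(1) mat_bound_uminus[OF assms(2)]] by simp
qed

lemma mat_bound_triangle:
  fixes a :: "'a::unital_cstar_algebra mat"
  assumes "mat_bound (mat_diff a b) C" "mat_bound (mat_diff b c) D"
  shows "mat_bound (mat_diff a c) (C + D)"
proof -
  have "mat_diff a c = mat_add (mat_diff a b) (mat_diff b c)" by (simp add: mat_diff_def
      mat_add_def)
  then show ?thesis using mat_bound_add[OF assms] by simp
qed

lemma adjointable_mat_bound:
  assumes "a \<in> adjointable_mat"
  obtains C where "mat_bound a C"
proof -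
  obtain g where g: "g \<in> core_mat" "mat_bound (mat_diff a g) 1"
    using assms zero_less_one unfolding adjointable_mat_def by blast
  then obtain C where "mat_bound g C" unfolding core_mat_def by blast
  then have "mat_bound (mat_add (mat_diff a g) g) (1 + C)" by (rule mat_bound_add[OF g(2)])
  then show thesis using that by (simp add: mat_add_def mat_diff_def)
qed

lemma core_mat_subset: "core_mat \<subseteq> adjointable_mat"
proof
  fix a :: "'a mat" assume a: "a \<in> core_mat"
  have "mat_bound (mat_diff a a) \<epsilon>" if "\<epsilon> > 0" for \<epsilon> :: real
    using that mat_bound_mono[OF mat_bound_zero, of \<epsilon>] by (simp add: mat_diff_def)
  with a show "a \<in> adjointable_mat" by (auto simp: adjointable_mat_def)
qed

lemma adjointable_mat_closed:
  assumes "\<And>\<epsilon>. \<epsilon> > 0 \<Longrightarrow> \<exists>g\<in>adjointable_mat. mat_bound (mat_diff a g) \<epsilon>"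
  shows "a \<in> adjointable_mat"
  unfolding adjointable_mat_def
proof (intro CollectI allI impI)
  fix \<epsilon> :: real assume "\<epsilon> > 0"
  then obtain g where g: "g \<in> adjointable_mat" "mat_bound (mat_diff a g) (\<epsilon> / 2)"
    using assms[of "\<epsilon> / 2"] by auto
  then obtain h where h: "h \<in> core_mat" "mat_bound (mat_diff g h) (\<epsilon> / 2)"
    using half_gt_zero[OF \<open>\<epsilon> > 0\<close>] unfolding adjointable_mat_def by blast
  show "\<exists>g\<in>core_mat. mat_bound (mat_diff a g) \<epsilon>"
    using mat_bound_triangle[OF g(2) h(2)] h(1) by (intro bexI[of _ h]) auto
qed

text \<open>Beyond the finite support of row i of g, row i of a agrees with row i of a - g, so tails
  of the series are at most \<eta> times the bound of a column of b.\<close>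

lemma summable_adjointable_mult:
  assumes a: "a \<in> adjointable_mat" and b: "mat_bound b D"
  shows "summable (\<lambda>k. a i k * b k j :: 'a::unital_cstar_algebra)"
  unfolding summable_Cauchy
proof (intro allI impI)
  fix \<epsilon> :: real assume e: "\<epsilon> > 0"
  have D: "0 \<le> D" by (rule mat_bound_nonneg[OF b])
  define \<eta> where "\<eta> = \<epsilon> / (D + 1)"
  have "\<eta> > 0" using e D by (simp add: \<eta>_def)
  then obtain g where g: "g \<in> core_mat" "mat_bound (mat_diff a g) \<eta>"
    using a unfolding adjointable_mat_def by blast
  then have "finite {k. g i k \<noteq> 0}" by (simp add: core_mat_def)
  then obtain M where "{k. g i k \<noteq> 0} \<subseteq> {..<M}" unfolding finite_nat_iff_bounded by blast
  then have M: "g i k = 0" if "M \<le> k" for k using that by force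
  show "\<exists>N. \<forall>m\<ge>N. \<forall>n. norm (\<Sum>k=m..<n. a i k * b k j) < \<epsilon>"
  proof (intro exI allI impI)
    fix m n assume m: "M \<le> m"
    define v where "v = (\<lambda>k. if m \<le> k then b k j else 0)"
    have "(\<Sum>k=m..<n. a i k * b k j) = (\<Sum>k<n. mat_diff a g i k * v k)"
    proof (rule sum.mono_neutral_cong_left)
      show "\<forall>k\<in>{..<n} - {m..<n}. mat_diff a g i k * v k = 0" by (auto simp: v_def)
      fix k assume "k \<in> {m..<n}"
      then have "g i k = 0" using M[of k] m by simp
      with \<open>k \<in> {m..<n}\<close> show "a i k * b k j = mat_diff a g i k * v k" by (simp add: mat_diff_def
          v_def)
    qed auto
    then have "norm (\<Sum>k=m..<n. a i k * b k j) \<le> vec_norm (Suc i) (mat_vec n (mat_diff a g) v)"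
      using norm_le_vec_norm[of i "Suc i" "mat_vec n (mat_diff a g) v"] by (simp add: mat_vec_def)
    also have "\<dots> \<le> \<eta> * vec_norm n v" by (rule vec_norm_mat_vec[OF g(2)])
    also have "\<dots> \<le> \<eta> * D"
    proof (intro mult_left_mono)
      have "vec_norm n v \<le> vec_norm n (\<lambda>k. b k j)" by (intro vec_norm_mono) (auto simp: v_def)
      also have "\<dots> \<le> D" by (rule vec_norm_column[OF b])
      finally show "vec_norm n v \<le> D" .
    qed (use \<open>\<eta> > 0\<close> in simp)
    also have "\<dots> < \<epsilon>" using e D by (simp add: \<eta>_def field_simps)
    finally show "norm (\<Sum>k=m..<n. a i k * b k j) < \<epsilon>" .
  qed
qed

lemma summable_mult_adjointable:
  assumes "a \<in> adjointable_mat" "b \<in> adjointable_mat"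
  shows "summable (\<lambda>k. a i k * b k j :: 'a::unital_cstar_algebra)"
  by (rule adjointable_mat_bound[OF assms(2)]) (rule summable_adjointable_mult[OF assms(1)])

lemma core_mat_diff:
  assumes "a \<in> core_mat" "b \<in> core_mat"
  shows "mat_diff a b \<in> core_mat"
proof -
  obtain C D where "mat_bound a C" "mat_bound b D" using assms unfolding core_mat_def by blast
  then have "mat_bound (mat_diff a b) (C + D)" by (rule mat_bound_diff)
  moreover have "finite {j. mat_diff a b i j \<noteq> 0}" for i
    by (rule finite_subset[of _ "{j. a i j \<noteq> 0} \<union> {j. b i j \<noteq> 0}"])
      (use assms in \<open>auto simp: core_mat_def mat_diff_def\<close>)
  moreover have "finite {i. mat_diff a b i j \<noteq> 0}" for j
    by (rule finite_subset[of _ "{i. a i j \<noteq> 0} \<union> {i. b i j \<noteq> 0}"])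
      (use assms in \<open>auto simp: core_mat_def mat_diff_def\<close>)
  ultimately show ?thesis unfolding core_mat_def by blast
qed

lemma core_mat_mult:
  assumes a: "a \<in> core_mat" and b: "b \<in> core_mat"
  shows "mat_mult a b \<in> core_mat"
proof -
  obtain C D where CD: "mat_bound a C" "mat_bound b D" using assms unfolding core_mat_def by blast
  have "mat_bound (mat_mult a b) (C * D)"
    by (rule mat_bound_mult[OF CD]) (use core_mat_subset a CD(2) summable_adjointable_mult in blast)
  moreover have nz: "\<exists>k. a i k \<noteq> 0 \<and> b k j \<noteq> 0" if "mat_mult a b i j \<noteq> 0" for i j
  proof (rule ccontr)
    assume "\<not> ?thesis"
    then have "(\<lambda>k. a i k * b k j) = (\<lambda>k. 0)"
      by (intro ext) (metis mult_zero_left mult_zero_right)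
    then show False using that by (simp add: mat_mult_def)
  qed
  moreover have "finite {j. mat_mult a b i j \<noteq> 0}" for i
    by (rule finite_subset[of _ "\<Union>k\<in>{k. a i k \<noteq> 0}. {j. b k j \<noteq> 0}"])
      (use assms in \<open>auto simp: core_mat_def dest!: nz\<close>)
  moreover have "finite {i. mat_mult a b i j \<noteq> 0}" for j
    by (rule finite_subset[of _ "\<Union>k\<in>{k. b k j \<noteq> 0}. {i. a i k \<noteq> 0}"])
      (use assms in \<open>auto simp: core_mat_def dest!: nz\<close>)
  ultimately show ?thesis unfolding core_mat_def by blast
qed

lemma core_mat_adj:
  assumes a: "a \<in> core_mat"
  shows "mat_adj a \<in> core_mat"
proof -
  have "star (x::'a) = 0 \<longleftrightarrow> x = 0" for x by (metis norm_eq_zero norm_star)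
  then show ?thesis using a mat_bound_adj unfolding core_mat_def by (auto simp: mat_adj_def)
qed

lemma mat_mult_diff_left:
  assumes "\<And>i j. summable (\<lambda>k. a i k * c k j)" "\<And>i j. summable (\<lambda>k. b i k * c k j)"
  shows "mat_mult (mat_diff a b) c = mat_diff (mat_mult a c) (mat_mult b c :: 'a::cstar_algebra
      mat)"
  unfolding mat_mult_def mat_diff_def left_diff_distrib suminf_diff[OF assms, symmetric] ..

lemma mat_mult_diff_right:
  assumes "\<And>i j. summable (\<lambda>k. c i k * a k j)" "\<And>i j. summable (\<lambda>k. c i k * b k j)"
  shows "mat_mult c (mat_diff a b) = mat_diff (mat_mult c a) (mat_mult c b :: 'a::cstar_algebra
      mat)"
  unfolding mat_mult_def mat_diff_def right_diff_distrib suminf_diff[OF assms, symmetric] ..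

lemma adjointable_mat_diff:
  assumes "a \<in> adjointable_mat" "b \<in> adjointable_mat"
  shows "mat_diff a b \<in> adjointable_mat"
  unfolding adjointable_mat_def
proof (intro CollectI allI impI)
  fix \<epsilon> :: real assume "\<epsilon> > 0"
  then have "\<epsilon> / 2 > 0" by simp
  then obtain g h where g: "g \<in> core_mat" "mat_bound (mat_diff a g) (\<epsilon> / 2)"
    and h: "h \<in> core_mat" "mat_bound (mat_diff b h) (\<epsilon> / 2)"
    using assms unfolding adjointable_mat_def by blast
  have "mat_diff (mat_diff a b) (mat_diff g h) = mat_diff (mat_diff a g) (mat_diff b h)"
    by (simp add: mat_diff_def algebra_simps)
  then have "mat_bound (mat_diff (mat_diff a b) (mat_diff g h)) \<epsilon>"
    using mat_bound_diff[OF g(2) h(2)] by simp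
  then show "\<exists>g\<in>core_mat. mat_bound (mat_diff (mat_diff a b) g) \<epsilon>"
    using core_mat_diff[OF g(1) h(1)] by blast
qed

lemma adjointable_mat_zero: "(\<lambda>i j. 0) \<in> adjointable_mat"
  by (rule subsetD[OF core_mat_subset]) (auto simp: core_mat_def intro: mat_bound_zero)

lemma adjointable_mat_uminus:
  assumes "a \<in> adjointable_mat"
  shows "(\<lambda>i j. - a i j) \<in> adjointable_mat"
  using adjointable_mat_diff[OF adjointable_mat_zero assms] by (simp add: mat_diff_def)

lemma adjointable_mat_add:
  assumes "a \<in> adjointable_mat" "b \<in> adjointable_mat"
  shows "mat_add a b \<in> adjointable_mat"
  using adjointable_mat_diff[OF assms(1) adjointable_mat_uminus[OF assms(2)]]
  by (simp add: mat_diff_def mat_add_def)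

lemma scaleC_zero_right [simp]: "scaleC c (0::'a::cstar_algebra) = 0"
  using scaleC_diff_right[of c 0 0] by simp

lemma adjointable_mat_scaleC:
  assumes "a \<in> adjointable_mat"
  shows "(\<lambda>i j. scaleC c (a i j)) \<in> adjointable_mat"
  unfolding adjointable_mat_def
proof (intro CollectI allI impI)
  fix \<epsilon> :: real assume e: "\<epsilon> > 0"
  define \<eta> where "\<eta> = \<epsilon> / (cmod c + 1)"
  have pos: "cmod c + 1 > 0" by (simp add: add_nonneg_pos)
  then have "\<eta> > 0" using e by (simp add: \<eta>_def)
  then obtain g where g: "g \<in> core_mat" "mat_bound (mat_diff a g) \<eta>"
    using assms unfolding adjointable_mat_def by blast
  have "mat_bound (mat_diff (\<lambda>i j. scaleC c (a i j)) (\<lambda>i j. scaleC c (g i j))) (cmod c * \<eta>)"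
    using mat_bound_scaleC[OF g(2), of c] by (simp add: mat_diff_def scaleC_diff_right)
  moreover have "cmod c * \<eta> \<le> \<epsilon>" using e pos by (simp add: \<eta>_def field_simps)
  ultimately have b: "mat_bound (mat_diff (\<lambda>i j. scaleC c (a i j)) (\<lambda>i j. scaleC c (g i j))) \<epsilon>"
    by (rule mat_bound_mono)
  have fin: "finite {k. scaleC c (f k) \<noteq> 0}" if "finite {k. f k \<noteq> 0}" for f :: "nat \<Rightarrow> 'a"
    by (rule finite_subset[OF _ that]) auto
  have "(\<lambda>i j. scaleC c (g i j)) \<in> core_mat"
    using g(1) unfolding core_mat_def by (auto intro: fin mat_bound_scaleC)
  with b show "\<exists>g\<in>core_mat. mat_bound (mat_diff (\<lambda>i j. scaleC c (a i j)) g) \<epsilon>" by blast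
qed

lemma adjointable_mat_adj:
  assumes "a \<in> adjointable_mat"
  shows "mat_adj a \<in> adjointable_mat"
  unfolding adjointable_mat_def
proof (intro CollectI allI impI)
  fix \<epsilon> :: real assume e: "\<epsilon> > 0"
  then obtain g where g: "g \<in> core_mat" "mat_bound (mat_diff a g) \<epsilon>"
    using assms unfolding adjointable_mat_def by blast
  have "mat_diff (mat_adj a) (mat_adj g) = mat_adj (mat_diff a g)"
    by (simp add: mat_diff_def mat_adj_def star_diff)
  with g show "\<exists>g\<in>core_mat. mat_bound (mat_diff (mat_adj a) g) \<epsilon>"
    using mat_bound_adj core_mat_adj by metis
qed

lemma adjointable_mat_mult:
  fixes a b :: "'a::unital_cstar_algebra mat"
  assumes a: "a \<in> adjointable_mat" and b: "b \<in> adjointable_mat"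
  shows "mat_mult a b \<in> adjointable_mat"
  unfolding adjointable_mat_def
proof (intro CollectI allI impI)
  fix \<epsilon> :: real assume e: "\<epsilon> > 0"
  obtain C where C: "mat_bound a C" by (rule adjointable_mat_bound[OF a])
  then have C0: "0 \<le> C" by (rule mat_bound_nonneg)
  define \<eta> where "\<eta> = \<epsilon> / (2 * (C + 1))"
  have "\<eta> > 0" using e C0 by (simp add: \<eta>_def)
  then obtain h where h: "h \<in> core_mat" "mat_bound (mat_diff b h) \<eta>"
    using b unfolding adjointable_mat_def by blast
  then obtain D where D: "mat_bound h D" unfolding core_mat_def by blast
  then have D0: "0 \<le> D" by (rule mat_bound_nonneg)
  \<comment> \<open>The accuracy needed for a depends on the bound D of h, so the right factor is
    approximated first.\<close>
  define \<theta> where "\<theta> = \<epsilon> / (2 * (D + 1))"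
  have "\<theta> > 0" using e D0 by (simp add: \<theta>_def)
  then obtain g where g: "g \<in> core_mat" "mat_bound (mat_diff a g) \<theta>"
    using a unfolding adjointable_mat_def by blast
  have gh: "g \<in> adjointable_mat" "h \<in> adjointable_mat" using g h core_mat_subset by auto
  have "mat_bound (mat_diff (mat_mult a b) (mat_mult a h)) (C * \<eta>)"
    using mat_bound_mult[OF C h(2) summable_adjointable_mult[OF a h(2)]]
      mat_mult_diff_right[OF summable_mult_adjointable[OF a b] summable_mult_adjointable[OF a
          gh(2)]]
    by simp
  moreover have "mat_bound (mat_diff (mat_mult a h) (mat_mult g h)) (\<theta> * D)"
    using mat_bound_mult[OF g(2) D summable_adjointable_mult[OF adjointable_mat_diff[OF a gh(1)] D]]
      mat_mult_diff_left[OF summable_mult_adjointable[OF a gh(2)] summable_mult_adjointable[OF gh]]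
    by simp
  ultimately have "mat_bound (mat_diff (mat_mult a b) (mat_mult g h)) (C * \<eta> + \<theta> * D)"
    by (rule mat_bound_triangle)
  moreover have "C * \<eta> \<le> \<epsilon> / 2" "\<theta> * D \<le> \<epsilon> / 2"
    using e C0 D0 by (simp_all add: \<eta>_def \<theta>_def field_simps)
  then have "C * \<eta> + \<theta> * D \<le> \<epsilon>" by simp
  ultimately show "\<exists>g\<in>core_mat. mat_bound (mat_diff (mat_mult a b) g) \<epsilon>"
    using core_mat_mult[OF g(1) h(1)] mat_bound_mono by blast
qed

lemma mat_eqI_bound:
  fixes a b :: "'a::unital_cstar_algebra mat"
  assumes "\<And>\<epsilon>. \<epsilon> > 0 \<Longrightarrow> mat_bound (mat_diff a b) \<epsilon>"
  shows "a = b"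
proof (intro ext)
  fix i j
  have "norm (a i j - b i j) \<le> 0 + \<epsilon>" if "\<epsilon> > 0" for \<epsilon>
    using norm_entry_le[OF assms[OF that], of i j] by (simp add: mat_diff_def)
  then have "norm (a i j - b i j) \<le> 0" by (rule field_le_epsilon)
  then show "a i j = b i j" by simp
qed

text \<open>Two infinite sums may be interchanged when the left factor is row-finite, since one of
  them is then finite. The general case follows by approximating a; \<eta> makes each of the two
  resulting errors at most \<epsilon>/2.\<close>

lemma mat_mult_assoc:
  fixes a b c :: "'a::unital_cstar_algebra mat"
  assumes a: "a \<in> adjointable_mat" and b: "b \<in> adjointable_mat" and c: "c \<in> adjointable_mat"
  shows "mat_mult (mat_mult a b) c = mat_mult a (mat_mult b c)"
proof (rule mat_eqI_bound)
  fix \<epsilon> :: real assume e: "\<epsilon> > 0"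
  obtain B where B: "mat_bound b B" by (rule adjointable_mat_bound[OF b])
  obtain C where C: "mat_bound c C" by (rule adjointable_mat_bound[OF c])
  have BC: "0 \<le> B" "0 \<le> C" using B C mat_bound_nonneg by auto
  define \<eta> where "\<eta> = \<epsilon> / (2 * (B * C + 1))"
  have pos: "B * C + 1 > 0" using BC by (simp add: add_nonneg_pos)
  then have "\<eta> > 0" using e by (simp add: \<eta>_def)
  then obtain g where g: "g \<in> core_mat" "mat_bound (mat_diff a g) \<eta>"
    using a unfolding adjointable_mat_def by blast
  have g': "g \<in> adjointable_mat" using g core_mat_subset by auto
  have ag: "mat_diff a g \<in> adjointable_mat" by (rule adjointable_mat_diff[OF a g'])
  have bc: "mat_bound (mat_mult b c) (B * C)"
    by (rule mat_bound_mult[OF B C summable_mult_adjointable[OF b c]])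
  have "mat_mult (mat_mult g b) c = mat_mult g (mat_mult b c)"
  proof (intro ext)
    fix i j
    define K where "K = {k. g i k \<noteq> 0}"
    have K: "finite K" using g by (simp add: core_mat_def K_def)
    have g0: "(\<Sum>k. g i k * f k) = (\<Sum>k\<in>K. g i k * f k)" for f :: "nat \<Rightarrow> 'a"
      by (rule suminf_finite[OF K]) (simp add: K_def)
    have "mat_mult (mat_mult g b) c i j = (\<Sum>l. \<Sum>k\<in>K. g i k * (b k l * c l j))"
      by (simp add: mat_mult_def g0 sum_distrib_right mult.assoc)
    also have "\<dots> = (\<Sum>k\<in>K. \<Sum>l. g i k * (b k l * c l j))"
      by (intro suminf_sum summable_mult summable_mult_adjointable b c)
    also have "\<dots> = (\<Sum>k\<in>K. g i k * mat_mult b c k j)"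
      by (simp add: mat_mult_def suminf_mult summable_mult_adjointable b c)
    finally show "mat_mult (mat_mult g b) c i j = mat_mult g (mat_mult b c) i j"
      by (simp add: g0 mat_mult_def[of g])
  qed
  moreover have "mat_bound (mat_mult (mat_mult (mat_diff a g) b) c) (\<eta> * B * C)"
    by (rule mat_bound_mult[OF mat_bound_mult[OF g(2) B summable_mult_adjointable[OF ag b]] C
          summable_mult_adjointable[OF adjointable_mat_mult[OF ag b] c]])
  then have "mat_bound (mat_diff (mat_mult (mat_mult a b) c) (mat_mult (mat_mult g b) c)) (\<eta> * B *
      C)"
    by (simp add: mat_mult_diff_left summable_mult_adjointable a b c g' adjointable_mat_mult)
  moreover have ga: "mat_bound (mat_diff g a) \<eta>"
  proof -
    have "mat_diff g a = (\<lambda>i j. - mat_diff a g i j)" by (simp add: mat_diff_def)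
    then show ?thesis using mat_bound_uminus[OF g(2)] by simp
  qed
  have "mat_bound (mat_mult (mat_diff g a) (mat_mult b c)) (\<eta> * (B * C))"
    by (rule mat_bound_mult[OF ga bc summable_adjointable_mult[OF adjointable_mat_diff[OF g' a]
        bc]])
  then have "mat_bound (mat_diff (mat_mult g (mat_mult b c)) (mat_mult a (mat_mult b c))) (\<eta> * (B
      * C))"
    by (simp add: mat_mult_diff_left summable_mult_adjointable a b c g' adjointable_mat_mult)
  ultimately have "mat_bound (mat_diff (mat_mult (mat_mult a b) c) (mat_mult a (mat_mult b c)))
      (\<eta> * B * C + \<eta> * (B * C))"
    using mat_bound_triangle by metis
  moreover have "\<eta> * (B * C) \<le> \<epsilon> / 2" using e BC pos by (simp add: \<eta>_def field_simps)
  then have "\<eta> * B * C + \<eta> * (B * C) \<le> \<epsilon>" unfolding mult.assoc by linarith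
  ultimately show "mat_bound (mat_diff (mat_mult (mat_mult a b) c) (mat_mult a (mat_mult b c))) \<epsilon>"
    by (rule mat_bound_mono)
qed

definition mat_id :: "'a::unital_cstar_algebra mat" where
  "mat_id = (\<lambda>i j. if i = j then 1 else 0)"

lemma mat_id_mult: "mat_mult mat_id a = a" "mat_mult a mat_id = a"
proof -
  have "mat_mult mat_id a i j = a i j" for i j
    unfolding mat_mult_def by (subst suminf_finite[of "{i}"]) (auto simp: mat_id_def)
  moreover have "mat_mult a mat_id i j = a i j" for i j
    unfolding mat_mult_def by (subst suminf_finite[of "{j}"]) (auto simp: mat_id_def)
  ultimately show "mat_mult mat_id a = a" "mat_mult a mat_id = a" by (intro ext; blast)+
qed

lemma mat_bound_id: "mat_bound mat_id 1"
proof -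
  have "mat_vec n mat_id v i = (if i < n then v i else 0)" for n and v :: "nat \<Rightarrow> 'a" and i
    unfolding mat_vec_def mat_id_def by (simp add: if_distrib[of "\<lambda>x. x * _"] cong: if_cong)
  then have "vec_norm n (mat_vec n mat_id v) = vec_norm n v" for n and v :: "nat \<Rightarrow> 'a"
    by (intro vec_norm_cong) simp
  then show ?thesis by (simp add: mat_bound_def)
qed

lemma adjointable_mat_id: "mat_id \<in> adjointable_mat"
proof (rule subsetD[OF core_mat_subset])
  have "finite {j. mat_id i j \<noteq> (0::'a)}" "finite {j. mat_id j i \<noteq> (0::'a)}" for i
    by (rule finite_subset[of _ "{i}"]; auto simp: mat_id_def)+
  then show "mat_id \<in> (core_mat :: 'a mat set)" using mat_bound_id by (auto simp: core_mat_def)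
qed

text \<open>
  A unital C*-algebra that contains every \<open>M\<^sub>n(A)\<close> and \<open>A \<otimes> K\<close>, so that square roots and positive
  parts are taken in a single type.
\<close>

typedef (overloaded) 'a adjointable = "adjointable_mat :: 'a::unital_cstar_algebra mat set"
  morphisms entries Adjointable
  using adjointable_mat_zero by blast

lemma entries_adjointable [simp]: "entries x \<in> adjointable_mat"
  by (rule entries)

lemma adjointable_eqI: "entries x = entries y \<Longrightarrow> x = y"
  by (simp add: entries_inject)

lemma summable_entries: "summable (\<lambda>k. entries x i k * entries y k j)"
  by (rule summable_mult_adjointable) simp_all

lemma adjointable_mat_scaleR: "a \<in> adjointable_mat \<Longrightarrow> (\<lambda>i j. r *\<^sub>R a i j) \<in> adjointable_mat"
  using adjointable_mat_scaleC[of a "complex_of_real r"] by (simp add: scaleC_complex_of_real)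

lemma mat_bound_scaleR: "mat_bound a C \<Longrightarrow> mat_bound (\<lambda>i j. r *\<^sub>R a i j) (\<bar>r\<bar> * C)"
  using mat_bound_scaleC[of a C "complex_of_real r"] by (simp add: scaleC_complex_of_real)

instantiation adjointable :: (unital_cstar_algebra) real_normed_algebra
begin

definition "0 = Adjointable (\<lambda>i j. 0)"
definition "x + y = Adjointable (mat_add (entries x) (entries y))"
definition "- x = Adjointable (\<lambda>i j. - entries x i j)"
definition "x - y = Adjointable (mat_diff (entries x) (entries y))"
definition "x * y = Adjointable (mat_mult (entries x) (entries y))"
definition "r *\<^sub>R x = Adjointable (\<lambda>i j. r *\<^sub>R entries x i j)"
definition "norm x = enn2real (mat_norm (entries x))"
definition "dist x y = norm (x - y :: 'a adjointable)"
definition "sgn x = (inverse (norm x) *\<^sub>R x :: 'a adjointable)"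
definition "(uniformity :: ('a adjointable \<times> 'a adjointable) filter) =
  (INF e\<in>{0<..}. principal {(x, y). dist x y < e})"
definition "open (U :: 'a adjointable set) \<longleftrightarrow>
  (\<forall>x\<in>U. eventually (\<lambda>(x', y). x' = x \<longrightarrow> y \<in> U) uniformity)"

lemma entries_zero: "entries 0 = (\<lambda>i j. 0)"
  by (simp add: zero_adjointable_def Adjointable_inverse adjointable_mat_zero)

lemma entries_add: "entries (x + y) = mat_add (entries x) (entries y)"
  by (simp add: plus_adjointable_def Adjointable_inverse adjointable_mat_add)

lemma entries_uminus: "entries (- x) = (\<lambda>i j. - entries x i j)"
  by (simp add: uminus_adjointable_def Adjointable_inverse adjointable_mat_uminus)

lemma entries_diff: "entries (x - y) = mat_diff (entries x) (entries y)"
  by (simp add: minus_adjointable_def Adjointable_inverse adjointable_mat_diff)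

lemma entries_mult: "entries (x * y) = mat_mult (entries x) (entries y)"
  by (simp add: times_adjointable_def Adjointable_inverse adjointable_mat_mult)

lemma entries_scaleR: "entries (r *\<^sub>R x) = (\<lambda>i j. r *\<^sub>R entries x i j)"
  by (simp add: scaleR_adjointable_def Adjointable_inverse adjointable_mat_scaleR)

lemma mat_norm_entries: "mat_norm (entries x) = ennreal (norm x)"
proof -
  obtain C where "mat_bound (entries x) C" by (rule adjointable_mat_bound[OF entries_adjointable])
  then have "mat_norm (entries x) < top" using mat_bound_iff le_less_trans ennreal_less_top by blast
  then show ?thesis by (simp add: norm_adjointable_def)
qed

lemma mat_bound_entries_iff: "mat_bound (entries x) C \<longleftrightarrow> norm x \<le> C"
proof -
  have "0 \<le> norm x" by (simp add: norm_adjointable_def)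
  then show ?thesis unfolding mat_bound_iff mat_norm_entries by (auto simp: ennreal_le_iff)
qed

lemma mat_bound_norm: "mat_bound (entries x) (norm x)"
  by (simp add: mat_bound_entries_iff)

instance
proof
  fix x y z :: "'a adjointable" and r s :: real
  show "x + y + z = x + (y + z)" "x + y = y + x" "0 + x = x"
    by (rule adjointable_eqI; simp add: entries_add entries_zero mat_add_def algebra_simps)+
  show "- x + x = 0" "x - y = x + - y"
    by (rule adjointable_eqI;
      simp add: entries_add entries_zero entries_uminus entries_diff mat_add_def mat_diff_def)+
  show "r *\<^sub>R (x + y) = r *\<^sub>R x + r *\<^sub>R y" "(r + s) *\<^sub>R x = r *\<^sub>R x + s *\<^sub>R x"
    "r *\<^sub>R s *\<^sub>R x = (r * s) *\<^sub>R x" "1 *\<^sub>R x = x"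
    by (rule adjointable_eqI;
      simp add: entries_add entries_scaleR mat_add_def scaleR_add_right scaleR_add_left)+
  show "x * y * z = x * (y * z)"
    by (rule adjointable_eqI) (simp add: entries_mult mat_mult_assoc)
  show "(x + y) * z = x * z + y * z" "x * (y + z) = x * y + x * z"
    by (rule adjointable_eqI; simp add: entries_mult entries_add mat_mult_def mat_add_def
        distrib_left distrib_right suminf_add[OF summable_entries summable_entries])+
  show "r *\<^sub>R x * y = r *\<^sub>R (x * y)" "x * r *\<^sub>R y = r *\<^sub>R (x * y)"
    by (rule adjointable_eqI; simp add: entries_mult entries_scaleR mat_mult_def
        suminf_scaleR_right summable_entries)+
  show "dist x y = norm (x - y)" by (fact dist_adjointable_def)
  show "sgn x = inverse (norm x) *\<^sub>R x" by (fact sgn_adjointable_def)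
  show "(uniformity :: ('a adjointable \<times> 'a adjointable) filter) =
      (INF e\<in>{0<..}. principal {(x, y). dist x y < e})" by (fact uniformity_adjointable_def)
  show "open U \<longleftrightarrow> (\<forall>x\<in>U. eventually (\<lambda>(x', y). x' = x \<longrightarrow> y \<in> U) uniformity)"
    for U :: "'a adjointable set" by (fact open_adjointable_def)
  have norm_nonneg: "0 \<le> norm x" for x :: "'a adjointable" by (simp add: norm_adjointable_def)
  show norm0: "norm x = 0 \<longleftrightarrow> x = 0" for x :: "'a adjointable"
  proof
    assume "norm x = 0"
    then have "norm (entries x i j) \<le> 0" for i j using norm_entry_le[OF mat_bound_norm[of x]] by
        metis
    then show "x = 0" by (intro adjointable_eqI ext) (simp add: entries_zero)
  next
    assume "x = 0"
    then have "norm x \<le> 0" using mat_bound_zero by (simp add: entries_zero flip: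
        mat_bound_entries_iff)
    then show "norm x = 0" using norm_nonneg[of x] by simp
  qed
  show "norm (x + y) \<le> norm x + norm y"
    unfolding mat_bound_entries_iff[symmetric] entries_add by (intro mat_bound_add mat_bound_norm)
  have scaleR_le: "norm (r *\<^sub>R x) \<le> \<bar>r\<bar> * norm x" for r and x :: "'a adjointable"
    unfolding mat_bound_entries_iff[symmetric] entries_scaleR by (intro mat_bound_scaleR
        mat_bound_norm)
  show "norm (r *\<^sub>R x) = \<bar>r\<bar> * norm x"
  proof (cases "r = 0")
    case True
    then show ?thesis using scaleR_le[of r x] norm_nonneg[of "r *\<^sub>R x"] by simp
  next
    case False
    then have "inverse r *\<^sub>R r *\<^sub>R x = x" by (intro adjointable_eqI) (simp add: entries_scaleR)
    then have "norm x \<le> inverse \<bar>r\<bar> * norm (r *\<^sub>R x)"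
      using scaleR_le[of "inverse r" "r *\<^sub>R x"] by simp
    then have "\<bar>r\<bar> * norm x \<le> norm (r *\<^sub>R x)" using False by (simp add: field_simps)
    then show ?thesis using scaleR_le[of r x] by simp
  qed
  show "norm (x * y) \<le> norm x * norm y"
    unfolding mat_bound_entries_iff[symmetric] entries_mult
    by (intro mat_bound_mult mat_bound_norm summable_entries)
qed

end

instance adjointable :: (unital_cstar_algebra) banach
proof
  fix X :: "nat \<Rightarrow> 'a adjointable"
  assume X: "Cauchy X"
  have "Cauchy (\<lambda>k. entries (X k) i j)" for i j
  proof (rule CauchyI)
    fix e :: real assume "e > 0"
    then obtain M where M: "\<And>m n. m \<ge> M \<Longrightarrow> n \<ge> M \<Longrightarrow> norm (X m - X n) < e"
      using CauchyD[OF X] by meson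
    have "norm (entries (X m) i j - entries (X n) i j) < e" if "m \<ge> M" "n \<ge> M" for m n
      using norm_entry_le[OF mat_bound_norm[of "X m - X n"], of i j] M[OF that]
      by (simp add: entries_diff mat_diff_def)
    then show "\<exists>M. \<forall>m\<ge>M. \<forall>n\<ge>M. norm (entries (X m) i j - entries (X n) i j) < e" by blast
  qed
  then have "\<exists>l. (\<lambda>k. entries (X k) i j) \<longlonglongrightarrow> l" for i j
    by (simp add: Cauchy_convergent_iff convergent_def)
  then obtain a where a: "\<And>i j. (\<lambda>k. entries (X k) i j) \<longlonglongrightarrow> a i j" by metis
  \<comment> \<open>The differences \<open>X k - X m\<close> converge entrywise as k grows, and
    \<open>mat_bound_limit\<close> carries the Cauchy bound over; this turns the entrywise limit
    into a norm limit.\<close>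
  have ev: "\<exists>M. \<forall>m\<ge>M. mat_bound (mat_diff a (entries (X m))) e" if "e > 0" for e :: real
  proof -
    obtain M where M: "\<And>m n. m \<ge> M \<Longrightarrow> n \<ge> M \<Longrightarrow> norm (X m - X n) < e"
      using CauchyD[OF X \<open>e > 0\<close>] by meson
    have "mat_bound (mat_diff a (entries (X m))) e" if "m \<ge> M" for m
    proof (rule mat_bound_limit)
      show "(\<lambda>k. entries (X k - X m) i j) \<longlonglongrightarrow> mat_diff a (entries (X m)) i j" for i j
        unfolding entries_diff mat_diff_def by (intro tendsto_intros a)
      show "mat_bound (entries (X k - X m)) e" if "M \<le> k" for k
        unfolding mat_bound_entries_iff using M[OF that \<open>m \<ge> M\<close>] by simp
    qed
    then show ?thesis by blast
  qed
  have "a \<in> adjointable_mat"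
  proof (rule adjointable_mat_closed)
    fix e :: real assume "e > 0"
    then obtain m where "mat_bound (mat_diff a (entries (X m))) e" using ev by blast
    then show "\<exists>g\<in>adjointable_mat. mat_bound (mat_diff a g) e" using entries_adjointable by blast
  qed
  then have a': "entries (Adjointable a) = a" by (rule Adjointable_inverse)
  have "X \<longlonglongrightarrow> Adjointable a"
  proof (rule metric_LIMSEQ_I)
    fix e :: real assume "e > 0"
    then obtain M where M: "\<And>m. m \<ge> M \<Longrightarrow> mat_bound (mat_diff a (entries (X m))) (e / 2)"
      using ev[of "e / 2"] by auto
    have "dist (X m) (Adjointable a) < e" if "m \<ge> M" for m
    proof -
      have "norm (Adjointable a - X m) \<le> e / 2"
        unfolding mat_bound_entries_iff[symmetric] entries_diff a' by (rule M[OF that])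
      then show ?thesis using \<open>e > 0\<close> by (simp add: dist_norm norm_minus_commute)
    qed
    then show "\<exists>M. \<forall>m\<ge>M. dist (X m) (Adjointable a) < e" by blast
  qed
  then show "convergent X" by (auto simp: convergent_def)
qed

instantiation adjointable :: (unital_cstar_algebra) unital_cstar_algebra
begin

definition "1 = Adjointable mat_id"
definition "scaleC c x = Adjointable (\<lambda>i j. scaleC c (entries x i j))"
definition "star x = Adjointable (mat_adj (entries x))"

lemma entries_one: "entries 1 = mat_id"
  by (simp add: one_adjointable_def Adjointable_inverse adjointable_mat_id)

lemma entries_scaleC: "entries (scaleC c x) = (\<lambda>i j. scaleC c (entries x i j))"
  by (simp add: scaleC_adjointable_def Adjointable_inverse adjointable_mat_scaleC)

lemma entries_star: "entries (star x) = mat_adj (entries x)"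
  by (simp add: star_adjointable_def Adjointable_inverse adjointable_mat_adj)

instance
proof
  fix x y z :: "'a adjointable" and r s :: real and c d :: complex
  show "1 * x = x" "x * 1 = x"
    by (rule adjointable_eqI; simp add: entries_mult entries_one mat_id_mult)+
  show "scaleC c (x + y) = scaleC c x + scaleC c y" "scaleC (c + d) x = scaleC c x + scaleC d x"
    "scaleC c (scaleC d x) = scaleC (c * d) x" "scaleC (complex_of_real r) x = r *\<^sub>R x"
    by (rule adjointable_eqI; simp add: entries_add entries_scaleC entries_scaleR mat_add_def
        scaleC_add_right scaleC_add_left scaleC_scaleC scaleC_complex_of_real)+
  have suminf_scaleC: "(\<Sum>k. scaleC c (entries x i k * entries y k j)) = scaleC c (\<Sum>k. entries x i
      k * entries y k j)"
    for x y :: "'a adjointable" and i j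
  proof (rule bounded_linear.suminf[symmetric, OF _ summable_entries])
    show "bounded_linear (scaleC c :: 'a \<Rightarrow> 'a)"
      by (rule bounded_linear_intro[of _ "cmod c"])
        (simp_all add: scaleC_add_right scaleC_scaleR norm_scaleC mult.commute)
  qed
  show "scaleC c x * y = scaleC c (x * y)" "x * scaleC c y = scaleC c (x * y)"
    by (rule adjointable_eqI; simp add: entries_mult entries_scaleC mat_mult_def
        mult_scaleC_left mult_scaleC_right suminf_scaleC)+
  show "star (x + y) = star x + star y" "star (scaleC c x) = scaleC (cnj c) (star x)" "star (star
      x) = x"
    by (rule adjointable_eqI;
      simp add: entries_star entries_add entries_scaleC mat_adj_def mat_add_def star_add
          star_scaleC)+
  show "star (x * y) = star y * star x"
    by (rule adjointable_eqI) (simp add: entries_star entries_mult mat_adj_def mat_mult_def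
        bounded_linear.suminf[OF bounded_linear_star summable_entries] flip: star_mult)
  have scaleC_le: "norm (scaleC c x) \<le> cmod c * norm x" for c and x :: "'a adjointable"
    unfolding mat_bound_entries_iff[symmetric] entries_scaleC by (intro mat_bound_scaleC
        mat_bound_norm)
  show "norm (scaleC c x) = cmod c * norm x"
  proof (cases "c = 0")
    case True
    then show ?thesis using scaleC_le[of c x] by simp
  next
    case False
    have "scaleC 1 z = z" for z :: 'a by (metis of_real_1 scaleC_complex_of_real scaleR_one)
    then have "scaleC (inverse c) (scaleC c x) = x" using False
      by (intro adjointable_eqI) (simp add: entries_scaleC scaleC_scaleC)
    then have "norm x \<le> inverse (cmod c) * norm (scaleC c x)"
      using scaleC_le[of "inverse c" "scaleC c x"] by (simp add: norm_inverse)
    then have "cmod c * norm x \<le> norm (scaleC c x)" using False by (simp add: field_simps)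
    then show ?thesis using scaleC_le[of c x] by simp
  qed
  have star_le: "norm (star x) \<le> norm x"
    unfolding mat_bound_entries_iff[symmetric] entries_star by (intro mat_bound_adj mat_bound_norm)
  show "norm (star x * x) = (norm x)\<^sup>2"
  proof (rule antisym)
    have "norm (star x * x) \<le> norm (star x) * norm x" by (rule norm_mult_ineq)
    also have "\<dots> \<le> norm x * norm x" by (intro mult_right_mono star_le norm_ge_zero)
    finally show "norm (star x * x) \<le> (norm x)\<^sup>2" by (simp add: power2_eq_square)
    have "mat_bound (mat_mult (mat_adj (entries x)) (entries x)) (norm (star x * x))"
      using mat_bound_norm[of "star x * x"] by (simp add: entries_mult entries_star)
    moreover have "summable (\<lambda>k. mat_adj (entries x) i k * entries x k j)" for i j
      using summable_entries[of "star x" i x j] by (simp add: entries_star)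
    ultimately have "mat_bound (entries x) (sqrt (norm (star x * x)))" by (rule mat_bound_cstar)
    then have "norm x \<le> sqrt (norm (star x * x))" by (simp add: mat_bound_entries_iff)
    then have "(norm x)\<^sup>2 \<le> (sqrt (norm (star x * x)))\<^sup>2" by (intro power_mono norm_ge_zero)
    then show "(norm x)\<^sup>2 \<le> norm (star x * x)" by simp
  qed
qed

end

section \<open>Cuntz comparison in hereditary subalgebras\<close>

lemma approx_unit_mult:
  assumes a: "pos_elem (a::'a::unital_cstar_algebra)" and e: "\<epsilon> > 0"
  obtains q where "star q = q" "bicomm a q" "a * q = q * a" "norm (a * q) \<le> 2"
    "norm (a - a * q * a) \<le> \<epsilon>"
proof -
  obtain q where q: "pos_elem q" "bicomm a q" "pos_elem (1 - a * q)" "norm (1 - a * q) \<le> 1"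
    "norm (a * (1 - a * q)) \<le> \<epsilon>" by (rule approx_unit[OF a e])
  have aq: "a * q = q * a" using bicomm_self_commute[OF q(2)] by simp
  have "norm (a * q) \<le> norm (1::'a) + norm (1 - a * q)"
    using norm_triangle_ineq4[of 1 "1 - a * q"] by simp
  then have "norm (a * q) \<le> 2" using q(4) norm_one_le[where ?'a='a] by linarith
  moreover have "a * (1 - a * q) = a - a * q * a"
  proof -
    have "a * (1 - a * q) = a - a * (a * q)" by (simp add: right_diff_distrib)
    also have "a * (a * q) = a * (q * a)" unfolding aq ..
    finally show ?thesis by (simp only: mult.assoc)
  qed
  ultimately show thesis using that q aq pos_elem_self_adjoint by metis
qed

text \<open>The closure properties that M_n(A), M_infty(A) and A tensor K have in common. Norm
  closure is not demanded, as M_infty(A) is in general not complete; closure under self-adjoint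
  square roots takes over its role.\<close>

definition hereditary :: "'a::unital_cstar_algebra set \<Rightarrow> bool" where
  "hereditary S \<longleftrightarrow> (\<forall>x\<in>S. star x \<in> S) \<and> (\<forall>x\<in>S. \<forall>y\<in>S. x + y \<in> S) \<and>
     (\<forall>x\<in>S. \<forall>z\<in>S. \<forall>y. x * y * z \<in> S) \<and> (\<forall>z. star z = z \<and> z * z \<in> S \<longrightarrow> z \<in> S)"

lemma hereditaryD:
  assumes "hereditary S"
  shows "x \<in> S \<Longrightarrow> star x \<in> S" "x \<in> S \<Longrightarrow> y \<in> S \<Longrightarrow> x + y \<in> S"
    "x \<in> S \<Longrightarrow> z \<in> S \<Longrightarrow> x * y * z \<in> S" "x \<in> S \<Longrightarrow> z \<in> S \<Longrightarrow> x * z \<in> S"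
    "star z = z \<Longrightarrow> z * z \<in> S \<Longrightarrow> z \<in> S"
proof -
  show "x \<in> S \<Longrightarrow> star x \<in> S" "x \<in> S \<Longrightarrow> y \<in> S \<Longrightarrow> x + y \<in> S"
    "x \<in> S \<Longrightarrow> z \<in> S \<Longrightarrow> x * y * z \<in> S" for x y z
    using assms unfolding hereditary_def by blast+
  from this(3)[of x z 1] show "x \<in> S \<Longrightarrow> z \<in> S \<Longrightarrow> x * z \<in> S" by simp
  show "star z = z \<Longrightarrow> z * z \<in> S \<Longrightarrow> z \<in> S" using assms unfolding hereditary_def by blast
qed

lemma hereditary_sqrt:
  assumes "hereditary S" "pos_elem a" "a \<in> S"
  obtains b where "pos_elem b" "b \<in> S" "b * b = a" "bicomm a b"
proof -
  obtain b where b: "pos_elem b" "b * b = a" "bicomm a b" by (rule pos_elem_sqrt[OF assms(2)])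
  then have "b \<in> S" using hereditaryD(5)[OF assms(1)] assms(3) pos_elem_self_adjoint by metis
  with b show thesis using that by blast
qed

text \<open>With b the root of a, a q = b q b, and S admits an arbitrary factor between two of its
  elements. So q itself may lie outside S.\<close>

lemma hereditary_bicomm_mult:
  assumes "hereditary S" "pos_elem a" "a \<in> S" "bicomm a q"
  shows "a * q \<in> S"
proof -
  obtain b where b: "pos_elem b" "b \<in> S" "b * b = a" by (rule hereditary_sqrt[OF assms(1-3)])
  have "q * b = b * q" using b(3) by (intro bicommD[OF assms(4)]) (metis mult.assoc)
  then have "a * q = b * q * b" by (simp add: mult.assoc flip: b(3))
  then show ?thesis using hereditaryD(3)[OF assms(1) b(2) b(2)] by simp
qed

text \<open>Form of \<open>cuntz_le\<close> with an \<epsilon> in place of a sequence, see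
  \<open>cuntz_le_entries\<close>.\<close>

definition cuntz_sub :: "'a::unital_cstar_algebra set \<Rightarrow> 'a \<Rightarrow> 'a \<Rightarrow> bool" where
  "cuntz_sub S a b \<longleftrightarrow> (\<forall>\<epsilon>>0. \<exists>r\<in>S. norm (a - r * b * star r) \<le> \<epsilon>)"

lemma cuntz_subD: "cuntz_sub S a b \<Longrightarrow> \<epsilon> > 0 \<Longrightarrow> \<exists>r\<in>S. norm (a - r * b * star r) \<le> \<epsilon>"
  by (simp add: cuntz_sub_def)

lemma norm_triangle_diff: "norm (a - b) \<le> C \<Longrightarrow> norm (b - c) \<le> D \<Longrightarrow> norm (a - c ::
    'a::real_normed_vector) \<le> C + D"
  using norm_triangle_ineq[of "a - b" "b - c"] by simp

lemma norm_mult3: "norm (a * b * c) \<le> norm a * norm b * norm (c::'a::real_normed_algebra)"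
  by (meson mult_right_mono norm_ge_zero norm_mult_ineq order_trans)

lemma cuntz_sub_closed:
  assumes "\<And>\<epsilon>. \<epsilon> > 0 \<Longrightarrow> \<exists>c. norm (a - c) \<le> \<epsilon> \<and> cuntz_sub S c b"
  shows "cuntz_sub S a b"
  unfolding cuntz_sub_def
proof (intro allI impI)
  fix \<epsilon> :: real assume "\<epsilon> > 0"
  then have e: "\<epsilon> / 2 > 0" by simp
  obtain c where c: "norm (a - c) \<le> \<epsilon> / 2" "cuntz_sub S c b" using assms[OF e] by blast
  then obtain r where "r \<in> S" "norm (c - r * b * star r) \<le> \<epsilon> / 2" using cuntz_subD e by blast
  then show "\<exists>r\<in>S. norm (a - r * b * star r) \<le> \<epsilon>" using norm_triangle_diff[OF c(1)] by fastforce
qed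

lemma cuntz_sub_conj: "r \<in> S \<Longrightarrow> cuntz_sub S (r * b * star r) b"
  unfolding cuntz_sub_def by (metis diff_self norm_zero less_imp_le)

lemma cuntz_sub_trans:
  assumes S: "hereditary S" and ab: "cuntz_sub S a b" and bc: "cuntz_sub S b c"
  shows "cuntz_sub S a c"
  unfolding cuntz_sub_def
proof (intro allI impI)
  fix \<epsilon> :: real assume "\<epsilon> > 0"
  then have e: "\<epsilon> / 2 > 0" by simp
  obtain r where r: "r \<in> S" "norm (a - r * b * star r) \<le> \<epsilon> / 2" using cuntz_subD[OF ab e] by blast
  define \<eta> where "\<eta> = \<epsilon> / 2 / (norm r * norm r + 1)"
  have pos: "norm r * norm r + 1 > 0" by (simp add: add_nonneg_pos)
  then have "\<eta> > 0" using e by (simp add: \<eta>_def)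
  then obtain s where s: "s \<in> S" "norm (b - s * c * star s) \<le> \<eta>" using cuntz_subD[OF bc] by blast
  have "norm (r * b * star r - (r * s) * c * star (r * s)) = norm (r * (b - s * c * star s) * star
      r)"
    by (simp add: algebra_simps star_mult)
  also have "\<dots> \<le> norm r * norm (b - s * c * star s) * norm (star r)" by (rule norm_mult3)
  also have "\<dots> \<le> norm r * \<eta> * norm r" using s by (simp add: mult_left_mono mult_right_mono)
  also have "\<dots> \<le> \<epsilon> / 2" using pos \<open>\<epsilon> > 0\<close> by (simp add: \<eta>_def field_simps)
  finally have "norm (a - (r * s) * c * star (r * s)) \<le> \<epsilon> / 2 + \<epsilon> / 2"
    by (rule norm_triangle_diff[OF r(2)])
  then show "\<exists>r\<in>S. norm (a - r * c * star r) \<le> \<epsilon>"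
    using hereditaryD(4)[OF S r(1) s(1)] by auto
qed

lemma norm_sandwich_diff:
  assumes "star g = g" "norm g \<le> K" "norm (a - g * a) \<le> \<epsilon>" "star a = (a::'a::unital_cstar_algebra)"
  shows "norm (a - g * a * g) \<le> (K + 1) * \<epsilon>"
proof -
  have "a - a * g = star (a - g * a)" using assms by (simp add: star_diff star_mult)
  then have ag: "norm (a - a * g) \<le> \<epsilon>" using assms(3) by simp
  have "g * a - g * a * g = g * (a - a * g)" by (simp add: algebra_simps)
  then have "norm (g * a - g * a * g) \<le> norm g * norm (a - a * g)" using norm_mult_ineq by metis
  also have "\<dots> \<le> K * \<epsilon>" using assms(2) ag by (intro mult_mono) (auto intro: order_trans[OF
      norm_ge_zero])
  finally have "norm (a - g * a * g) \<le> \<epsilon> + K * \<epsilon>" by (rule norm_triangle_diff[OF assms(3)])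
  then show ?thesis by (simp add: algebra_simps)
qed

text \<open>The element g = a q is a local unit inside S. That it annihilates whatever a annihilates
  removes cross terms between orthogonal elements. The accuracy \<epsilon>/3 pays for the factor K +
  1 = 3 in \<open>norm_sandwich_diff\<close>.\<close>

lemma local_unit:
  assumes S: "hereditary S" and a: "pos_elem a" "a \<in> S" and e: "\<epsilon> > 0"
  obtains g where "g \<in> S" "star g = g" "norm (a - g * a * g) \<le> \<epsilon>" "\<And>b. a * b = 0 \<Longrightarrow> g * b = 0"
proof -
  obtain q where q: "star q = q" "bicomm a q" "a * q = q * a" "norm (a * q) \<le> 2"
    "norm (a - a * q * a) \<le> \<epsilon> / 3" using approx_unit_mult[OF a(1), of "\<epsilon> / 3"] e by auto
  have sa: "star a = a" by (rule pos_elem_self_adjoint[OF a(1)])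
  show thesis
  proof (rule that)
    show "a * q \<in> S" by (rule hereditary_bicomm_mult[OF S a q(2)])
    show sg: "star (a * q) = a * q" using q sa by (simp add: star_mult)
    show "norm (a - a * q * a * (a * q)) \<le> \<epsilon>"
      using norm_sandwich_diff[OF sg q(4) q(5) sa] by simp
    show "a * q * b = 0" if "a * b = 0" for b unfolding q(3) using that by (simp add: mult.assoc)
  qed
qed

lemma cuntz_sub_refl:
  assumes "hereditary S" "pos_elem a" "a \<in> S"
  shows "cuntz_sub S a a"
  unfolding cuntz_sub_def
proof (intro allI impI)
  fix \<epsilon> :: real assume "\<epsilon> > 0"
  from local_unit[OF assms this] show "\<exists>r\<in>S. norm (a - r * a * star r) \<le> \<epsilon>" by metis
qed

text \<open>If r and s witness the two comparisons and g, h are local units for a, b, then r g + s h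
  witnesses the comparison of sums: g b = 0 and h a = 0 remove the mixed terms.\<close>

lemma cuntz_sub_add:
  assumes S: "hereditary S" and a: "pos_elem a" "a \<in> S" and b: "pos_elem b" "b \<in> S" and ab: "a * b
      = 0"
    and c: "cuntz_sub S c a" and d: "cuntz_sub S d b"
  shows "cuntz_sub S (c + d) (a + b)"
proof -
  have ba: "b * a = 0" using arg_cong[OF ab, of star] a b by (simp add: star_mult
      pos_elem_self_adjoint)
  have *: "\<exists>r g. r \<in> S \<and> g \<in> S \<and> star g = g \<and> norm (c - r * (g * a * g) * star r) \<le> \<epsilon> \<and>
      (\<forall>b. a * b = 0 \<longrightarrow> g * b = 0)"
    if pa: "pos_elem a" "a \<in> S" and ca: "cuntz_sub S c a" and e0: "\<epsilon> > 0" for a c \<epsilon>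
  proof -
    have e: "\<epsilon> / 2 > 0" using e0 by simp
    obtain r where r: "r \<in> S" "norm (c - r * a * star r) \<le> \<epsilon> / 2" using cuntz_subD[OF ca e] by blast
    define \<eta> where "\<eta> = \<epsilon> / 2 / (norm r * norm r + 1)"
    have pos: "norm r * norm r + 1 > 0" by (simp add: add_nonneg_pos)
    then have "\<eta> > 0" using e by (simp add: \<eta>_def)
    then obtain g where g: "g \<in> S" "star g = g" "norm (a - g * a * g) \<le> \<eta>" "\<And>b. a * b = 0 \<Longrightarrow> g * b
        = 0"
      using local_unit[OF S pa] by metis
    have "norm (r * a * star r - r * (g * a * g) * star r) = norm (r * (a - g * a * g) * star r)"
      by (simp add: algebra_simps)
    also have "\<dots> \<le> norm r * norm (a - g * a * g) * norm (star r)" by (rule norm_mult3)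
    also have "\<dots> \<le> norm r * \<eta> * norm r" using g by (simp add: mult_left_mono mult_right_mono)
    also have "\<dots> \<le> \<epsilon> / 2" using pos e0 by (simp add: \<eta>_def field_simps)
    finally have "norm (c - r * (g * a * g) * star r) \<le> \<epsilon> / 2 + \<epsilon> / 2" by (rule
        norm_triangle_diff[OF r(2)])
    with r(1) g show ?thesis by auto
  qed
  show ?thesis
    unfolding cuntz_sub_def
  proof (intro allI impI)
    fix \<epsilon> :: real assume "\<epsilon> > 0"
    then have e: "\<epsilon> / 2 > 0" by simp
    obtain r g where r: "r \<in> S" "g \<in> S" "star g = g" "norm (c - r * (g * a * g) * star r) \<le> \<epsilon> / 2"
      "\<And>b. a * b = 0 \<Longrightarrow> g * b = 0" using *[OF a c e] by metis
    obtain s h where s: "s \<in> S" "h \<in> S" "star h = h" "norm (d - s * (h * b * h) * star s) \<le> \<epsilon> / 2"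
      "\<And>a. b * a = 0 \<Longrightarrow> h * a = 0" using *[OF b d e] by metis
    have gb: "g * b = 0" "h * a = 0" using r(5) s(5) ab ba by auto
    have bg: "b * g = 0" "a * h = 0"
      using arg_cong[OF gb(1), of star] arg_cong[OF gb(2), of star] r s a b
      by (simp_all add: star_mult pos_elem_self_adjoint)
    have "(r * g + s * h) * (a + b) = r * g * a + s * h * b"
      by (simp add: distrib_left distrib_right mult.assoc gb)
    moreover have "star (r * g + s * h) = g * star r + h * star s"
      by (simp add: star_add star_mult r s)
    moreover have "(r * g * a + s * h * b) * (g * star r + h * star s)
        = r * (g * a * g) * star r + s * (h * b * h) * star s"
    proof -
      have "a * (h * x) = 0" "b * (g * x) = 0" for x using bg by (simp_all flip: mult.assoc)
      then show ?thesis by (simp add: distrib_left distrib_right mult.assoc)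
    qed
    ultimately have eq: "c + d - (r * g + s * h) * (a + b) * star (r * g + s * h)
        = (c - r * (g * a * g) * star r) + (d - s * (h * b * h) * star s)" by simp
    have "norm (c + d - (r * g + s * h) * (a + b) * star (r * g + s * h)) \<le> \<epsilon>"
      unfolding eq using norm_triangle_mono[OF r(4) s(4)] by simp
    moreover have "r * g + s * h \<in> S"
      by (rule hereditaryD(2)[OF S hereditaryD(4)[OF S r(1,2)] hereditaryD(4)[OF S s(1,2)]])
    ultimately show "\<exists>r\<in>S. norm (c + d - r * (a + b) * star r) \<le> \<epsilon>" by blast
  qed
qed

text \<open>With b, c the roots of x, y and g = y q, the witness b q c produces b g g b. This is
  close to x = b b, because the squared norm of b (1 - g) is the norm of (1 - g) x (1 - g), which is
  at most that of (1 - g) y (1 - g).\<close>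

lemma cuntz_sub_of_le:
  assumes S: "hereditary S" and x: "pos_elem x" "x \<in> S" and y: "y \<in> S" and xy: "pos_elem (y - x)"
  shows "cuntz_sub S x y"
  unfolding cuntz_sub_def
proof (intro allI impI)
  fix \<epsilon> :: real assume e: "\<epsilon> > 0"
  have py: "pos_elem y" using pos_elem_add[OF x(1) xy] by simp
  obtain b where b: "pos_elem b" "b \<in> S" "b * b = x" by (rule hereditary_sqrt[OF S x])
  obtain c where c: "pos_elem c" "c \<in> S" "c * c = y" by (rule hereditary_sqrt[OF S py y])
  have sb: "star b = b" "star c = c" using b c by (simp_all add: pos_elem_self_adjoint)
  \<comment> \<open>The error x - b g g b has two parts, bounded by \<open>norm b * \<eta>\<close>
    and twice that, whence the 3; the 1 keeps the denominator positive.\<close>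
  define \<eta> where "\<eta> = \<epsilon> / (3 * norm b + 1)"
  have pos: "3 * norm b + 1 > 0" by (simp add: add_nonneg_pos)
  then have \<eta>: "\<eta> > 0" using e by (simp add: \<eta>_def)
  then have "\<eta> * \<eta> > 0" by simp
  then obtain q where q: "pos_elem q" "bicomm y q" "pos_elem (1 - y * q)" "norm (1 - y * q) \<le> 1"
    "norm (y * (1 - y * q)) \<le> \<eta> * \<eta>" by (rule approx_unit[OF py])
  define g where "g = y * q"
  have yq: "y * q = q * y" using bicomm_self_commute[OF q(2)] by simp
  have sq: "star q = q" using q(1) by (rule pos_elem_self_adjoint)
  have sg: "star g = g" using sq py by (simp add: g_def star_mult pos_elem_self_adjoint yq)
  have ng: "norm g \<le> 2"
    using norm_triangle_ineq4[of 1 "1 - g"] q(4) norm_one_le[where ?'a='a] by (simp add: g_def)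
  have "norm (b * (1 - g)) * norm (b * (1 - g)) = norm (star (b * (1 - g)) * (b * (1 - g)))"
    by (simp only: norm_star_mult_self power2_eq_square)
  also have "star (b * (1 - g)) * (b * (1 - g)) = (1 - g) * x * (1 - g)"
    by (simp add: star_mult star_diff sg sb mult.assoc flip: b(3))
  also have "norm ((1 - g) * x * (1 - g)) \<le> norm ((1 - g) * y * (1 - g))"
  proof (rule norm_mono)
    have s1: "star (1 - g) = 1 - g" by (simp add: star_diff sg)
    show "pos_elem ((1 - g) * x * (1 - g))" using pos_elem_conj[OF x(1), of "1 - g"] s1 by simp
    show "pos_elem ((1 - g) * y * (1 - g) - (1 - g) * x * (1 - g))"
      using pos_elem_conj[OF xy, of "1 - g"] s1 by (simp add: algebra_simps)
  qed
  also have "\<dots> \<le> norm (1 - g) * norm (y * (1 - g))" using norm_mult_ineq[of "1 - g"] by (simp add: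
      mult.assoc)
  also have "\<dots> \<le> 1 * (\<eta> * \<eta>)" using q(4,5) by (intro mult_mono) (simp_all add: g_def)
  finally have "norm (b * (1 - g)) \<le> \<eta>" using \<eta> by (metis abs_le_square_iff abs_norm_cancel
      abs_of_pos mult_1 power2_eq_square)
  then have n1: "norm (b - b * g) \<le> \<eta>" by (simp add: algebra_simps)
  have "b - g * b = star (b - b * g)" by (simp add: star_diff star_mult sb sg)
  then have n2: "norm (b - g * b) \<le> \<eta>" using n1 by simp
  have "x - b * g * g * b = (b - b * g) * b + b * g * (b - g * b)" by (simp add: algebra_simps
      flip: b(3))
  also have "norm \<dots> \<le> norm (b - b * g) * norm b + norm b * norm g * norm (b - g * b)"
    by (intro order_trans[OF norm_triangle_ineq] add_mono norm_mult_ineq norm_mult3)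
  also have "\<dots> \<le> \<eta> * norm b + norm b * 2 * \<eta>"
    using n1 n2 ng \<eta> by (intro add_mono mult_mono) auto
  also have "\<dots> = 3 * norm b * \<eta>" by simp
  also have "\<dots> \<le> (3 * norm b + 1) * \<eta>" using \<eta> by (intro mult_right_mono) auto
  also have "\<dots> = \<epsilon>" using pos by (simp add: \<eta>_def)
  finally have "norm (x - b * g * g * b) \<le> \<epsilon>" .
  moreover have "(b * q * c) * y * star (b * q * c) = b * g * g * b"
  proof -
    have cy: "c * y = y * c" unfolding c(3)[symmetric] by (simp add: mult.assoc)
    have "(b * q * c) * y * star (b * q * c) = b * q * (c * y) * c * q * b"
      by (simp add: star_mult sb sq mult.assoc)
    also have "\<dots> = b * (q * y) * (c * c) * q * b" unfolding cy by (simp add: mult.assoc)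
    also have "\<dots> = b * g * g * b" unfolding c(3) g_def yq[symmetric] by (simp add: mult.assoc)
    finally show ?thesis .
  qed
  ultimately show "\<exists>r\<in>S. norm (x - r * y * star r) \<le> \<epsilon>"
    using hereditaryD(3)[OF S b(2) c(2), of q] by metis
qed

text \<open>
  A substitute for the elements \<open>(a - \<eta>)\<^sub>+\<close>: with \<open>u = (a - \<eta>)\<^sub>+\<close>, the element
  \<open>c = a u\<^sup>3 a = a u (a - \<eta>) u a\<close> lies below \<open>a u b u a\<close> whenever \<open>\<parallel>a - b\<parallel> \<le> \<eta>\<close>, and it
  tends to \<open>a\<^sup>5\<close>, which is Cuntz equivalent to \<open>a\<close>.
\<close>

lemma cuntz_way_below:
  assumes S: "hereditary S" and a: "pos_elem a" "a \<in> S" and d: "\<delta> > 0"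
  obtains c \<eta> s where "pos_elem c" "c \<in> S" "\<eta> > 0"
    "\<And>b. star b = b \<Longrightarrow> b \<in> S \<Longrightarrow> norm (a - b) \<le> \<eta> \<Longrightarrow> cuntz_sub S c b"
    "s \<in> S" "norm (a - s * c * star s) \<le> \<delta>"
proof -
  have sa: "star a = a" by (rule pos_elem_self_adjoint[OF a(1)])
  \<comment> \<open>126 = 7 * 9 * 2: the factor 7 = 1 + 2 + 4 arises in passing from g to g^3, the
    factor 9 from sandwiching with g^3 of norm at most 8, and half of \<delta> is kept for replacing
    a by a cut-down.\<close>
  obtain q where q: "star q = q" "bicomm a q" "a * q = q * a" "norm (a * q) \<le> 2"
    "norm (a - a * q * a) \<le> \<delta> / 126" using approx_unit_mult[OF a(1), of "\<delta> / 126"] d by auto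
  define g where "g = a * q"
  \<comment> \<open>Chosen so that s a^2 = g^3; then s a^5 s = g^3 a g^3 is close to a, which
    recovers a from a^5.\<close>
  define s where "s = a * (q * q * q)"
  have aqx: "a * (q * x) = q * (a * x)" for x using q(3) by (simp flip: mult.assoc)
  have gggs: "g * g * g = s * (a * a)"
    unfolding g_def s_def by (simp add: mult.assoc q(3) aqx)
  have "bicomm a (q * q * q)" unfolding bicomm_def
  proof (intro allI impI)
    fix x assume "a * x = x * a"
    then have qx: "q * x = x * q" by (rule bicommD[OF q(2)])
    have "q * (x * y) = x * (q * y)" for y using qx by (simp flip: mult.assoc)
    then show "q * q * q * x = x * (q * q * q)" by (simp add: mult.assoc qx)
  qed
  then have sS: "s \<in> S" unfolding s_def by (rule hereditary_bicomm_mult[OF S a])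
  have ss: "star s = s" unfolding s_def by (simp add: star_mult q(1) sa mult.assoc q(3) aqx)
  have sas: "s * a = a * s" unfolding s_def by (simp add: mult.assoc q(3) aqx)
  have sax: "s * (a * x) = a * (s * x)" for x using sas by (simp flip: mult.assoc)
  have sg: "star g = g" by (simp add: g_def star_mult q(1,3) sa)
  have ng: "norm (g * x) \<le> 2 * norm x" for x
    using norm_mult_ineq[of g x] mult_right_mono[OF q(4), of "norm x"] by (simp add: g_def)
  have n1: "norm (a - g * a) \<le> \<delta> / 126" using q(5) by (simp add: g_def)
  have n2: "norm (g * a - g * (g * a)) \<le> 2 * (\<delta> / 126)"
    using ng[of "a - g * a"] n1 by (simp add: algebra_simps)
  have n3: "norm (g * (g * a) - g * (g * (g * a))) \<le> 4 * (\<delta> / 126)"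
    using ng[of "g * a - g * (g * a)"] n2 by (simp add: algebra_simps)
  have "norm (a - g * (g * (g * a))) \<le> \<delta> / 126 + 2 * (\<delta> / 126) + 4 * (\<delta> / 126)"
    by (rule norm_triangle_diff[OF norm_triangle_diff[OF n1 n2] n3])
  then have n: "norm (a - g * g * g * a) \<le> \<delta> / 18" by (simp add: mult.assoc)
  have "norm (g * g * g) \<le> 8"
    using ng[of "g * g"] ng[of g] q(4) by (simp add: g_def mult.assoc)
  moreover have "star (g * g * g) = g * g * g" by (simp add: star_mult sg mult.assoc)
  ultimately have "norm (a - g * g * g * a * (g * g * g)) \<le> (8 + 1) * (\<delta> / 18)"
    using n sa by (intro norm_sandwich_diff) auto
  moreover have "g * g * g * a * (g * g * g) = s * (a * (a * a * a) * a) * star s"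
    unfolding gggs ss by (simp add: mult.assoc sas sax)
  ultimately have half: "norm (a - s * (a * (a * a * a) * a) * star s) \<le> \<delta> / 2" by simp
  \<comment> \<open>The cut-downs at level 1/(k + 1) converge to a, so replacing the inner a^3 of
    a^5 by \<open>u k * u k * u k\<close> costs less than the remaining \<delta>/2 for some k. The
    level of that cut-down becomes \<eta>.\<close>
  have "\<exists>u. pos_elem u \<and> bicomm a u \<and> norm (a - u) \<le> 1 / real (Suc k) \<and>
      u * (a - (1 / real (Suc k)) *\<^sub>R 1) * u = u * u * u" for k
    using cutdown[OF a(1), of "1 / real (Suc k)"] by (metis of_nat_0_le_iff zero_le_divide_1_iff)
  then obtain u where u: "\<And>k. pos_elem (u k)" "\<And>k. bicomm a (u k)" "\<And>k. norm (a - u k) \<le> 1 / real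
      (Suc k)"
    "\<And>k. u k * (a - (1 / real (Suc k)) *\<^sub>R 1) * u k = u k * u k * u k" by metis
  have "(\<lambda>k. u k - a) \<longlonglongrightarrow> 0"
    by (rule Lim_null_comparison[OF _ lim_inverse_n'[THEN LIMSEQ_Suc]])
      (use u(3) in \<open>auto simp: norm_minus_commute\<close>)
  then have lim: "u \<longlonglongrightarrow> a" by (simp add: LIM_zero_iff)
  have "(\<lambda>k. norm (s * (a * (a * a * a) * a) * star s - s * (a * (u k * u k * u k) * a) * star s))
      \<longlonglongrightarrow> norm (s * (a * (a * a * a) * a) * star s - s * (a * (a * a * a) * a) * star s)"
    by (intro tendsto_intros lim)
  then have "(\<lambda>k. norm (s * (a * (a * a * a) * a) * star s - s * (a * (u k * u k * u k) * a) *
      star s)) \<longlonglongrightarrow> 0"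
    by simp
  then have "\<forall>\<^sub>F k in sequentially. norm (s * (a * (a * a * a) * a) * star s - s * (a * (u k * u k
      * u k) * a) * star s) < \<delta> / 2"
    using d by (intro order_tendstoD) auto
  then obtain k where k: "norm (s * (a * (a * a * a) * a) * star s - s * (a * (u k * u k * u k) *
      a) * star s) < \<delta> / 2"
    by (auto simp: eventually_sequentially)
  define v where "v = u k"
  define \<eta> where "\<eta> = 1 / real (Suc k)"
  have v: "pos_elem v" "bicomm a v" "v * (a - \<eta> *\<^sub>R 1) * v = v * v * v"
    unfolding v_def \<eta>_def by (rule u)+
  have sv: "star v = v" by (rule pos_elem_self_adjoint[OF v(1)])
  have va: "v * a = a * v" by (rule bicomm_self_commute[OF v(2)])
  define c where "c = a * (v * v * v) * a"
  have avS: "a * v \<in> S" by (rule hereditary_bicomm_mult[OF S a v(2)])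
  have sav: "star (a * v) = a * v" by (simp add: star_mult sv sa va)
  have pc: "pos_elem c"
  proof -
    have "c = (a * v) * v * star (a * v)" unfolding c_def sav by (simp add: mult.assoc va)
    then show ?thesis using pos_elem_conj'[OF v(1)] by simp
  qed
  have cS: "c \<in> S" unfolding c_def by (rule hereditaryD(3)[OF S a(2) a(2)])
  have below: "cuntz_sub S c b" if b: "star b = b" "b \<in> S" "norm (a - b) \<le> \<eta>" for b
  proof -
    \<comment> \<open>a - b \<le> \<eta> means a - \<eta> \<le> b; conjugation by a v turns the left
      side into c.\<close>
    have "pos_elem (\<eta> *\<^sub>R 1 - (a - b))" by (rule self_adjoint_le_norm) (use b sa in \<open>simp_all add:
        star_diff\<close>)
    then have "pos_elem ((a * v) * (\<eta> *\<^sub>R 1 - (a - b)) * star (a * v))" by (rule pos_elem_conj')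
    moreover have "(a * v) * (\<eta> *\<^sub>R 1 - (a - b)) * star (a * v) = (a * v) * b * star (a * v) - c"
    proof -
      have "c = a * (v * (a - \<eta> *\<^sub>R 1) * v) * a" unfolding c_def v(3) ..
      also have "\<dots> = (a * v) * (a - \<eta> *\<^sub>R 1) * (v * a)" by (simp add: mult.assoc)
      finally show ?thesis unfolding sav va by (simp add: algebra_simps)
    qed
    ultimately have "pos_elem ((a * v) * b * star (a * v) - c)" by simp
    then have "cuntz_sub S c ((a * v) * b * star (a * v))"
      using hereditaryD(3)[OF S avS, of "a * v" b] avS sav by (intro cuntz_sub_of_le[OF S pc cS])
          simp_all
    then show ?thesis using cuntz_sub_trans[OF S] cuntz_sub_conj[OF avS] by blast
  qed
  have "norm (a - s * c * star s) \<le> \<delta> / 2 + \<delta> / 2"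
    using k unfolding v_def[symmetric] c_def[symmetric] by (intro norm_triangle_diff[OF half]) simp
  then have fin: "norm (a - s * c * star s) \<le> \<delta>" by simp
  have e0: "\<eta> > 0" by (simp add: \<eta>_def)
  show thesis by (rule that[OF pc cS e0 _ sS fin]) (rule below)
qed

text \<open>\<open>cuntz_way_below\<close> is iterated with each new \<delta> at most the current
  \<eta>: then term k + 1, conjugated by its s, is within \<open>\<eta> k\<close> of a, so term k
  lies below it and hence below term k + 1. Since \<delta> also tends to 0, a lies below every
  common upper bound.\<close>

lemma cuntz_rapidly_increasing:
  assumes S: "hereditary S" and a: "pos_elem a" "a \<in> S"
  obtains c :: "nat \<Rightarrow> 'a::unital_cstar_algebra" and \<eta> :: "nat \<Rightarrow> real"
  where "\<And>k. pos_elem (c k)" "\<And>k. c k \<in> S" "\<And>k. \<eta> k > 0"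
    "\<And>k b. star b = b \<Longrightarrow> b \<in> S \<Longrightarrow> norm (a - b) \<le> \<eta> k \<Longrightarrow> cuntz_sub S (c k) b"
    "\<And>k. cuntz_sub S (c k) (c (Suc k))"
    "\<And>t. (\<And>k. cuntz_sub S (c k) t) \<Longrightarrow> cuntz_sub S a t"
proof -
  define good where "good \<delta> p \<longleftrightarrow> (case p of (c, \<eta>, s) \<Rightarrow> pos_elem c \<and> c \<in> S \<and> \<eta> > 0 \<and>
    (\<forall>b. star b = b \<and> b \<in> S \<and> norm (a - b) \<le> \<eta> \<longrightarrow> cuntz_sub S c b) \<and> s \<in> S \<and>
    norm (a - s * c * star s) \<le> \<delta>)" for \<delta> :: real and p
  have ex: "\<exists>p. good \<delta> p" if "\<delta> > 0" for \<delta>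
    by (rule cuntz_way_below[OF S a that]) (auto simp: good_def)
  have "\<exists>p. \<forall>k. good (1 / real (Suc k)) (p k) \<and> norm (a - snd (snd (p (Suc k))) * fst (p (Suc k))
      * star (snd (snd (p (Suc k))))) \<le> fst (snd (p k))"
  proof (rule dependent_nat_choice)
    show "\<exists>p. good (1 / real (Suc 0)) p" by (rule ex) simp
    fix p k assume p: "good (1 / real (Suc k)) p"
    define \<delta> where "\<delta> = min (fst (snd p)) (1 / real (Suc (Suc k)))"
    have "\<delta> > 0" using p by (auto simp: \<delta>_def good_def split: prod.splits)
    then obtain p' where p': "good \<delta> p'" using ex by blast
    then have "good (1 / real (Suc (Suc k))) p'"
      "norm (a - snd (snd p') * fst p' * star (snd (snd p'))) \<le> fst (snd p)"
      unfolding \<delta>_def good_def by (auto split: prod.splits)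
    then show "\<exists>p'. good (1 / real (Suc (Suc k))) p' \<and>
        norm (a - snd (snd p') * fst p' * star (snd (snd p'))) \<le> fst (snd p)" by blast
  qed
  then obtain p where p: "\<And>k. good (1 / real (Suc k)) (p k)"
    "\<And>k. norm (a - snd (snd (p (Suc k))) * fst (p (Suc k)) * star (snd (snd (p (Suc k))))) \<le> fst
        (snd (p k))"
    by blast
  define c where "c k = fst (p k)" for k
  define \<eta> where "\<eta> k = fst (snd (p k))" for k
  define s where "s k = snd (snd (p k))" for k
  have g: "pos_elem (c k)" "c k \<in> S" "\<eta> k > 0" "s k \<in> S" "norm (a - s k * c k * star (s k)) \<le> 1 /
      real (Suc k)"
    and below: "star b = b \<Longrightarrow> b \<in> S \<Longrightarrow> norm (a - b) \<le> \<eta> k \<Longrightarrow> cuntz_sub S (c k) b" for k b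
    using p(1)[of k] unfolding good_def c_def \<eta>_def s_def by (auto split: prod.splits)
  show thesis
  proof (rule that[of c \<eta>])
    show "cuntz_sub S (c k) (c (Suc k))" for k
    proof (rule cuntz_sub_trans[OF S below cuntz_sub_conj[OF g(4)]])
      show "star (s (Suc k) * c (Suc k) * star (s (Suc k))) = s (Suc k) * c (Suc k) * star (s (Suc
          k))"
        using pos_elem_self_adjoint[OF pos_elem_conj'[OF g(1)]] .
      show "s (Suc k) * c (Suc k) * star (s (Suc k)) \<in> S"
        by (rule hereditaryD(3)[OF S g(4) hereditaryD(1)[OF S g(4)]])
      show "norm (a - s (Suc k) * c (Suc k) * star (s (Suc k))) \<le> \<eta> k"
        using p(2)[of k] by (simp add: c_def \<eta>_def s_def)
    qed
    show "cuntz_sub S a t" if t: "\<And>k. cuntz_sub S (c k) t" for t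
    proof (rule cuntz_sub_closed)
      fix \<epsilon> :: real assume "\<epsilon> > 0"
      then obtain k where k: "1 / real (Suc k) < \<epsilon>" using nat_approx_posE by metis
      have "cuntz_sub S (s k * c k * star (s k)) t"
        by (rule cuntz_sub_trans[OF S cuntz_sub_conj[OF g(4)] t])
      moreover have "norm (a - s k * c k * star (s k)) \<le> \<epsilon>" using g(5)[of k] k by linarith
      ultimately show "\<exists>c. norm (a - c) \<le> \<epsilon> \<and> cuntz_sub S c t" by blast
    qed
  qed (fact g below)+
qed

section \<open>\<open>M\<^sub>\<infinity>(A)\<close> and \<open>A \<otimes> K\<close> as hereditary subalgebras\<close>

lemma finite_matrix_bounded:
  fixes a :: "'a::unital_cstar_algebra mat"
  assumes a: "a \<in> matrices n"
  obtains C where "mat_bound a C"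
proof
  \<comment> \<open>The sum of all entry norms bounds every corner at once, independently of its
    size m.\<close>
  let ?C = "\<Sum>(i, j)\<in>{..<n} \<times> {..<n}. norm (a i j)"
  have C0: "0 \<le> ?C" by (intro sum_nonneg) auto
  have nz: "i < n \<and> j < n" if "a i j \<noteq> 0" for i j
    using a that unfolding matrices_def by (metis (mono_tags, lifting) mem_Collect_eq not_le)
  have le: "(\<Sum>i<m. \<Sum>j<m. norm (a i j)) \<le> ?C" for m
  proof -
    have "(\<Sum>i<m. \<Sum>j<m. norm (a i j)) = (\<Sum>(i, j)\<in>{..<m} \<times> {..<m}. norm (a i j))"
      by (rule sum.cartesian_product)
    also have "\<dots> = (\<Sum>(i, j)\<in>({..<m} \<times> {..<m}) \<inter> ({..<n} \<times> {..<n}). norm (a i j))"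
      by (intro sum.mono_neutral_right) (auto dest!: nz)
    also have "\<dots> \<le> ?C" by (intro sum_mono2) auto
    finally show ?thesis .
  qed
  have "vec_norm m (mat_vec m a v) \<le> ?C * vec_norm m v" for m v
  proof -
    define w where "w = mat_vec m a v"
    have "vec_norm m w \<le> sqrt (\<Sum>i<m. (norm (w i))\<^sup>2)"
      unfolding vec_norm_def by (intro real_sqrt_le_mono sum_norm_le) (simp add:
          norm_star_mult_self)
    also have "\<dots> \<le> (\<Sum>i<m. norm (w i))"
      using L2_set_le_sum[of "{..<m}" "\<lambda>i. norm (w i)"] by (simp add: L2_set_def)
    also have "\<dots> \<le> (\<Sum>i<m. \<Sum>j<m. norm (a i j) * vec_norm m v)"
      unfolding w_def mat_vec_def
      by (intro sum_mono sum_norm_le order_trans[OF norm_mult_ineq] mult_left_mono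
          norm_le_vec_norm) auto
    also have "\<dots> = (\<Sum>i<m. \<Sum>j<m. norm (a i j)) * vec_norm m v" by (simp add: sum_distrib_right)
    also have "\<dots> \<le> ?C * vec_norm m v" by (intro mult_right_mono le) simp
    finally show ?thesis unfolding w_def .
  qed
  with C0 show "mat_bound a ?C" by (simp add: mat_bound_def)
qed

lemma finite_matrices_core: "a \<in> matrices n \<Longrightarrow> a \<in> core_mat"
proof -
  assume a: "a \<in> matrices n"
  then have "{j. a i j \<noteq> 0} \<subseteq> {..<n}" "{i. a i j \<noteq> 0} \<subseteq> {..<n}" for i j
    by (auto simp: matrices_def not_le[symmetric])
  then have "finite {j. a i j \<noteq> 0}" "finite {i. a i j \<noteq> 0}" for i j
    using finite_subset finite_lessThan by metis+
  with finite_matrix_bounded[OF a] show ?thesis unfolding core_mat_def by blast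
qed

definition proj :: "nat \<Rightarrow> 'a::unital_cstar_algebra adjointable" where
  "proj n = Adjointable (corner n mat_id)"

lemma entries_finite: "a \<in> matrices n \<Longrightarrow> entries (Adjointable a) = a"
  by (rule Adjointable_inverse) (use finite_matrices_core core_mat_subset in blast)

lemma corner_matrices: "corner n a \<in> matrices n"
  by (auto simp: corner_def matrices_def)

lemma entries_proj: "entries (proj n) = corner n mat_id"
  unfolding proj_def by (rule entries_finite[OF corner_matrices])

lemma entries_proj_mult: "entries (proj n * x) = (\<lambda>i j. if i < n then entries x i j else 0)"
proof (intro ext)
  fix i j
  have "entries (proj n * x) i j = (\<Sum>k\<in>{i}. corner n mat_id i k * entries x k j)"
    unfolding entries_mult mat_mult_def entries_proj
    by (rule suminf_finite) (auto simp: corner_def mat_id_def)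
  then show "entries (proj n * x) i j = (if i < n then entries x i j else 0)"
    by (simp add: corner_def mat_id_def)
qed

lemma entries_mult_proj: "entries (x * proj n) = (\<lambda>i j. if j < n then entries x i j else 0)"
proof (intro ext)
  fix i j
  have "entries (x * proj n) i j = (\<Sum>k\<in>{j}. entries x i k * corner n mat_id k j)"
    unfolding entries_mult mat_mult_def entries_proj
    by (rule suminf_finite) (auto simp: corner_def mat_id_def)
  then show "entries (x * proj n) i j = (if j < n then entries x i j else 0)"
    by (simp add: corner_def mat_id_def)
qed

lemma entries_corner: "entries (proj n * x * proj n) = corner n (entries x)"
  by (intro ext) (simp add: entries_mult_proj entries_proj_mult corner_def)

lemma star_proj [simp]: "star (proj n) = proj n"
  by (intro adjointable_eqI ext) (simp add: entries_star entries_proj corner_def mat_id_def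
      mat_adj_def)

lemma proj_mult_proj: "n \<le> m \<Longrightarrow> proj m * proj n = proj n" "n \<le> m \<Longrightarrow> proj n * proj m = proj n"
  by (intro adjointable_eqI ext; auto simp: entries_proj_mult entries_mult_proj entries_proj
      corner_def mat_id_def)+

lemma pos_elem_proj: "pos_elem (proj n)"
  using pos_elem_star_mult_self[of "proj n"] by (simp add: proj_mult_proj)

lemma norm_proj_le: "norm (proj n :: 'a::unital_cstar_algebra adjointable) \<le> 1"
proof -
  have "norm (proj n :: 'a adjointable) = (norm (proj n :: 'a adjointable))\<^sup>2"
    using norm_star_mult_self[of "proj n :: 'a adjointable"] by (simp add: proj_mult_proj)
  then show ?thesis by (cases "norm (proj n :: 'a adjointable) = 0") (auto simp: power2_eq_square)
qed

lemma norm_proj_mult_le: "norm (proj n * x) \<le> norm x"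
  by (rule order_trans[OF norm_mult_ineq]) (use mult_right_mono[OF norm_proj_le, of "norm x"] in
      simp)

lemma tendsto_of_diff_zero:
  fixes x :: "'a::real_normed_vector"
  assumes "(\<lambda>n. x - f n) \<longlonglongrightarrow> 0"
  shows "f \<longlonglongrightarrow> x"
  using tendsto_diff[OF tendsto_const[of x] assms] by simp

definition matrix_alg :: "nat \<Rightarrow> 'a::unital_cstar_algebra adjointable set" where
  "matrix_alg n = {x. entries x \<in> matrices n}"

definition finite_alg :: "'a::unital_cstar_algebra adjointable set" where
  "finite_alg = {x. entries x \<in> finite_matrices}"

definition stable_alg :: "'a::unital_cstar_algebra adjointable set" where
  "stable_alg = {x. entries x \<in> stabilization}"

lemma matrix_alg_iff: "x \<in> matrix_alg n \<longleftrightarrow> proj n * x = x \<and> x * proj n = x"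
  unfolding matrix_alg_def
  by (simp flip: entries_inject add: entries_proj_mult entries_mult_proj)
     (auto simp: matrices_def fun_eq_iff not_less[symmetric])

lemma matrix_alg_mono: "x \<in> matrix_alg n \<Longrightarrow> n \<le> m \<Longrightarrow> x \<in> matrix_alg m"
  by (auto simp: matrix_alg_def matrices_def)

lemma finite_alg_iff: "x \<in> finite_alg \<longleftrightarrow> (\<exists>n. x \<in> matrix_alg n)"
  by (simp add: finite_alg_def finite_matrices_def matrix_alg_def)

lemma proj_matrix_alg: "proj n \<in> matrix_alg n"
  by (simp add: matrix_alg_iff proj_mult_proj)

lemma stable_alg_iff: "x \<in> stable_alg \<longleftrightarrow> (\<lambda>n. proj n * x * proj n) \<longlonglongrightarrow> x"
proof -
  have "mat_norm (mat_diff (entries x) (corner n (entries x))) = ennreal (norm (proj n * x * proj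
      n - x))" for n
    by (subst norm_minus_commute) (simp add: entries_diff entries_corner flip: mat_norm_entries)
  then have "x \<in> stable_alg \<longleftrightarrow> (\<lambda>n. ennreal (norm (proj n * x * proj n - x))) \<longlonglongrightarrow> ennreal 0"
    by (simp add: stable_alg_def stabilization_def)
  also have "\<dots> \<longleftrightarrow> (\<lambda>n. norm (proj n * x * proj n - x)) \<longlonglongrightarrow> 0"
    by (rule tendsto_ennreal_iff) auto
  also have "\<dots> \<longleftrightarrow> (\<lambda>n. proj n * x * proj n) \<longlonglongrightarrow> x"
    by (simp add: tendsto_norm_zero_iff LIM_zero_iff)
  finally show ?thesis .
qed

text \<open>For p = \<open>proj n\<close>, x - p x = (1 - p)(x - p x p), so the two-sided error
  controls the one-sided ones. The one-sided form is the one that multiplication respects.\<close>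

lemma stable_alg_tendsto:
  assumes "x \<in> stable_alg"
  shows "(\<lambda>n. proj n * x) \<longlonglongrightarrow> x" "(\<lambda>n. x * proj n) \<longlonglongrightarrow> x"
proof -
  have lim: "(\<lambda>n. norm (x - proj n * x * proj n)) \<longlonglongrightarrow> 0"
  proof -
    have "(\<lambda>n. x - proj n * x * proj n) \<longlonglongrightarrow> x - x"
      using assms unfolding stable_alg_iff by (intro tendsto_intros)
    then have "(\<lambda>n. x - proj n * x * proj n) \<longlonglongrightarrow> 0" by simp
    then show ?thesis by (rule tendsto_norm_zero)
  qed
  have n1: "norm (1 - proj n :: 'a adjointable) \<le> 1" for n
  proof -
    have "star (1 - proj n) * (1 - proj n :: 'a adjointable) = 1 - proj n"
      by (simp add: star_diff algebra_simps proj_mult_proj)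
    then have "norm (1 - proj n :: 'a adjointable) = (norm (1 - proj n :: 'a adjointable))\<^sup>2"
      using norm_star_mult_self[of "1 - proj n :: 'a adjointable"] by simp
    then show ?thesis by (cases "norm (1 - proj n :: 'a adjointable) = 0") (auto simp:
        power2_eq_square)
  qed
  have "x - proj n * x = (1 - proj n) * (x - proj n * x * proj n)" for n
    by (simp add: algebra_simps proj_mult_proj flip: mult.assoc)
  then have "norm (x - proj n * x) \<le> norm (x - proj n * x * proj n)" for n
    using norm_mult_ineq[of "1 - proj n" "x - proj n * x * proj n"]
      mult_right_mono[OF n1[of n], of "norm (x - proj n * x * proj n)"] by simp
  then have "(\<lambda>n. x - proj n * x) \<longlonglongrightarrow> 0"
    by (intro Lim_null_comparison[OF always_eventually lim]) blast
  then show "(\<lambda>n. proj n * x) \<longlonglongrightarrow> x" by (rule tendsto_of_diff_zero)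
  have "x - x * proj n = (x - proj n * x * proj n) * (1 - proj n)" for n
    by (simp add: algebra_simps proj_mult_proj)
  then have "norm (x - x * proj n) \<le> norm (x - proj n * x * proj n)" for n
    using norm_mult_ineq[of "x - proj n * x * proj n" "1 - proj n"]
      mult_left_mono[OF n1[of n], of "norm (x - proj n * x * proj n)"] by simp
  then have "(\<lambda>n. x - x * proj n) \<longlonglongrightarrow> 0"
    by (intro Lim_null_comparison[OF always_eventually lim]) blast
  then show "(\<lambda>n. x * proj n) \<longlonglongrightarrow> x" by (rule tendsto_of_diff_zero)
qed

lemma stable_algI:
  assumes "(\<lambda>n. proj n * x) \<longlonglongrightarrow> x" "(\<lambda>n. x * proj n) \<longlonglongrightarrow> x"
  shows "x \<in> stable_alg"
proof -
  have lim: "(\<lambda>n. norm (x - proj n * x) + norm (x - x * proj n)) \<longlonglongrightarrow> norm (x - x) + norm (x - x)"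
    by (intro tendsto_intros assms)
  then have lim0: "(\<lambda>n. norm (x - proj n * x) + norm (x - x * proj n)) \<longlonglongrightarrow> 0" by simp
  have le: "norm (x - proj n * x * proj n) \<le> norm (x - proj n * x) + norm (x - x * proj n)" for n
  proof (rule norm_triangle_diff[OF order_refl])
    have "proj n * x - proj n * x * proj n = proj n * (x - x * proj n)" by (simp add: algebra_simps)
    then show "norm (proj n * x - proj n * x * proj n) \<le> norm (x - x * proj n)"
      using norm_proj_mult_le by simp
  qed
  have "(\<lambda>n. x - proj n * x * proj n) \<longlonglongrightarrow> 0"
    by (rule Lim_null_comparison[OF always_eventually lim0]) (intro allI le)
  then show ?thesis unfolding stable_alg_iff by (rule tendsto_of_diff_zero)
qed

lemma finite_alg_subset_stable: "finite_alg \<subseteq> stable_alg"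
proof
  fix x :: "'a adjointable" assume "x \<in> finite_alg"
  then obtain n where n: "x \<in> matrix_alg n" by (auto simp: finite_alg_iff)
  have "proj m * x = x \<and> x * proj m = x" if "n \<le> m" for m
    using matrix_alg_mono[OF n that] by (simp add: matrix_alg_iff)
  then have "\<forall>\<^sub>F m in sequentially. proj m * x = x" "\<forall>\<^sub>F m in sequentially. x * proj m = x"
    by (auto simp: eventually_sequentially)
  then show "x \<in> stable_alg" by (intro stable_algI tendsto_eventually)
qed

lemma hereditary_matrix_alg: "hereditary (matrix_alg n :: 'a::unital_cstar_algebra adjointable set)"
proof -
  have star: "star x \<in> matrix_alg n" if "x \<in> matrix_alg n" for x :: "'a adjointable"
    using that unfolding matrix_alg_iff by (metis star_mult star_proj)
  have "z \<in> matrix_alg n" if z: "star z = z" "z * z \<in> matrix_alg n" for z :: "'a adjointable"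
  proof -
    \<comment> \<open>For p = \<open>proj n\<close> this is (1 - p) z^2 (1 - p), which vanishes when
      z^2 lies in the corner.\<close>
    have "star (z - z * proj n) * (z - z * proj n) = z * z - proj n * (z * z) - z * z * proj n +
        proj n * (z * z) * proj n"
      by (simp add: star_diff star_mult z algebra_simps)
    also have "\<dots> = 0" using z(2) by (simp add: matrix_alg_iff)
    finally have "z - z * proj n = 0" using norm_star_mult_self[of "z - z * proj n"] by simp
    then have zp: "z * proj n = z" by simp
    then have "proj n * z = z" by (metis star_mult star_proj z(1))
    with zp show ?thesis by (simp add: matrix_alg_iff)
  qed
  moreover have "x + y \<in> matrix_alg n" if "x \<in> matrix_alg n" "y \<in> matrix_alg n" for x y :: "'a
      adjointable"
    using that by (simp add: matrix_alg_iff distrib_left distrib_right)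
  moreover have "x * y * z \<in> matrix_alg n" if "x \<in> matrix_alg n" "z \<in> matrix_alg n" for x y z ::
      "'a adjointable"
    using that unfolding matrix_alg_iff by (metis mult.assoc)
  ultimately show ?thesis using star unfolding hereditary_def by blast
qed

lemma hereditary_finite_alg: "hereditary finite_alg"
  unfolding hereditary_def
proof (intro conjI ballI allI impI)
  fix x y z :: "'a adjointable"
  show "star x \<in> finite_alg" if "x \<in> finite_alg"
    using that hereditaryD(1)[OF hereditary_matrix_alg] unfolding finite_alg_iff by blast
  have two: "\<exists>n. x \<in> matrix_alg n \<and> y \<in> matrix_alg n" if "x \<in> finite_alg" "y \<in> finite_alg" for x y
      :: "'a adjointable"
    using that matrix_alg_mono max.cobounded1 max.cobounded2 unfolding finite_alg_iff by metis
  show "x + y \<in> finite_alg" if "x \<in> finite_alg" "y \<in> finite_alg"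
    using two[OF that] hereditaryD(2)[OF hereditary_matrix_alg] unfolding finite_alg_iff by blast
  show "x * y * z \<in> finite_alg" if "x \<in> finite_alg" "z \<in> finite_alg"
    using two[OF that] hereditaryD(3)[OF hereditary_matrix_alg] unfolding finite_alg_iff by blast
  show "z \<in> finite_alg" if "star z = z \<and> z * z \<in> finite_alg"
    using that hereditaryD(5)[OF hereditary_matrix_alg] unfolding finite_alg_iff by blast
qed

lemma hereditary_stable_alg: "hereditary stable_alg"
  unfolding hereditary_def
proof (intro conjI ballI allI impI)
  fix x y z :: "'a adjointable"
  show "star x \<in> stable_alg" if x: "x \<in> stable_alg"
    using tendsto_star[OF stable_alg_tendsto(1)[OF x]] tendsto_star[OF stable_alg_tendsto(2)[OF x]]
    by (intro stable_algI) (simp_all add: star_mult)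
  show "x + y \<in> stable_alg" if "x \<in> stable_alg" "y \<in> stable_alg"
    using that by (intro stable_algI) (simp_all add: distrib_left distrib_right tendsto_add
        stable_alg_tendsto)
  show "x * y * z \<in> stable_alg" if "x \<in> stable_alg" "z \<in> stable_alg"
  proof (rule stable_algI)
    have "(\<lambda>n. (proj n * x) * y * z) \<longlonglongrightarrow> x * y * z" using that by (intro tendsto_intros
        stable_alg_tendsto)
    then show "(\<lambda>n. proj n * (x * y * z)) \<longlonglongrightarrow> x * y * z" by (simp add: mult.assoc)
    have "(\<lambda>n. x * y * (z * proj n)) \<longlonglongrightarrow> x * y * z" using that by (intro tendsto_intros
        stable_alg_tendsto)
    then show "(\<lambda>n. x * y * z * proj n) \<longlonglongrightarrow> x * y * z" by (simp add: mult.assoc)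
  qed
  show "z \<in> stable_alg" if z: "star z = z \<and> z * z \<in> stable_alg"
  proof -
    \<comment> \<open>The same identity as for corners, with convergence to 0 in place of
      vanishing.\<close>
    have eq: "star (z - z * proj n) * (z - z * proj n) = z * z - proj n * (z * z) - z * z * proj n
        + proj n * (z * z) * proj n" for n
      using z by (simp add: star_diff star_mult algebra_simps)
    have "(\<lambda>n. star (z - z * proj n) * (z - z * proj n)) \<longlonglongrightarrow> z * z - z * z - z * z + z * z"
      unfolding eq using z
      by (intro tendsto_add tendsto_diff tendsto_const stable_alg_tendsto)
        (simp_all flip: stable_alg_iff)
    then have "(\<lambda>n. star (z - z * proj n) * (z - z * proj n)) \<longlonglongrightarrow> 0" by simp
    then have "(\<lambda>n. norm (star (z - z * proj n) * (z - z * proj n))) \<longlonglongrightarrow> 0"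
      by (rule tendsto_norm_zero)
    then have "(\<lambda>n. sqrt (norm (star (z - z * proj n) * (z - z * proj n)))) \<longlonglongrightarrow> sqrt 0"
      by (rule tendsto_real_sqrt)
    then have "(\<lambda>n. norm (z - z * proj n)) \<longlonglongrightarrow> 0" by (simp add: norm_star_mult_self)
    then have "(\<lambda>n. z - z * proj n) \<longlonglongrightarrow> 0" by (simp add: tendsto_norm_zero_iff)
    from tendsto_diff[OF tendsto_const[of z] this] have l: "(\<lambda>n. z * proj n) \<longlonglongrightarrow> z" by simp
    with tendsto_star[OF l] z show ?thesis by (intro stable_algI) (simp_all add: star_mult)
  qed
qed

lemma entries_image:
  "entries ` matrix_alg n = (matrices n :: 'a::unital_cstar_algebra mat set)"
  "entries ` finite_alg = (finite_matrices :: 'a mat set)"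
  "entries ` stable_alg = (stabilization :: 'a mat set)"
proof -
  have im: "entries ` {x. entries x \<in> M} = M" if "M \<subseteq> adjointable_mat" for M :: "'a mat set"
    using that by (auto simp: image_iff) (metis Adjointable_inverse subsetD)
  have m: "matrices n \<subseteq> (adjointable_mat :: 'a mat set)" for n
    using finite_matrices_core core_mat_subset by blast
  then show "entries ` matrix_alg n = (matrices n :: 'a mat set)" unfolding matrix_alg_def by
      (rule im)
  show "entries ` finite_alg = (finite_matrices :: 'a mat set)" unfolding finite_alg_def
    by (rule im) (use m in \<open>auto simp: finite_matrices_def\<close>)
  have "stabilization \<subseteq> (adjointable_mat :: 'a mat set)"
  proof
    fix a :: "'a mat" assume a: "a \<in> stabilization"
    show "a \<in> adjointable_mat"
    proof (rule adjointable_mat_closed)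
      fix \<epsilon> :: real assume "\<epsilon> > 0"
      then have "\<forall>\<^sub>F n in sequentially. mat_norm (mat_diff a (corner n a)) < ennreal \<epsilon>"
        using a unfolding stabilization_def by (intro order_tendstoD(2)) auto
      then obtain n where "mat_norm (mat_diff a (corner n a)) < ennreal \<epsilon>"
        by (auto simp: eventually_sequentially)
      then have "mat_bound (mat_diff a (corner n a)) \<epsilon>" using \<open>\<epsilon> > 0\<close> by (simp add: mat_bound_iff)
      then show "\<exists>g\<in>adjointable_mat. mat_bound (mat_diff a g) \<epsilon>" using m[of n] corner_matrices by
          blast
    qed
  qed
  then show "entries ` stable_alg = (stabilization :: 'a mat set)" unfolding stable_alg_def by
      (rule im)
qed

text \<open>The root of a positive element of S lies in S, so positivity relative to S agrees with
  positivity in the ambient algebra.\<close>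

lemma positives_entries:
  assumes S: "hereditary S"
  shows "positives (entries ` S) = entries ` {x \<in> S. pos_elem x}"
proof
  show "positives (entries ` S) \<subseteq> entries ` {x \<in> S. pos_elem x}"
  proof
    fix a assume "a \<in> positives (entries ` S)"
    then obtain x where "x \<in> S" "a = entries (star x * x)"
      by (auto simp: positives_def entries_mult entries_star)
    moreover have "star x * x \<in> S"
      by (rule hereditaryD(4)[OF S hereditaryD(1)[OF S]]) (rule \<open>x \<in> S\<close>)+
    ultimately show "a \<in> entries ` {x \<in> S. pos_elem x}"
      using pos_elem_star_mult_self by blast
  qed
  show "entries ` {x \<in> S. pos_elem x} \<subseteq> positives (entries ` S)"
  proof
    fix a assume "a \<in> entries ` {x \<in> S. pos_elem x}"
    then obtain x where x: "x \<in> S" "pos_elem x" "a = entries x" by blast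
    obtain b where b: "pos_elem b" "b \<in> S" "b * b = x" by (rule hereditary_sqrt[OF S x(2,1)])
    have "a = mat_mult (mat_adj (entries b)) (entries b)"
      using b(3) pos_elem_self_adjoint[OF b(1)] x(3) by (metis entries_mult entries_star)
    then show "a \<in> positives (entries ` S)" using b(2) unfolding positives_def by blast
  qed
qed

lemma cuntz_le_entries:
  "cuntz_le (entries ` S) (entries a) (entries b) \<longleftrightarrow> cuntz_sub S a b"
proof -
  have norm: "mat_norm (mat_diff (entries a) (mat_mult (mat_mult (entries r) (entries b)) (mat_adj
      (entries r))))
      = ennreal (norm (a - r * b * star r))" for r
    by (simp add: entries_diff entries_mult entries_star flip: mat_norm_entries)
  have "cuntz_le (entries ` S) (entries a) (entries b) \<longleftrightarrow>
      (\<exists>r. (\<forall>n. r n \<in> S) \<and> (\<lambda>n. ennreal (norm (a - r n * b * star (r n)))) \<longlonglongrightarrow> ennreal 0)" (is "_ \<longleftrightarrow>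
          ?R")
  proof
    assume "cuntz_le (entries ` S) (entries a) (entries b)"
    then obtain R where R: "\<And>n. R n \<in> entries ` S"
      "(\<lambda>n. mat_norm (mat_diff (entries a) (mat_mult (mat_mult (R n) (entries b)) (mat_adj (R
          n))))) \<longlonglongrightarrow> 0"
      unfolding cuntz_le_def by blast
    then obtain r where r: "\<And>n. r n \<in> S" "\<And>n. R n = entries (r n)" unfolding image_iff by metis
    with R(2) show ?R by (auto simp: norm)
  next
    assume ?R
    then obtain r where r: "\<And>n. r n \<in> S" "(\<lambda>n. ennreal (norm (a - r n * b * star (r n)))) \<longlonglongrightarrow> 0" by
        auto
    then show "cuntz_le (entries ` S) (entries a) (entries b)"
      unfolding cuntz_le_def by (intro exI[of _ "\<lambda>n. entries (r n)"]) (simp add: norm)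
  qed
  also have "\<dots> \<longleftrightarrow> (\<exists>r. (\<forall>n. r n \<in> S) \<and> (\<lambda>n. norm (a - r n * b * star (r n))) \<longlonglongrightarrow> 0)"
    by (subst tendsto_ennreal_iff) auto
  also have "\<dots> \<longleftrightarrow> cuntz_sub S a b"
  proof
    assume "\<exists>r. (\<forall>n. r n \<in> S) \<and> (\<lambda>n. norm (a - r n * b * star (r n))) \<longlonglongrightarrow> 0"
    then obtain r where r: "\<And>n. r n \<in> S" "(\<lambda>n. norm (a - r n * b * star (r n))) \<longlonglongrightarrow> 0" by blast
    show "cuntz_sub S a b" unfolding cuntz_sub_def
    proof (intro allI impI)
      fix \<epsilon> :: real assume "\<epsilon> > 0"
      then have "\<forall>\<^sub>F n in sequentially. norm (a - r n * b * star (r n)) < \<epsilon>"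
        using r(2) by (intro order_tendstoD(2)) auto
      then show "\<exists>r\<in>S. norm (a - r * b * star r) \<le> \<epsilon>"
        using r(1) less_imp_le unfolding eventually_sequentially by blast
    qed
  next
    assume ab: "cuntz_sub S a b"
    have "\<exists>r\<in>S. norm (a - r * b * star r) \<le> inverse (real (Suc n))" for n
      by (rule cuntz_subD[OF ab]) simp
    then obtain r where r: "\<And>n. r n \<in> S" "\<And>n. norm (a - r n * b * star (r n)) \<le> inverse (real (Suc
        n))" by metis
    have "(\<lambda>n. norm (a - r n * b * star (r n))) \<longlonglongrightarrow> 0"
      by (rule Lim_null_comparison[OF _ LIMSEQ_inverse_real_of_nat]) (use r in auto)
    with r(1) show "\<exists>r. (\<forall>n. r n \<in> S) \<and> (\<lambda>n. norm (a - r n * b * star (r n))) \<longlonglongrightarrow> 0" by blast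
  qed
  finally show ?thesis .
qed

text \<open>Replacing a witness r by its block p_n r p_m compresses the error by p_n on both sides,
  because p_n fixes a and p_m fixes b.\<close>

lemma cuntz_sub_finite_alg:
  assumes a: "a \<in> finite_alg" and b: "b \<in> finite_alg"
  shows "cuntz_sub finite_alg a b \<longleftrightarrow> cuntz_sub stable_alg a b"
proof
  show "cuntz_sub stable_alg a b" if "cuntz_sub finite_alg a b"
    using that finite_alg_subset_stable unfolding cuntz_sub_def by blast
  assume ab: "cuntz_sub stable_alg a b"
  obtain n m where n: "a \<in> matrix_alg n" and m: "b \<in> matrix_alg m" using a b unfolding
      finite_alg_iff by blast
  show "cuntz_sub finite_alg a b" unfolding cuntz_sub_def
  proof (intro allI impI)
    fix \<epsilon> :: real assume "\<epsilon> > 0"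
    then obtain r where r: "norm (a - r * b * star r) \<le> \<epsilon>" using cuntz_subD[OF ab] by blast
    have pb: "proj m * b = b" "b * proj m = b" and pa: "proj n * a = a" "a * proj n = a"
      using n m unfolding matrix_alg_iff by auto
    have pb': "proj m * (b * x) = b * x" for x using pb(1) by (simp flip: mult.assoc)
    have pb'': "b * (proj m * x) = b * x" for x using pb(2) by (simp flip: mult.assoc)
    have "a - (proj n * r * proj m) * b * star (proj n * r * proj m) = proj n * (a - r * b * star
        r) * proj n"
      by (simp add: star_mult mult.assoc pb' pb'' left_diff_distrib right_diff_distrib pa)
    also have "norm \<dots> \<le> norm (proj n :: 'a adjointable) * norm (a - r * b * star r) * norm (proj n
        :: 'a adjointable)"
      by (rule norm_mult3)
    also have "\<dots> \<le> 1 * norm (a - r * b * star r) * 1"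
      by (intro mult_mono norm_proj_le) auto
    finally have "norm (a - (proj n * r * proj m) * b * star (proj n * r * proj m)) \<le> \<epsilon>" using r
        by simp
    moreover have "proj n * r * proj m \<in> finite_alg"
      by (rule hereditaryD(3)[OF hereditary_finite_alg]) (use proj_matrix_alg finite_alg_iff in
          blast)+
    ultimately show "\<exists>r\<in>finite_alg. norm (a - r * b * star r) \<le> \<epsilon>" by blast
  qed
qed

section \<open>The Cuntz semigroup\<close>

definition stable_pos :: "'a::unital_cstar_algebra adjointable set" where
  "stable_pos = {x \<in> stable_alg. pos_elem x}"

lemma positives_image:
  "positives stabilization = entries ` stable_pos"
  "positives finite_matrices = entries ` {x \<in> finite_alg. pos_elem x}"
  "positives (matrices n) = entries ` {x \<in> matrix_alg n. pos_elem x}"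
  unfolding stable_pos_def entries_image[symmetric]
  by (rule positives_entries[OF hereditary_stable_alg] positives_entries[OF hereditary_finite_alg]
      positives_entries[OF hereditary_matrix_alg])+

lemma cuntz_le_stabilization:
  "cuntz_le stabilization (entries a) (entries b) \<longleftrightarrow> cuntz_sub stable_alg a b"
  unfolding entries_image(3)[symmetric] by (rule cuntz_le_entries)

lemma cuntz_le_finite_matrices:
  fixes A B :: "'a::unital_cstar_algebra mat"
  assumes "A \<in> positives finite_matrices" "B \<in> positives finite_matrices"
  shows "cuntz_le finite_matrices A B \<longleftrightarrow> cuntz_le stabilization A B"
proof -
  obtain a b where "A = entries a" "B = entries b" "a \<in> finite_alg" "b \<in> finite_alg"
    using assms unfolding positives_image by blast
  then show ?thesis
    unfolding entries_image(2,3)[symmetric] using cuntz_le_entries cuntz_sub_finite_alg by blast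
qed

lemma cuntz_equiv_entries:
  "(entries a, entries b) \<in> cuntz_equiv \<longleftrightarrow>
    a \<in> stable_pos \<and> b \<in> stable_pos \<and> cuntz_sub stable_alg a b \<and> cuntz_sub stable_alg b a"
  by (simp add: cuntz_equiv_def cuntz_le_stabilization positives_image inj_image_mem_iff inj_def
      entries_inject)

lemma mem_cu_class:
  assumes "a \<in> stable_pos"
  shows "m \<in> cu_class (entries a) \<longleftrightarrow>
    (\<exists>b\<in>stable_pos. m = entries b \<and> cuntz_sub stable_alg a b \<and> cuntz_sub stable_alg b a)"
proof
  assume "m \<in> cu_class (entries a)"
  then have m: "(entries a, m) \<in> cuntz_equiv" by (simp add: cu_class_def)
  then obtain b where "m = entries b" unfolding cuntz_equiv_def positives_image by blast
  with m show "\<exists>b\<in>stable_pos. m = entries b \<and> cuntz_sub stable_alg a b \<and> cuntz_sub stable_alg b a"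
    by (auto simp: cuntz_equiv_entries)
qed (use assms in \<open>auto simp: cu_class_def cuntz_equiv_entries\<close>)

lemma stable_pos_refl: "a \<in> stable_pos \<Longrightarrow> cuntz_sub stable_alg a a"
  by (rule cuntz_sub_refl[OF hereditary_stable_alg]) (simp_all add: stable_pos_def)

lemmas stable_trans = cuntz_sub_trans[OF hereditary_stable_alg]

lemma entries_mem_cu_class: "a \<in> stable_pos \<Longrightarrow> entries a \<in> cu_class (entries a)"
  using mem_cu_class stable_pos_refl by blast

lemma cu_class_eqI:
  assumes "a \<in> stable_pos" "b \<in> stable_pos" "cuntz_sub stable_alg a b" "cuntz_sub stable_alg b a"
  shows "cu_class (entries a) = cu_class (entries b)"
proof -
  have "m \<in> cu_class (entries a) \<longleftrightarrow> m \<in> cu_class (entries b)" for m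
    unfolding mem_cu_class[OF assms(1)] mem_cu_class[OF assms(2)] using assms stable_trans by blast
  then show ?thesis by blast
qed

lemma cu_class_mem_Cu: "a \<in> stable_pos \<Longrightarrow> cu_class (entries a) \<in> Cu"
  unfolding Cu_def cu_class_def by (rule quotientI) (simp add: positives_image)

lemma Cu_cases:
  assumes "x \<in> Cu"
  obtains a where "a \<in> stable_pos" "x = cu_class (entries a)"
  using assms unfolding Cu_def cu_class_def positives_image by (auto elim: quotientE)

lemma cu_le_class:
  assumes "a \<in> stable_pos" "b \<in> stable_pos"
  shows "cu_le (cu_class (entries a)) (cu_class (entries b)) \<longleftrightarrow> cuntz_sub stable_alg a b"
proof
  assume "cu_le (cu_class (entries a)) (cu_class (entries b))"
  then obtain a' b' where "cuntz_sub stable_alg a a'" "cuntz_sub stable_alg a' b'" "cuntz_sub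
      stable_alg b' b"
    unfolding cu_le_def by (auto simp: mem_cu_class assms cuntz_le_stabilization)
  then show "cuntz_sub stable_alg a b" using stable_trans by blast
next
  assume "cuntz_sub stable_alg a b"
  then show "cu_le (cu_class (entries a)) (cu_class (entries b))"
    unfolding cu_le_def using entries_mem_cu_class assms cuntz_le_stabilization by blast
qed

lemma stable_pos_add: "a \<in> stable_pos \<Longrightarrow> b \<in> stable_pos \<Longrightarrow> a + b \<in> stable_pos"
  using hereditaryD(2)[OF hereditary_stable_alg] pos_elem_add by (auto simp: stable_pos_def)

text \<open>By \<open>cuntz_sub_add\<close> in both directions, all orthogonal pairs of
  representatives have equivalent sums, so the union in \<open>cu_add\<close> runs over a single
  class.\<close>

lemma cu_add_class:
  assumes a: "a \<in> stable_pos" and b: "b \<in> stable_pos" and ab: "a * b = 0"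
  shows "cu_add (cu_class (entries a)) (cu_class (entries b)) = cu_class (entries (a + b))"
proof -
  have zero: "mat_mult (entries x) (entries y) = mat_zero \<longleftrightarrow> x * y = 0" for x y :: "'a adjointable"
    by (simp add: mat_zero_def flip: entries_mult entries_zero entries_inject)
  have "{cu_class (mat_add m n) |m n. m \<in> cu_class (entries a) \<and> n \<in> cu_class (entries b) \<and>
      mat_mult m n = mat_zero}
      = {cu_class (entries (a + b))}" (is "?K = _")
  proof
    show "?K \<subseteq> {cu_class (entries (a + b))}"
    proof
      fix x assume "x \<in> ?K"
      then obtain c d where cd: "c \<in> stable_pos" "d \<in> stable_pos" "x = cu_class (entries (c + d))"
          "c * d = 0"
        "cuntz_sub stable_alg a c" "cuntz_sub stable_alg c a"
        "cuntz_sub stable_alg b d" "cuntz_sub stable_alg d b"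
        by (auto simp: mem_cu_class[OF a] mem_cu_class[OF b] zero simp flip: entries_add)
      have "cuntz_sub stable_alg (a + b) (c + d)" "cuntz_sub stable_alg (c + d) (a + b)"
        using a b ab cd by (auto simp: stable_pos_def intro: cuntz_sub_add[OF
            hereditary_stable_alg])
      then have "x = cu_class (entries (a + b))"
        unfolding cd(3) using a b cd(1,2) by (intro cu_class_eqI stable_pos_add)
      then show "x \<in> {cu_class (entries (a + b))}" by simp
    qed
    have "cu_class (entries (a + b)) \<in> ?K"
      unfolding entries_add using entries_mem_cu_class[OF a] entries_mem_cu_class[OF b] ab zero by
          blast
    then show "{cu_class (entries (a + b))} \<subseteq> ?K" by simp
  qed
  then show ?thesis by (simp add: cu_add_def)
qed

section \<open>Direct sums as orthogonal sums\<close>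

definition shift :: "nat \<Rightarrow> nat \<Rightarrow> 'a::unital_cstar_algebra adjointable" where
  "shift n m = Adjointable (\<lambda>i j. if i = j + n \<and> j < m then 1 else 0)"

lemma shift_matrices: "(\<lambda>i j. if i = j + n \<and> j < m then 1 else 0) \<in> matrices (n + m)"
  by (auto simp: matrices_def)

lemma entries_shift: "entries (shift n m) = (\<lambda>i j. if i = j + n \<and> j < m then 1 else 0)"
  unfolding shift_def by (rule entries_finite[OF shift_matrices])

lemma entries_shift_mult:
  "entries (shift n m * x) = (\<lambda>i j. if n \<le> i \<and> i - n < m then entries x (i - n) j else 0)"
proof (intro ext)
  fix i j
  have "entries (shift n m * x) i j
      = (\<Sum>k\<in>{i - n}. (if i = k + n \<and> k < m then 1 else 0) * entries x k j)"
    unfolding entries_mult mat_mult_def entries_shift by (rule suminf_finite) auto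
  then show "entries (shift n m * x) i j = (if n \<le> i \<and> i - n < m then entries x (i - n) j else 0)"
    by auto
qed

lemma entries_mult_star_shift:
  "entries (x * star (shift n m)) = (\<lambda>i j. if n \<le> j \<and> j - n < m then entries x i (j - n) else 0)"
proof -
  have "x * star (shift n m) = star (shift n m * star x)" by (simp add: star_mult)
  then show ?thesis by (simp add: entries_star entries_shift_mult mat_adj_def fun_eq_iff)
qed

lemma star_shift_mult_shift: "star (shift n m) * shift n m = proj m"
proof (intro adjointable_eqI ext)
  fix i j
  have "entries (star (shift n m) * shift n m :: 'a adjointable) i j
      = (\<Sum>k\<in>{i + n}. star (if k = i + n \<and> i < m then 1 else 0) * (if k = j + n \<and> j < m then 1 else
          0))"
    unfolding entries_mult mat_mult_def entries_star mat_adj_def entries_shift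
    by (rule suminf_finite) auto
  then show "entries (star (shift n m) * shift n m) i j = entries (proj m :: 'a adjointable) i j"
    by (auto simp: entries_proj corner_def mat_id_def)
qed

text \<open>The direct sum is a + s b \<open>star s\<close>, where the partial isometry s moves the
  block of b down by n places. Conjugation by s and by \<open>star s\<close> shows equivalence of
  the moved block with b, and p_n s = 0 makes it orthogonal to a.\<close>

lemma direct_sum_class:
  fixes A B :: "'a::unital_cstar_algebra mat"
  assumes A: "A \<in> positives (matrices n)" and B: "B \<in> positives finite_matrices"
  shows "direct_sum n A B \<in> positives finite_matrices"
    and "cu_add (cu_class A) (cu_class B) = cu_class (direct_sum n A B)"
    and "cu_le (cu_class A) (cu_class (direct_sum n A B))"
proof -
  obtain a where a: "A = entries a" "a \<in> matrix_alg n" "pos_elem a" using A unfolding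
      positives_image by blast
  obtain b where b: "B = entries b" "b \<in> finite_alg" "pos_elem b" using B unfolding
      positives_image by blast
  obtain m where m: "b \<in> matrix_alg m" using b(2) finite_alg_iff by blast
  define s :: "'a adjointable" where "s = shift n m"
  define t where "t = s * b * star s"
  have "s \<in> matrix_alg (n + m)"
    using shift_matrices by (simp add: s_def matrix_alg_def entries_shift)
  then have s: "s \<in> finite_alg" using finite_alg_iff by blast
  then have ss: "star s \<in> finite_alg" by (rule hereditaryD(1)[OF hereditary_finite_alg])
  have t: "t \<in> finite_alg" unfolding t_def by (rule hereditaryD(3)[OF hereditary_finite_alg s ss])
  have pt: "pos_elem t" unfolding t_def by (rule pos_elem_conj'[OF b(3)])
  have af: "a \<in> finite_alg" using a(2) finite_alg_iff by blast
  have "direct_sum n A B = entries (a + t)"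
  proof (intro ext)
    fix i j
    have a0: "entries a i j = 0" if "n \<le> i \<or> n \<le> j" using a(2) that by (auto simp: matrix_alg_def
        matrices_def)
    have b0: "entries b i j = 0" if "m \<le> i \<or> m \<le> j" for i j using m that by (auto simp:
        matrix_alg_def matrices_def)
    have "entries t i j = (if n \<le> i \<and> n \<le> j then entries b (i - n) (j - n) else 0)"
      unfolding t_def s_def using b0 by (auto simp: entries_mult_star_shift entries_shift_mult)
    then show "direct_sum n A B i j = entries (a + t) i j"
      using a0 by (auto simp: direct_sum_def a b entries_add mat_add_def)
  qed
  moreover have "a + t \<in> finite_alg" by (rule hereditaryD(2)[OF hereditary_finite_alg af t])
  ultimately show "direct_sum n A B \<in> positives finite_matrices"
    using pos_elem_add[OF a(3) pt] unfolding positives_image by blast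
  have sp: "a \<in> stable_pos" "b \<in> stable_pos" "t \<in> stable_pos"
    using af a b t pt finite_alg_subset_stable by (auto simp: stable_pos_def)
  have sst: "s \<in> stable_alg" "star s \<in> stable_alg" using s ss finite_alg_subset_stable by auto
  have "cuntz_sub stable_alg t b" unfolding t_def by (rule cuntz_sub_conj[OF sst(1)])
  moreover have "cuntz_sub stable_alg b t"
  proof -
    have "star s * t * star (star s) = (star s * s) * b * (star s * s)" by (simp add: t_def
        mult.assoc)
    also have "\<dots> = b" using m by (simp add: s_def star_shift_mult_shift matrix_alg_iff)
    finally show ?thesis using cuntz_sub_conj[OF sst(2)] by metis
  qed
  ultimately have "cu_class (entries b) = cu_class (entries t)" using sp by (intro cu_class_eqI)
  moreover have "a * t = 0"
  proof -
    have "proj n * s = 0"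
      unfolding s_def by (intro adjointable_eqI ext) (auto simp: entries_proj_mult entries_shift
          entries_zero)
    moreover have "a * t = a * (proj n * s) * b * star s"
      using a(2) by (simp add: t_def matrix_alg_iff flip: mult.assoc)
    ultimately show ?thesis by simp
  qed
  ultimately show "cu_add (cu_class A) (cu_class B) = cu_class (direct_sum n A B)"
    using cu_add_class[OF sp(1,3)] a(1) b(1) \<open>direct_sum n A B = entries (a + t)\<close> by simp
  have "a \<in> stable_alg" "a + t \<in> stable_alg" using sp stable_pos_add by (auto simp: stable_pos_def)
  then have "cuntz_sub stable_alg a (a + t)"
    using a(3) pt by (intro cuntz_sub_of_le[OF hereditary_stable_alg]) simp_all
  then show "cu_le (cu_class A) (cu_class (direct_sum n A B))"
    using cu_le_class[OF sp(1) stable_pos_add[OF sp(1,3)]] a(1)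
      \<open>direct_sum n A B = entries (a + t)\<close> by simp
qed

lemma positives_finite_matrices_iff:
  fixes A :: "'a::unital_cstar_algebra mat"
  shows "A \<in> positives finite_matrices \<longleftrightarrow> (\<exists>n. A \<in> positives (matrices n))"
  unfolding positives_image finite_alg_iff by blast

lemma cu_class_finite:
  fixes A :: "'a::unital_cstar_algebra mat"
  shows "A \<in> positives finite_matrices \<Longrightarrow> cu_class A \<in> Cu"
  using cu_class_mem_Cu finite_alg_subset_stable unfolding positives_image stable_pos_def by blast

lemma cu_le_class_finite:
  fixes A B :: "'a::unital_cstar_algebra mat"
  assumes "A \<in> positives finite_matrices" "B \<in> positives finite_matrices"
  shows "cu_le (cu_class A) (cu_class B) \<longleftrightarrow> cuntz_le finite_matrices A B"
proof -
  obtain a b where ab: "A = entries a" "B = entries b" "a \<in> stable_pos" "b \<in> stable_pos"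
    using assms finite_alg_subset_stable unfolding positives_image stable_pos_def by blast
  have "cu_le (cu_class A) (cu_class B) \<longleftrightarrow> cuntz_le stabilization A B"
    unfolding ab(1,2) cuntz_le_stabilization by (rule cu_le_class[OF ab(3,4)])
  then show ?thesis using cuntz_le_finite_matrices[OF assms] by simp
qed

lemma positives_matrices_mono:
  fixes A :: "'a::unital_cstar_algebra mat"
  shows "A \<in> positives (matrices n) \<Longrightarrow> n \<le> m \<Longrightarrow> A \<in> positives (matrices m)"
  using matrix_alg_mono unfolding positives_image by blast

lemma cu_le_trans:
  fixes x y z :: "'a::unital_cstar_algebra mat set"
  assumes "x \<in> Cu" "y \<in> Cu" "z \<in> Cu" "cu_le x y" "cu_le y z"
  shows "cu_le x z"
proof -
  obtain a b c where "a \<in> stable_pos" "b \<in> stable_pos" "c \<in> stable_pos"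
    "x = cu_class (entries a)" "y = cu_class (entries b)" "z = cu_class (entries c)"
    using assms(1-3) Cu_cases by metis
  then show ?thesis using assms(4,5) stable_trans by (auto simp: cu_le_class)
qed

lemma mat_zero_positive: "mat_zero \<in> positives (matrices 0 :: 'a::unital_cstar_algebra mat set)"
proof -
  have "mat_zero = entries (0 :: 'a adjointable)" by (simp add: entries_zero mat_zero_def)
  moreover have "(0 :: 'a adjointable) \<in> matrix_alg 0" by (simp add: matrix_alg_iff)
  ultimately show ?thesis unfolding positives_image by auto
qed

lemma mat_unit_entries: "mat_unit = entries (proj 1)"
  by (intro ext) (auto simp: mat_unit_def entries_proj corner_def mat_id_def)

lemma entries_proj_positive: "entries (proj n) \<in> positives (matrices n)"
  unfolding positives_image using proj_matrix_alg pos_elem_proj by blast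

lemma mat_unit_positive: "mat_unit \<in> positives (matrices 1)"
  unfolding mat_unit_entries by (rule entries_proj_positive)

lemma cu_multiple_unit:
  "cu_multiple n (cu_class mat_unit) = cu_class (entries (proj n :: 'a::unital_cstar_algebra
      adjointable))"
proof (induction n)
  case 0
  have "mat_zero = entries (proj 0 :: 'a adjointable)" by (intro ext) (simp add: entries_proj
      corner_def mat_zero_def)
  then show ?case by simp
next
  case (Suc n)
  have "direct_sum 1 mat_unit (entries (proj n)) = entries (proj (Suc n) :: 'a adjointable)"
    by (intro ext) (auto simp: direct_sum_def mat_unit_def entries_proj corner_def mat_id_def)
  moreover have "entries (proj n :: 'a adjointable) \<in> positives finite_matrices"
    using entries_proj_positive positives_finite_matrices_iff by blast
  from direct_sum_class(2)[OF mat_unit_positive this]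
  have "cu_add (cu_class mat_unit) (cu_class (entries (proj n :: 'a adjointable)))
      = cu_class (direct_sum 1 mat_unit (entries (proj n)))" .
  ultimately show ?case by (simp only: cu_multiple.simps Suc)
qed

lemma cu_le_multiple_unit:
  fixes A :: "'a::unital_cstar_algebra mat"
  assumes A: "A \<in> positives (matrices n)"
  shows "cu_le (cu_class A) (cu_multiple n (cu_class mat_unit))"
proof -
  obtain a where a: "A = entries a" "a \<in> matrix_alg n" "pos_elem a" using A unfolding
      positives_image by blast
  obtain b where b: "pos_elem b" "b \<in> matrix_alg n" "b * b = a"
    by (rule hereditary_sqrt[OF hereditary_matrix_alg a(3,2)])
  have st: "matrix_alg n \<subseteq> (stable_alg :: 'a adjointable set)"
    using finite_alg_subset_stable finite_alg_iff by blast
  have "a = b * proj n * star b" using b by (simp add: pos_elem_self_adjoint matrix_alg_iff)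
  then have "cuntz_sub stable_alg a (proj n)" using cuntz_sub_conj[of b stable_alg "proj n"] b(2)
      st by auto
  then show ?thesis unfolding cu_multiple_unit a(1)
    using a st proj_matrix_alg[of n] pos_elem_proj by (subst cu_le_class) (auto simp:
        stable_pos_def)
qed

text \<open>The source of lower semicontinuity: a functional comes arbitrarily close to its value at
  [A] on the classes \<open>x k\<close>, and each \<open>x k\<close> stays below [B] for every B
  near A.\<close>

lemma cu_class_approx:
  assumes A: "A \<in> positives finite_matrices"
  obtains x :: "nat \<Rightarrow> 'a::unital_cstar_algebra mat set" and \<eta> :: "nat \<Rightarrow> real"
  where "\<And>k. x k \<in> Cu" "\<And>k. \<eta> k > 0" "\<And>k. cu_le (x k) (x (Suc k))" "cu_is_sup x (cu_class A)"
    "\<And>k B. B \<in> positives finite_matrices \<Longrightarrow> mat_norm (mat_diff B A) < ennreal (\<eta> k) \<Longrightarrow> cu_le (x k)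
        (cu_class B)"
proof -
  obtain a where a: "A = entries a" "a \<in> stable_alg" "pos_elem a"
    using A finite_alg_subset_stable unfolding positives_image by blast
  obtain c :: "nat \<Rightarrow> 'a adjointable" and \<eta> :: "nat \<Rightarrow> real"
  where c: "\<And>k. pos_elem (c k)" "\<And>k. c k \<in> stable_alg" "\<And>k. \<eta> k > 0"
    "\<And>k b. star b = b \<Longrightarrow> b \<in> stable_alg \<Longrightarrow> norm (a - b) \<le> \<eta> k \<Longrightarrow> cuntz_sub stable_alg (c k) b"
    "\<And>k. cuntz_sub stable_alg (c k) (c (Suc k))"
    "\<And>t. (\<And>k. cuntz_sub stable_alg (c k) t) \<Longrightarrow> cuntz_sub stable_alg a t"
    using cuntz_rapidly_increasing[OF hereditary_stable_alg a(3,2)] by metis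
  have sp: "a \<in> stable_pos" "c k \<in> stable_pos" for k using a c by (auto simp: stable_pos_def)
  show thesis
  proof (rule that[of "\<lambda>k. cu_class (entries (c k))" \<eta>])
    show "cu_class (entries (c k)) \<in> Cu" for k by (rule cu_class_mem_Cu[OF sp(2)])
    show "\<eta> k > 0" for k by (rule c(3))
    show "cu_le (cu_class (entries (c k))) (cu_class (entries (c (Suc k))))" for k
      using c(5) sp by (simp add: cu_le_class)
    show "cu_is_sup (\<lambda>k. cu_class (entries (c k))) (cu_class A)"
      unfolding cu_is_sup_def a(1)
    proof (intro conjI allI ballI impI)
      show "cu_class (entries a) \<in> Cu" by (rule cu_class_mem_Cu[OF sp(1)])
      show "cu_le (cu_class (entries (c k))) (cu_class (entries a))" for k
        unfolding cu_le_class[OF sp(2,1)] using a c(3)[of k] by (intro c(4)) (simp_all add: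
            pos_elem_self_adjoint)
      fix t assume t: "t \<in> Cu" "\<forall>k. cu_le (cu_class (entries (c k))) t"
      obtain b where b: "b \<in> stable_pos" "t = cu_class (entries b)" using Cu_cases[OF t(1)] .
      with t(2) show "cu_le (cu_class (entries a)) t" using c(6) sp by (simp add: cu_le_class)
    qed
    fix k B assume B: "B \<in> positives finite_matrices" "mat_norm (mat_diff B A) < ennreal (\<eta> k)"
    then obtain b where b: "B = entries b" "b \<in> stable_alg" "pos_elem b"
      using finite_alg_subset_stable unfolding positives_image by blast
    have "ennreal (norm (b - a)) < ennreal (\<eta> k)"
      using B(2) by (simp add: a(1) b(1) mat_norm_entries flip: entries_diff)
    then have "norm (a - b) \<le> \<eta> k" using c(3)[of k] by (simp add: ennreal_less_iff
        norm_minus_commute)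
    then have "cuntz_sub stable_alg (c k) b" using b by (intro c(4)) (simp_all add:
        pos_elem_self_adjoint)
    then show "cu_le (cu_class (entries (c k))) (cu_class B)"
      unfolding b(1) using sp b by (subst cu_le_class) (auto simp: stable_pos_def)
  qed
qed

section \<open>Functionals and dimension functions\<close>

lemma functionalsD:
  assumes "f \<in> functionals"
  shows "x \<in> Cu \<Longrightarrow> y \<in> Cu \<Longrightarrow> cu_le x y \<Longrightarrow> f x \<le> f y"
    and "f (cu_class mat_zero) = 0"
    and "x \<in> Cu \<Longrightarrow> y \<in> Cu \<Longrightarrow> f (cu_add x y) = f x + f y"
    and "(\<And>n. X n \<in> Cu) \<Longrightarrow> (\<And>n. cu_le (X n) (X (Suc n))) \<Longrightarrow> cu_is_sup X s \<Longrightarrow> f s = (SUP n. f (X n))"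
proof -
  show "x \<in> Cu \<Longrightarrow> y \<in> Cu \<Longrightarrow> cu_le x y \<Longrightarrow> f x \<le> f y"
    and "f (cu_class mat_zero) = 0" and "x \<in> Cu \<Longrightarrow> y \<in> Cu \<Longrightarrow> f (cu_add x y) = f x + f y"
    using assms unfolding functionals_def by blast+
  assume X: "\<And>n. X n \<in> Cu" "\<And>n. cu_le (X n) (X (Suc n))" "cu_is_sup X s"
  have "\<forall>X s. (\<forall>n. X n \<in> Cu) \<and> (\<forall>n. cu_le (X n) (X (Suc n))) \<and> cu_is_sup X s \<longrightarrow> f s = (SUP n. f (X
      n))"
    using assms unfolding functionals_def by blast
  then show "f s = (SUP n. f (X n))" using X by blast
qed

lemma functional_scale:
  fixes f :: "'a::cstar_algebra mat set \<Rightarrow> ennreal"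
  assumes f: "f \<in> functionals"
  shows "(\<lambda>x. c * f x) \<in> functionals"
  unfolding functionals_def
proof (intro CollectI conjI ballI allI impI)
  show "c * f x \<le> c * f y" if "x \<in> Cu" "y \<in> Cu" "cu_le x y" for x y
    using functionalsD(1)[OF f that] by (rule mult_left_mono) simp
  show "c * f (cu_class mat_zero) = 0" using functionalsD(2)[OF f] by simp
  show "c * f (cu_add x y) = c * f x + c * f y" if "x \<in> Cu" "y \<in> Cu" for x y
    using functionalsD(3)[OF f that] by (simp add: distrib_left)
  fix X :: "nat \<Rightarrow> 'a mat set" and s assume "(\<forall>n. X n \<in> Cu) \<and> (\<forall>n. cu_le (X n) (X (Suc n))) \<and>
      cu_is_sup X s"
  then have "f s = (SUP n. f (X n))" by (intro functionalsD(4)[OF f]) auto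
  then show "c * f s = (SUP n. c * f (X n))" by (simp add: SUP_mult_left_ennreal)
qed

lemma mat_unit_finite: "mat_unit \<in> positives finite_matrices"
  using mat_unit_positive positives_finite_matrices_iff by blast

lemma mat_zero_finite: "mat_zero \<in> positives (finite_matrices :: 'a::unital_cstar_algebra mat set)"
  using mat_zero_positive positives_finite_matrices_iff by blast

lemma cu_multiple_unit_mem_Cu:
  "cu_multiple n (cu_class mat_unit) \<in> (Cu :: 'a::unital_cstar_algebra mat set set)"
  unfolding cu_multiple_unit
  using entries_proj_positive positives_finite_matrices_iff cu_class_finite by blast

lemma functional_cu_multiple_unit:
  fixes f :: "'a::unital_cstar_algebra mat set \<Rightarrow> ennreal"
  assumes f: "f \<in> functionals"
  shows "f (cu_multiple n (cu_class mat_unit)) = of_nat n * f (cu_class mat_unit)"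
proof (induction n)
  case 0
  show ?case using functionalsD(2)[OF f] by simp
next
  case (Suc n)
  show ?case
    using Suc functionalsD(3)[OF f cu_class_finite[OF mat_unit_finite] cu_multiple_unit_mem_Cu]
    by (simp add: distrib_right)
qed

lemma functional_le_of_matrices:
  fixes f :: "'a::unital_cstar_algebra mat set \<Rightarrow> ennreal"
  assumes f: "f \<in> functionals" and A: "A \<in> positives (matrices n)"
  shows "f (cu_class A) \<le> of_nat n * f (cu_class mat_unit)"
  unfolding functional_cu_multiple_unit[OF f, symmetric]
  using A positives_finite_matrices_iff
  by (intro functionalsD(1)[OF f] cu_class_finite cu_multiple_unit_mem_Cu cu_le_multiple_unit)
      blast+

lemma DF_D:
  assumes "\<delta> \<in> DF"
  shows "\<delta> \<in> positives finite_matrices \<rightarrow>\<^sub>E {0..}"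
    and "a \<in> positives (matrices n) \<Longrightarrow> b \<in> positives finite_matrices \<Longrightarrow> \<delta> (direct_sum n a b) = \<delta> a +
        \<delta> b"
    and "a \<in> positives finite_matrices \<Longrightarrow> b \<in> positives finite_matrices \<Longrightarrow> cu_le (cu_class a)
        (cu_class b) \<Longrightarrow> \<delta> a \<le> \<delta> b"
    and "\<delta> mat_unit = 1"
    and "a \<in> positives finite_matrices \<Longrightarrow> 0 \<le> \<delta> a"
    and "\<delta> mat_zero = 0"
proof -
  show P: "\<delta> \<in> positives finite_matrices \<rightarrow>\<^sub>E {0..}" and "\<delta> mat_unit = 1"
    and "a \<in> positives finite_matrices \<Longrightarrow> b \<in> positives finite_matrices \<Longrightarrow> cu_le (cu_class a)
        (cu_class b) \<Longrightarrow> \<delta> a \<le> \<delta> b"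
    using assms cu_le_class_finite unfolding DF_def by blast+
  show ds: "a \<in> positives (matrices n) \<Longrightarrow> b \<in> positives finite_matrices \<Longrightarrow> \<delta> (direct_sum n a b) = \<delta>
      a + \<delta> b"
    for a b n using assms unfolding DF_def by blast
  show "a \<in> positives finite_matrices \<Longrightarrow> 0 \<le> \<delta> a" using P by (auto simp: PiE_def)
  \<comment> \<open>Additivity at block size 0 gives \<open>\<delta> mat_zero\<close> = 2
    \<open>\<delta> mat_zero\<close>.\<close>
  have "direct_sum 0 mat_zero mat_zero = (mat_zero :: 'a mat)"
    by (intro ext) (simp add: direct_sum_def mat_zero_def)
  then show "\<delta> mat_zero = 0" using ds[OF mat_zero_positive mat_zero_finite] by simp
qed

text \<open>Values are finite because every matrix lies below a multiple of the unit. Lower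
  semicontinuity comes from the supremum in \<open>cu_class_approx\<close>, which functionals
  preserve.\<close>

lemma LDF_of_functional:
  fixes f :: "'a::unital_cstar_algebra mat set \<Rightarrow> ennreal"
  assumes f: "f \<in> functionals" and f1: "f (cu_class mat_unit) = 1"
  defines "\<delta> \<equiv> \<lambda>A\<in>positives finite_matrices. enn2real (f (cu_class A))"
  shows "\<delta> \<in> (LDF :: ('a::unital_cstar_algebra mat \<Rightarrow> real) set)"
    and "A \<in> positives finite_matrices \<Longrightarrow> ennreal (\<delta> A) = f (cu_class A)"
proof -
  have fin: "f (cu_class A) < top" if A: "A \<in> positives finite_matrices" for A :: "'a mat"
  proof -
    obtain n where "A \<in> positives (matrices n)" using A positives_finite_matrices_iff by blast
    then have "f (cu_class A) \<le> of_nat n * f (cu_class mat_unit)" by (rule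
        functional_le_of_matrices[OF f])
    then have "f (cu_class A) \<le> of_nat n" by (simp add: f1)
    then show ?thesis using of_nat_less_top le_less_trans by blast
  qed
  then show eq: "A \<in> positives finite_matrices \<Longrightarrow> ennreal (\<delta> A) = f (cu_class A)" for A
    by (simp add: \<delta>_def)
  have "\<delta> \<in> DF" unfolding DF_def
  proof (intro CollectI conjI ballI allI impI)
    show "\<delta> \<in> positives finite_matrices \<rightarrow>\<^sub>E {0..}" by (auto simp: \<delta>_def)
    show "\<delta> (direct_sum n a b) = \<delta> a + \<delta> b"
      if a: "a \<in> positives (matrices n)" and b: "b \<in> positives finite_matrices" for n a b
    proof -
      have a': "a \<in> positives finite_matrices" using a positives_finite_matrices_iff by blast
      have "f (cu_class (direct_sum n a b)) = f (cu_class a) + f (cu_class b)"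
        unfolding direct_sum_class(2)[OF a b, symmetric]
        by (rule functionalsD(3)[OF f cu_class_finite[OF a'] cu_class_finite[OF b]])
      then show ?thesis
        using direct_sum_class(1)[OF a b] a' b fin by (simp add: \<delta>_def enn2real_plus)
    qed
    show "\<delta> a \<le> \<delta> b" if "a \<in> positives finite_matrices" "b \<in> positives finite_matrices"
      "cuntz_le finite_matrices a b" for a b
    proof -
      have "f (cu_class a) \<le> f (cu_class b)"
        using that cu_le_class_finite by (intro functionalsD(1)[OF f] cu_class_finite) blast+
      then show ?thesis using that fin by (simp add: \<delta>_def enn2real_mono)
    qed
    show "\<delta> mat_unit = 1" using mat_unit_finite[where 'a='a] by (simp add: \<delta>_def f1)
  qed
  moreover have "\<exists>\<epsilon>>0. \<forall>B\<in>positives finite_matrices. mat_norm (mat_diff B A) < ennreal \<epsilon> \<longrightarrow> t < \<delta> B"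
    if A: "A \<in> positives finite_matrices" and t: "t < \<delta> A" for A t
  proof (cases "t < 0")
    \<comment> \<open>Negative t is split off because \<open>ennreal\<close> truncates it to
      0.\<close>
    case True
    have "0 \<le> \<delta> B" if "B \<in> positives finite_matrices" for B using that by (simp add: \<delta>_def)
    with True show ?thesis by (intro exI[of _ 1]) force
  next
    case False
    obtain x :: "nat \<Rightarrow> 'a mat set" and \<eta> :: "nat \<Rightarrow> real" where x: "\<And>k. x k \<in> Cu" "\<And>k. \<eta> k > 0"
      "\<And>k. cu_le (x k) (x (Suc k))" "cu_is_sup x (cu_class A)"
      "\<And>k B. B \<in> positives finite_matrices \<Longrightarrow> mat_norm (mat_diff B A) < ennreal (\<eta> k) \<Longrightarrow> cu_le (x k)
          (cu_class B)"
      using cu_class_approx[OF A] by metis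
    have "ennreal t < f (cu_class A)" using t False eq[OF A] by (metis ennreal_less_iff
        not_le_imp_less)
    also have "f (cu_class A) = (SUP k. f (x k))" using x by (intro functionalsD(4)[OF f])
    finally obtain k where k: "ennreal t < f (x k)" by (auto simp: less_SUP_iff)
    have "t < \<delta> B" if B: "B \<in> positives finite_matrices" "mat_norm (mat_diff B A) < ennreal (\<eta> k)"
        for B
    proof -
      have "f (x k) \<le> f (cu_class B)"
        by (rule functionalsD(1)[OF f x(1) cu_class_finite[OF B(1)] x(5)[OF B]])
      with k have "ennreal t < ennreal (\<delta> B)" using eq[OF B(1)] by simp
      then show ?thesis using False by (simp add: ennreal_less_iff)
    qed
    then show ?thesis using x(2) by blast
  qed
  ultimately show "\<delta> \<in> LDF" unfolding LDF_def by blast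
qed

lemma LDF_subset_DF: "LDF \<subseteq> DF"
  by (auto simp: LDF_def)

lemma LDF_convex:
  assumes l: "l \<in> LDF" and l': "l' \<in> LDF" and t: "0 \<le> t" "t \<le> (1::real)"
  shows "(\<lambda>A\<in>positives finite_matrices. (1 - t) * l A + t * l' A) \<in> (LDF ::
      ('a::unital_cstar_algebra mat \<Rightarrow> real) set)"
    (is "?\<delta> \<in> _")
proof -
  have L: "l \<in> DF" "l' \<in> DF" using assms LDF_subset_DF by auto
  have "?\<delta> \<in> DF" unfolding DF_def
  proof (intro CollectI conjI ballI allI impI)
    show "?\<delta> \<in> positives finite_matrices \<rightarrow>\<^sub>E {0..}"
      using t DF_D(5)[OF L(1)] DF_D(5)[OF L(2)] by auto
    show "?\<delta> (direct_sum n a b) = ?\<delta> a + ?\<delta> b"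
      if a: "a \<in> positives (matrices n)" and b: "b \<in> positives finite_matrices" for n a b
    proof -
      have "a \<in> positives finite_matrices" using a positives_finite_matrices_iff by blast
      then show ?thesis using direct_sum_class(1)[OF a b] b DF_D(2)[OF L(1) a b] DF_D(2)[OF L(2) a
          b]
        by (simp add: algebra_simps)
    qed
    show "?\<delta> a \<le> ?\<delta> b" if ab: "a \<in> positives finite_matrices" "b \<in> positives finite_matrices"
      "cuntz_le finite_matrices a b" for a b
    proof -
      have "l a \<le> l b" "l' a \<le> l' b" using ab L unfolding DF_def by blast+
      then show ?thesis using ab t by (simp add: add_mono mult_left_mono)
    qed
    show "?\<delta> mat_unit = 1" using mat_unit_finite[where 'a='a] DF_D(4)[OF L(1)] DF_D(4)[OF L(2)] by
        simp
  qed
  moreover have "\<exists>\<epsilon>>0. \<forall>B\<in>positives finite_matrices. mat_norm (mat_diff B A) < ennreal \<epsilon> \<longrightarrow> s < ?\<delta> B"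
    if A: "A \<in> positives finite_matrices" and s: "s < ?\<delta> A" for A s
  proof -
    \<comment> \<open>Both semicontinuity bounds are taken with half the slack, so that the convex
      combination loses at most e and still exceeds s.\<close>
    define e where "e = (?\<delta> A - s) / 2"
    have e: "e > 0" using s by (simp add: e_def)
    have lsc: "\<exists>\<epsilon>>0. \<forall>B\<in>positives finite_matrices. mat_norm (mat_diff B A) < ennreal \<epsilon> \<longrightarrow> l A - e <
        l B"
      if "l \<in> LDF" for l :: "'a mat \<Rightarrow> real"
      using that A e unfolding LDF_def by auto
    obtain \<epsilon> \<epsilon>' where \<epsilon>: "\<epsilon> > 0" "\<epsilon>' > 0"
      "\<And>B. B \<in> positives finite_matrices \<Longrightarrow> mat_norm (mat_diff B A) < ennreal \<epsilon> \<Longrightarrow> l A - e < l B"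
      "\<And>B. B \<in> positives finite_matrices \<Longrightarrow> mat_norm (mat_diff B A) < ennreal \<epsilon>' \<Longrightarrow> l' A - e < l' B"
      using lsc[OF l] lsc[OF l'] by blast
    have "s < ?\<delta> B" if B: "B \<in> positives finite_matrices" "mat_norm (mat_diff B A) < ennreal (min
        \<epsilon> \<epsilon>')" for B
    proof -
      have "ennreal (min \<epsilon> \<epsilon>') \<le> ennreal \<epsilon>" "ennreal (min \<epsilon> \<epsilon>') \<le> ennreal \<epsilon>'" by (auto intro:
          ennreal_leI)
      then have "l A - e < l B" "l' A - e < l' B"
        using B by (auto intro!: \<epsilon>(3,4) elim: less_le_trans)
      then have "(1 - t) * (l A - e) + t * (l' A - e) \<le> (1 - t) * l B + t * l' B"
        using t by (intro add_mono mult_left_mono) auto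
      moreover have "(1 - t) * (l A - e) + t * (l' A - e) = ?\<delta> A - e" using A by (simp add:
          algebra_simps)
      ultimately have "?\<delta> A - e \<le> ?\<delta> B" using B by simp
      then show ?thesis using s by (simp add: e_def field_simps)
    qed
    then show ?thesis using \<epsilon>(1,2) by (intro exI[of _ "min \<epsilon> \<epsilon>'"]) auto
  qed
  ultimately show ?thesis unfolding LDF_def by blast
qed

text \<open>Dimension functions act on matrices, whereas the hypothesis speaks of multiples of
  classes; a k-fold direct sum serves both.\<close>

lemma cu_multiple_rep:
  fixes A :: "'a::unital_cstar_algebra mat"
  assumes A: "A \<in> positives finite_matrices"
  obtains B where "B \<in> positives finite_matrices" "cu_multiple k (cu_class A) = cu_class B"
    "\<And>\<delta>. \<delta> \<in> DF \<Longrightarrow> \<delta> B = real k * \<delta> A" "k > 0 \<Longrightarrow> cu_le (cu_class A) (cu_class B)"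
proof -
  have "\<exists>B. B \<in> positives finite_matrices \<and> cu_multiple k (cu_class A) = cu_class B \<and>
    (\<forall>\<delta>\<in>DF. \<delta> B = real k * \<delta> A) \<and> (k > 0 \<longrightarrow> cu_le (cu_class A) (cu_class B))"
  proof (induction k)
    case 0
    show ?case using mat_zero_finite DF_D(6) by (intro exI[of _ mat_zero]) auto
  next
    case (Suc k)
    then obtain B where B: "B \<in> positives finite_matrices" "cu_multiple k (cu_class A) = cu_class B"
      "\<forall>\<delta>\<in>DF. \<delta> B = real k * \<delta> A" by blast
    obtain n where n: "A \<in> positives (matrices n)" using A positives_finite_matrices_iff by blast
    show ?case
      using direct_sum_class[OF n B(1)] B(2,3) DF_D(2)[OF _ n B(1)]
      by (intro exI[of _ "direct_sum n A B"]) (auto simp: algebra_simps)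
  qed
  then show thesis using that by blast
qed

lemma direct_sum_rep:
  fixes A B :: "'a::unital_cstar_algebra mat"
  assumes A: "A \<in> positives finite_matrices" and B: "B \<in> positives finite_matrices"
  obtains D where "D \<in> positives finite_matrices" "\<And>\<delta>. \<delta> \<in> DF \<Longrightarrow> \<delta> D = \<delta> A + \<delta> B"
    "cu_le (cu_class A) (cu_class D)"
proof -
  obtain n where n: "A \<in> positives (matrices n)" using A positives_finite_matrices_iff by blast
  show thesis using that[OF direct_sum_class(1)[OF n B]] DF_D(2)[OF _ n B] direct_sum_class(3)[OF
      n B] by blast
qed

lemma combination_rep:
  assumes "finite I" "I \<subseteq> positives (finite_matrices :: 'a::unital_cstar_algebra mat set)"
  obtains B where "B \<in> positives (finite_matrices :: 'a mat set)"
    "\<And>\<delta>. \<delta> \<in> DF \<Longrightarrow> \<delta> B = (\<Sum>A\<in>I. real (k A) * \<delta> A)"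
proof -
  have "\<exists>B\<in>positives (finite_matrices :: 'a mat set). \<forall>\<delta>\<in>DF. \<delta> B = (\<Sum>A\<in>I. real (k A) * \<delta> A)"
    using assms
  proof (induction I)
    case empty
    show ?case using mat_zero_finite DF_D(6) by (intro bexI[of _ mat_zero]) auto
  next
    case (insert A I)
    then obtain B where B: "B \<in> positives finite_matrices" "\<forall>\<delta>\<in>DF. \<delta> B = (\<Sum>A\<in>I. real (k A) * \<delta> A)"
        by auto
    have "A \<in> positives finite_matrices" using insert.prems by simp
    then obtain C where C: "C \<in> positives finite_matrices" "\<And>\<delta>. \<delta> \<in> DF \<Longrightarrow> \<delta> C = real (k A) * \<delta> A"
      using cu_multiple_rep by metis
    obtain D where D: "D \<in> positives finite_matrices" "\<And>\<delta>. \<delta> \<in> DF \<Longrightarrow> \<delta> D = \<delta> C + \<delta> B"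
      using direct_sum_rep[OF C(1) B(1)] by metis
    have "\<delta> D = (\<Sum>A\<in>insert A I. real (k A) * \<delta> A)" if "\<delta> \<in> DF" for \<delta>
      using D(2)[OF that] C(2)[OF that] B(2) that insert.hyps by simp
    then show ?case by (intro bexI[OF _ D(1)] ballI)
  qed
  then show thesis using that by blast
qed

lemma DF_bound:
  fixes A :: "'a::unital_cstar_algebra mat"
  assumes A: "A \<in> positives (matrices n)" and d: "\<delta> \<in> DF"
  shows "\<delta> A \<le> real n"
proof -
  have A': "A \<in> positives finite_matrices" using A positives_finite_matrices_iff by blast
  obtain B :: "'a mat" where B: "B \<in> positives finite_matrices" "cu_multiple n (cu_class mat_unit)
      = cu_class B"
    "\<And>\<delta>. \<delta> \<in> DF \<Longrightarrow> \<delta> B = real n * \<delta> mat_unit"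
    using cu_multiple_rep[OF mat_unit_finite] by metis
  have "\<delta> A \<le> \<delta> B" using cu_le_multiple_unit[OF A] B(2) by (intro DF_D(3)[OF d A' B(1)]) simp
  then show ?thesis using B(3)[OF d] DF_D(4)[OF d] by simp
qed

section \<open>Density\<close>

text \<open>
  For a near-minimizer \<open>c\<close> of the distance to \<open>d\<close>, the functional \<open>\<langle>c - d, _\<rangle>\<close> separates the convex
  set \<open>C\<close> from \<open>d\<close>.
\<close>

lemma separation_near_minimizer:
  fixes C :: "('i \<Rightarrow> real) set" and d :: "'i \<Rightarrow> real"
  assumes I: "finite I"
    and conv: "\<And>l l' t. l \<in> C \<Longrightarrow> l' \<in> C \<Longrightarrow> 0 \<le> t \<Longrightarrow> t \<le> 1 \<Longrightarrow>
      \<exists>m\<in>C. \<forall>i\<in>I. m i = (1 - t) * l i + t * l' i"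
    and bound: "\<And>l i. l \<in> C \<Longrightarrow> i \<in> I \<Longrightarrow> \<bar>l i - d i\<bar> \<le> M"
    and far: "\<epsilon> > 0" "\<And>l. l \<in> C \<Longrightarrow> \<exists>i\<in>I. \<bar>l i - d i\<bar> \<ge> \<epsilon>"
  obtains w \<kappa> where "\<kappa> > 0" "\<And>l. l \<in> C \<Longrightarrow> (\<Sum>i\<in>I. w i * (l i - d i)) \<ge> \<kappa>"
proof (cases "C = {}")
  case True
  then show thesis using that[of 1 "\<lambda>_. 0"] by simp
next
  case False
  \<comment> \<open>Squared Euclidean distance to d in the coordinates I. Its infimum D over C need
    not be attained, so a point within t D/2 of it is used.\<close>
  define q where "q l = (\<Sum>i\<in>I. (l i - d i)\<^sup>2)" for l :: "'i \<Rightarrow> real"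
  define D where "D = Inf (q ` C)"
  have q_ge: "\<epsilon>\<^sup>2 \<le> q l" if l: "l \<in> C" for l
  proof -
    obtain i where i: "i \<in> I" "\<bar>l i - d i\<bar> \<ge> \<epsilon>" using far(2)[OF l] by blast
    then have "\<epsilon>\<^sup>2 \<le> (l i - d i)\<^sup>2" using far(1) by (metis less_imp_le power2_abs power_mono)
    also have "\<dots> \<le> q l" unfolding q_def using I i by (intro member_le_sum) auto
    finally show ?thesis .
  qed
  have bdd: "bdd_below (q ` C)" using q_ge by (intro bdd_belowI2)
  have "\<epsilon>\<^sup>2 \<le> D" unfolding D_def using False q_ge by (intro cINF_greatest)
  then have D: "D > 0" using far(1) by (meson less_le_trans zero_less_power)
  have D_le: "D \<le> q l" if "l \<in> C" for l unfolding D_def by (rule cINF_lower[OF bdd that])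
  define B where "B = real (card I) * (2 * M)\<^sup>2"
  have B0: "B \<ge> 0" by (simp add: B_def)
  have B: "(\<Sum>i\<in>I. (l' i - l i)\<^sup>2) \<le> B" if "l \<in> C" "l' \<in> C" for l l'
  proof -
    have "(l' i - l i)\<^sup>2 \<le> (2 * M)\<^sup>2" if i: "i \<in> I" for i
    proof -
      have "\<bar>l' i - l i\<bar> \<le> 2 * M"
        using bound[OF \<open>l \<in> C\<close> i] bound[OF \<open>l' \<in> C\<close> i] by linarith
      then show ?thesis by (metis abs_ge_zero power2_abs power_mono)
    qed
    then show ?thesis unfolding B_def by (rule sum_bounded_above)
  qed
  \<comment> \<open>The step length makes t^2 B at most t D/2, the same size as the permitted excess
    of \<open>q c\<close> over D.\<close>
  define t where "t = min 1 (D / (2 * (B + 1)))"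
  have t: "0 < t" "t \<le> 1" using D B0 by (auto simp: t_def)
  have tB: "t * B \<le> D / 2"
  proof -
    have "t * B \<le> D / (2 * (B + 1)) * B" using B0 by (intro mult_right_mono) (auto simp: t_def)
    also have "\<dots> \<le> D / 2" using D B0 by (simp add: field_simps)
    finally show ?thesis .
  qed
  have "Inf (q ` C) < D + t * D / 2" using D t by (simp add: D_def)
  then obtain c where c: "c \<in> C" "q c < D + t * D / 2"
    using False by (subst (asm) cInf_less_iff[OF _ bdd]) auto
  show thesis
  proof (rule that[of "D / 2" "\<lambda>i. c i - d i"])
    show "D / 2 > 0" using D by simp
    fix l assume l: "l \<in> C"
    obtain m where m: "m \<in> C" "\<forall>i\<in>I. m i = (1 - t) * c i + t * l i" using conv[OF c(1) l
        less_imp_le[OF t(1)] t(2)] by blast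
    \<comment> \<open>Moving from c towards l by t cannot bring q below D, so D \<le> q(c) + 2 t X +
      t^2 B. This yields X \<ge> - D/2, and the separating sum equals q(c) + X.\<close>
    define X where "X = (\<Sum>i\<in>I. (c i - d i) * (l i - c i))"
    have "q m = (\<Sum>i\<in>I. (c i - d i)\<^sup>2 + 2 * t * ((c i - d i) * (l i - c i)) + t\<^sup>2 * (l i - c i)\<^sup>2)"
      unfolding q_def
    proof (rule sum.cong)
      fix i assume "i \<in> I"
      then have eq: "m i - d i = (c i - d i) + t * (l i - c i)" using m(2) by (simp add:
          algebra_simps)
      show "(m i - d i)\<^sup>2
          = (c i - d i)\<^sup>2 + 2 * t * ((c i - d i) * (l i - c i)) + t\<^sup>2 * (l i - c i)\<^sup>2"
        unfolding eq by (simp add: power2_eq_square algebra_simps)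
    qed simp
    also have "\<dots> = q c + 2 * t * X + t\<^sup>2 * (\<Sum>i\<in>I. (l i - c i)\<^sup>2)"
      by (simp only: sum.distrib q_def X_def sum_distrib_left)
    finally have "D \<le> q c + 2 * t * X + t\<^sup>2 * (\<Sum>i\<in>I. (l i - c i)\<^sup>2)" using D_le[OF m(1)] by simp
    also have "t\<^sup>2 * (\<Sum>i\<in>I. (l i - c i)\<^sup>2) \<le> t\<^sup>2 * B" using B[OF c(1) l] by (intro mult_left_mono)
        auto
    also have "t\<^sup>2 * B \<le> t * (D / 2)" using tB t by (simp add: power2_eq_square mult.assoc)
    finally have "0 \<le> t * (D + 2 * X)" using c(2) by (simp add: algebra_simps)
    then have X: "- D / 2 \<le> X" using t by (simp add: zero_le_mult_iff)
    have "(\<Sum>i\<in>I. (c i - d i) * (l i - d i)) = q c + X"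
      unfolding q_def X_def sum.distrib[symmetric]
      by (rule sum.cong) (auto simp: power2_eq_square algebra_simps)
    then show "D / 2 \<le> (\<Sum>i\<in>I. (c i - d i) * (l i - d i))" using X D_le[OF c(1)] by simp
  qed
qed

text \<open>Rounding the scaled weights changes the sum by at most \<open>card I\<close> times |M|;
  T is chosen so that the scaled gap T \<kappa> covers both this loss and |K|.\<close>

lemma integer_separation:
  fixes C :: "('i \<Rightarrow> real) set" and d :: "'i \<Rightarrow> real"
  assumes I: "finite I"
    and bound: "\<And>l i. l \<in> C \<Longrightarrow> i \<in> I \<Longrightarrow> \<bar>l i - d i\<bar> \<le> M"
    and sep: "\<kappa> > 0" "\<And>l. l \<in> C \<Longrightarrow> (\<Sum>i\<in>I. w i * (l i - d i)) \<ge> \<kappa>"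
  obtains m :: "'i \<Rightarrow> int" where "\<And>l. l \<in> C \<Longrightarrow> (\<Sum>i\<in>I. of_int (m i) * (l i - d i)) \<ge> K"
proof -
  define T where "T = (\<bar>K\<bar> + real (card I) * \<bar>M\<bar>) / \<kappa>"
  have T: "T \<ge> 0" "T * \<kappa> = \<bar>K\<bar> + real (card I) * \<bar>M\<bar>" using sep(1) by (simp_all add: T_def)
  show thesis
  proof (rule that[of "\<lambda>i. \<lfloor>T * w i\<rfloor>"])
    fix l assume l: "l \<in> C"
    have "T * \<kappa> \<le> T * (\<Sum>i\<in>I. w i * (l i - d i))" using sep(2)[OF l] T by (intro mult_left_mono)
    also have "\<dots> = (\<Sum>i\<in>I. T * w i * (l i - d i))" by (simp add: sum_distrib_left mult.assoc)
    also have "\<dots> \<le> (\<Sum>i\<in>I. of_int \<lfloor>T * w i\<rfloor> * (l i - d i) + \<bar>M\<bar>)"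
    proof (rule sum_mono)
      fix i assume i: "i \<in> I"
      have "(T * w i - of_int \<lfloor>T * w i\<rfloor>) * (l i - d i) \<le> \<bar>T * w i - of_int \<lfloor>T * w i\<rfloor>\<bar> * \<bar>l i - d i\<bar>"
        by (metis abs_ge_self abs_mult)
      also have "\<dots> \<le> 1 * \<bar>M\<bar>" using bound[OF l i] by (intro mult_mono) linarith+
      finally show "T * w i * (l i - d i) \<le> of_int \<lfloor>T * w i\<rfloor> * (l i - d i) + \<bar>M\<bar>"
        by (simp add: left_diff_distrib)
    qed
    finally show "K \<le> (\<Sum>i\<in>I. of_int \<lfloor>T * w i\<rfloor> * (l i - d i))"
      using T(2) by (simp add: sum.distrib)
  qed
qed

section \<open>From a uniform gap on \<open>LDF\<close> to comparison of multiples\<close>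

lemma LDF_comparison:
  fixes x y :: "'a::unital_cstar_algebra mat"
  assumes comp: "locally_bounded_comparison_amplitude_uniformly_full TYPE('a)"
    and x: "x \<in> positives finite_matrices" and y: "y \<in> positives finite_matrices"
    and unit: "cu_le (cu_class mat_unit) (cu_class y)"
    and gap: "\<And>l. l \<in> LDF \<Longrightarrow> l x + 1 \<le> l y"
    and \<delta>: "\<delta> \<in> DF"
  shows "\<delta> x \<le> \<delta> y"
proof -
  obtain n m where n: "x \<in> positives (matrices n)" and m: "y \<in> positives (matrices m)"
    using x y positives_finite_matrices_iff by blast
  \<comment> \<open>One number serves as matrix size, as bound for normalized dimension functions on
    y, and as the d of the hypothesis; being at least 2 makes 1 - 1/d positive.\<close>
  define d where "d = max (max n m) 2"
  define \<gamma> where "\<gamma> = 1 - 1 / real d"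
  have d2: "real d \<ge> 2" by (simp add: d_def)
  have \<gamma>: "0 < \<gamma>" "\<gamma> < 1" using d2 by (auto simp: \<gamma>_def field_simps)
  have xd: "x \<in> positives (matrices d)" and yd: "y \<in> positives (matrices d)"
    using n m by (auto simp: d_def intro: positives_matrices_mono)
  note Cu = cu_class_finite[OF x] cu_class_finite[OF y] cu_class_finite[OF mat_unit_finite]
  have "cu_le (cu_class x) (cu_multiple d (cu_class mat_unit))" by (rule cu_le_multiple_unit[OF xd])
  moreover have "cu_le (cu_class y) (cu_multiple d (cu_class mat_unit))" by (rule
      cu_le_multiple_unit[OF yd])
  moreover have "cu_le (cu_class mat_unit) (cu_multiple d (cu_class y))"
  proof -
    obtain B where B: "B \<in> positives finite_matrices" "cu_multiple d (cu_class y) = cu_class B"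
      "d > 0 \<Longrightarrow> cu_le (cu_class y) (cu_class B)" using cu_multiple_rep[OF y] by metis
    then have "cu_le (cu_class y) (cu_class B)" using d2 by auto
    then show ?thesis unfolding B(2) using cu_le_trans[OF Cu(3,2) cu_class_finite[OF B(1)] unit]
        by simp
  qed
  moreover have "cu_hat (cu_class x) f \<le> ennreal \<gamma> * cu_hat (cu_class y) f" if f: "f \<in>
      functionals" for f
  proof -
    have fy: "f (cu_class mat_unit) \<le> f (cu_class y)" by (rule functionalsD(1)[OF f Cu(3,2) unit])
    show ?thesis
    proof (cases "f (cu_class mat_unit)")
      case (real r)
      show ?thesis
      proof (cases "r = 0")
        \<comment> \<open>A functional that vanishes at [1] vanishes at [x], which lies below a
          multiple of [1].\<close>
        case True
        then show ?thesis using functional_le_of_matrices[OF f n] real by (simp add: cu_hat_def)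
      next
        case False
        then have r: "r > 0" using real by simp
        define g where "g = (\<lambda>z. ennreal (1 / r) * f z)"
        have g: "g \<in> functionals" unfolding g_def by (rule functional_scale[OF f])
        have g1: "g (cu_class mat_unit) = 1"
          using r by (simp add: g_def real flip: ennreal_mult)
        define l where "l = (\<lambda>A\<in>positives finite_matrices. enn2real (g (cu_class A)))"
        have l: "l \<in> LDF" unfolding l_def by (rule LDF_of_functional(1)[OF g g1])
        then have lD: "l \<in> DF" using LDF_subset_DF by blast
        have lg: "ennreal (l A) = g (cu_class A)" if "A \<in> positives finite_matrices" for A
          unfolding l_def by (rule LDF_of_functional(2)[OF g g1 that])
        have "l y \<le> real d" by (rule DF_bound[OF yd lD])
        then have "l y / real d \<le> 1" using d2 by simp
        \<comment> \<open>The gap 1 is at least l(y)/d, so l(x) \<le> l(y) - l(y)/d.\<close>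
        then have "l x \<le> \<gamma> * l y" using gap[OF l] by (simp add: \<gamma>_def algebra_simps)
        then have "ennreal (l x) \<le> ennreal \<gamma> * ennreal (l y)"
          using \<gamma> DF_D(5)[OF lD y] by (simp add: ennreal_leI flip: ennreal_mult)
        then have "g (cu_class x) \<le> ennreal \<gamma> * g (cu_class y)" by (simp add: lg x y)
        then have "ennreal r * g (cu_class x) \<le> ennreal r * (ennreal \<gamma> * g (cu_class y))"
          by (rule mult_left_mono) simp
        moreover have "ennreal r * g z = f z" for z
          using r by (simp add: g_def flip: mult.assoc ennreal_mult)
        ultimately show ?thesis by (simp add: cu_hat_def mult.left_commute[of "ennreal r"])
      qed
    next
      case top
      \<comment> \<open>As [1] lies below [y], the right-hand side is infinite; this uses \<gamma> >
        0.\<close>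
      then have "f (cu_class y) = top" using fy top_unique by metis
      then show ?thesis using \<gamma> by (simp add: cu_hat_def ennreal_mult_top)
    qed
  qed
  ultimately obtain N where N: "cu_le_from N (cu_class x) (cu_class y)"
    using comp \<gamma> Cu unfolding locally_bounded_comparison_amplitude_uniformly_full_def by blast
  \<comment> \<open>A multiple k \<ge> N that is also positive, so that the factor cancels in the
    reals.\<close>
  define k where "k = Suc N"
  obtain X where X: "X \<in> positives finite_matrices" "cu_multiple k (cu_class x) = cu_class X"
    "\<And>\<delta>. \<delta> \<in> DF \<Longrightarrow> \<delta> X = real k * \<delta> x" using cu_multiple_rep[OF x] by metis
  obtain Y where Y: "Y \<in> positives finite_matrices" "cu_multiple k (cu_class y) = cu_class Y"
    "\<And>\<delta>. \<delta> \<in> DF \<Longrightarrow> \<delta> Y = real k * \<delta> y" using cu_multiple_rep[OF y] by metis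
  have "cu_le (cu_class X) (cu_class Y)" using N X(2) Y(2) unfolding cu_le_from_def k_def by
      (metis le_Suc_eq order_refl)
  then have "\<delta> X \<le> \<delta> Y" by (rule DF_D(3)[OF \<delta> X(1) Y(1)])
  then show ?thesis using X(3)[OF \<delta>] Y(3)[OF \<delta>] by (simp add: k_def)
qed

section \<open>Approximation on finite sets and density\<close>

lemma LDF_approx:
  fixes \<delta> :: "'a::unital_cstar_algebra mat \<Rightarrow> real"
  assumes comp: "locally_bounded_comparison_amplitude_uniformly_full TYPE('a)"
    and \<delta>: "\<delta> \<in> DF" and I: "finite I" "I \<subseteq> positives finite_matrices" and e: "\<epsilon> > 0"
  shows "\<exists>l\<in>LDF. \<forall>A\<in>I. \<bar>l A - \<delta> A\<bar> < \<epsilon>"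
proof (rule ccontr)
  assume neg: "\<not> ?thesis"
  have "\<exists>n. \<forall>A\<in>I. A \<in> positives (matrices n)"
    using I
  proof (induction I)
    case (insert A I)
    then obtain n where n: "\<forall>A\<in>I. A \<in> positives (matrices n)" by auto
    obtain m where "A \<in> positives (matrices m)" using insert.prems positives_finite_matrices_iff
        by blast
    with n have "\<forall>A\<in>insert A I. A \<in> positives (matrices (max n m))"
      using positives_matrices_mono by (metis insert_iff max.cobounded1 max.cobounded2)
    then show ?case by blast
  qed simp
  then obtain n where n: "\<And>A. A \<in> I \<Longrightarrow> A \<in> positives (matrices n)" by metis
  have bound: "\<bar>l A - \<delta> A\<bar> \<le> real n" if "l \<in> LDF" "A \<in> I" for l A
  proof -
    have lD: "l \<in> DF" using that(1) LDF_subset_DF by blast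
    have A: "A \<in> positives finite_matrices" using that(2) I(2) by blast
    show ?thesis
      using DF_bound[OF n[OF that(2)] lD] DF_bound[OF n[OF that(2)] \<delta>] DF_D(5)[OF lD A] DF_D(5)[OF
          \<delta> A]
      by linarith
  qed
  obtain w \<kappa> where w: "\<kappa> > 0" "\<And>l. l \<in> LDF \<Longrightarrow> (\<Sum>A\<in>I. w A * (l A - \<delta> A)) \<ge> \<kappa>"
  proof (rule separation_near_minimizer[of I LDF \<delta> "real n" \<epsilon>])
    fix l l' :: "'a mat \<Rightarrow> real" and t :: real
    assume a: "l \<in> LDF" "l' \<in> LDF" "0 \<le> t" "t \<le> 1"
    have "\<forall>A\<in>I. (\<lambda>A\<in>positives finite_matrices. (1 - t) * l A + t * l' A) A = (1 - t) * l A + t *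
        l' A"
      using I(2) by auto
    then show "\<exists>m\<in>LDF. \<forall>A\<in>I. m A = (1 - t) * l A + t * l' A" using LDF_convex[OF a] by blast
  next
    show "\<exists>A\<in>I. \<epsilon> \<le> \<bar>l A - \<delta> A\<bar>" if "l \<in> LDF" for l
      using neg that by (meson not_le_imp_less)
  qed (use I(1) bound e in auto)
  \<comment> \<open>The gap 2 splits into 1 for rounding \<theta> up to an integer and 1 for the gap
    required by \<open>LDF_comparison\<close>.\<close>
  have "\<exists>m :: 'a mat \<Rightarrow> int. \<forall>l\<in>LDF. (\<Sum>A\<in>I. of_int (m A) * (l A - \<delta> A)) \<ge> 2"
  proof (rule integer_separation[of I LDF \<delta> "real n" \<kappa> w 2])
    show "finite I" by (rule I(1))
    show "\<bar>l A - \<delta> A\<bar> \<le> real n" if "l \<in> LDF" "A \<in> I" for l A by (rule bound[OF that])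
    show "\<kappa> > 0" by (rule w(1))
    show "\<kappa> \<le> (\<Sum>A\<in>I. w A * (l A - \<delta> A))" if "l \<in> LDF" for l by (rule w(2)[OF that])
  qed blast
  then obtain m :: "'a mat \<Rightarrow> int"
    where m: "\<And>l. l \<in> LDF \<Longrightarrow> (\<Sum>A\<in>I. of_int (m A) * (l A - \<delta> A)) \<ge> 2" by metis
  \<comment> \<open>Negative coefficients move to the other side, as direct sums realize only
    nonnegative ones.\<close>
  obtain x0 where x0: "x0 \<in> positives finite_matrices"
    "\<And>l. l \<in> DF \<Longrightarrow> l x0 = (\<Sum>A\<in>I. real (nat (- m A)) * l A)"
    using combination_rep[OF I, of "\<lambda>A. nat (- m A)"] by metis
  obtain y0 where y0: "y0 \<in> positives finite_matrices"
    "\<And>l. l \<in> DF \<Longrightarrow> l y0 = (\<Sum>A\<in>I. real (nat (m A)) * l A)"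
    using combination_rep[OF I, of "\<lambda>A. nat (m A)"] by metis
  have diff: "l y0 - l x0 = (\<Sum>A\<in>I. of_int (m A) * l A)" if "l \<in> DF" for l
    unfolding x0(2)[OF that] y0(2)[OF that] sum_subtractf[symmetric]
  proof (rule sum.cong)
    fix A
    have "real (nat (m A)) - real (nat (- m A)) = of_int (m A)" by (cases "m A \<ge> 0") auto
    then show "real (nat (m A)) * l A - real (nat (- m A)) * l A = of_int (m A) * l A"
      by (metis left_diff_distrib)
  qed simp
  define \<theta> where "\<theta> = \<delta> y0 - \<delta> x0"
  have sep: "l y0 - l x0 \<ge> \<theta> + 2" if "l \<in> LDF" for l
  proof -
    have "l \<in> DF" using that LDF_subset_DF by blast
    then show ?thesis using m[OF that] diff[of l] diff[OF \<delta>]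
      by (simp add: \<theta>_def right_diff_distrib sum_subtractf)
  qed
  \<comment> \<open>The least integer strictly above \<theta>: strictness yields \<delta>(x) >
    \<delta>(y) at the end, and u \<le> \<theta> + 1 preserves a gap of 1 on
    \<open>LDF\<close>.\<close>
  define u where "u = \<lfloor>\<theta>\<rfloor> + 1"
  have u: "\<theta> < of_int u" "of_int u \<le> \<theta> + 1" by (auto simp: u_def)
  have add_unit: "\<exists>z\<in>positives finite_matrices. (\<forall>l\<in>DF. l z = l z0 + real k) \<and>
      (k > 0 \<longrightarrow> cu_le (cu_class mat_unit) (cu_class z))"
    if z0: "z0 \<in> positives finite_matrices" for z0 :: "'a mat" and k
  proof -
    obtain B :: "'a mat" where B: "B \<in> positives finite_matrices"
      "\<And>\<delta>. \<delta> \<in> DF \<Longrightarrow> \<delta> B = real k * \<delta> mat_unit" "k > 0 \<Longrightarrow> cu_le (cu_class mat_unit) (cu_class B)"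
      using cu_multiple_rep[OF mat_unit_finite] by metis
    obtain z where z: "z \<in> positives finite_matrices" "\<And>\<delta>. \<delta> \<in> DF \<Longrightarrow> \<delta> z = \<delta> B + \<delta> z0"
      "cu_le (cu_class B) (cu_class z)" using direct_sum_rep[OF B(1) z0] by metis
    have "k > 0 \<longrightarrow> cu_le (cu_class mat_unit) (cu_class z)"
      using cu_le_trans[OF cu_class_finite[OF mat_unit_finite] cu_class_finite[OF B(1)]
          cu_class_finite[OF z(1)]]
        B(3) z(3) by blast
    moreover have "l z = l z0 + real k" if "l \<in> DF" for l
      using z(2)[OF that] B(2)[OF that] DF_D(4)[OF that] by simp
    ultimately show ?thesis using z(1) by blast
  qed
  \<comment> \<open>The numbers of units added to x and to y differ by u, whatever its sign. The
    further copy on both sides leaves this difference unchanged and puts the unit below y.\<close>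
  obtain x where x: "x \<in> positives finite_matrices" "\<And>l. l \<in> DF \<Longrightarrow> l x = l x0 + real (nat u + 1)"
    using add_unit[OF x0(1), of "nat u + 1"] by metis
  obtain y where y: "y \<in> positives finite_matrices" "\<And>l. l \<in> DF \<Longrightarrow> l y = l y0 + real (nat (- u) + 1)"
    "cu_le (cu_class mat_unit) (cu_class y)"
    using add_unit[OF y0(1), of "nat (- u) + 1"] by (metis add_gr_0 zero_less_one)
  have nu: "real (nat u + 1) - real (nat (- u) + 1) = of_int u" by (cases "u \<ge> 0") auto
  have "l x + 1 \<le> l y" if "l \<in> LDF" for l
  proof -
    have "l \<in> DF" using that LDF_subset_DF by blast
    then show ?thesis using x(2)[of l] y(2)[of l] sep[OF that] u nu by linarith
  qed
  then have "\<delta> x \<le> \<delta> y" by (rule LDF_comparison[OF comp x(1) y(1,3) _ \<delta>])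
  then show False using x(2)[OF \<delta>] y(2)[OF \<delta>] u nu by (simp add: \<theta>_def)
qed

theorem theorem8p5:
  assumes "locally_bounded_comparison_amplitude_uniformly_full TYPE('a::unital_cstar_algebra)"
  shows "DF_topology closure_of (LDF :: ('a mat \<Rightarrow> real) set) = DF"
proof -
  let ?P = "positives finite_matrices :: 'a mat set"
  let ?X = "product_topology (\<lambda>_. euclideanreal) ?P"
  have top: "topspace (DF_topology :: ('a mat \<Rightarrow> real) topology) = DF"
  proof -
    have "DF \<subseteq> (\<Pi>\<^sub>E A\<in>?P. (UNIV :: real set))" using DF_D(1) by blast
    then show ?thesis by (auto simp: DF_topology_def)
  qed
  show ?thesis
  proof
    show "DF_topology closure_of LDF \<subseteq> (DF :: ('a mat \<Rightarrow> real) set)"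
      using closure_of_subset_topspace top by metis
    show "(DF :: ('a mat \<Rightarrow> real) set) \<subseteq> DF_topology closure_of LDF"
    proof
      fix \<delta> :: "'a mat \<Rightarrow> real" assume \<delta>: "\<delta> \<in> DF"
      have "\<exists>l. l \<in> LDF \<and> l \<in> T" if T: "\<delta> \<in> T" "openin DF_topology T" for T
      proof -
        obtain T' where T': "openin ?X T'" "T = T' \<inter> DF"
          using T(2) unfolding DF_topology_def openin_subtopology by blast
        then obtain U where U: "finite {A \<in> ?P. U A \<noteq> topspace euclideanreal}"
          "\<forall>A\<in>?P. openin euclideanreal (U A)" "\<delta> \<in> Pi\<^sub>E ?P U" "Pi\<^sub>E ?P U \<subseteq> T'"
          using T(1) unfolding openin_product_topology_alt by blast
        \<comment> \<open>A basic open set restricts only finitely many coordinates, so closeness on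
          I suffices.\<close>
        define I where "I = {A \<in> ?P. U A \<noteq> UNIV}"
        have I: "finite I" "I \<subseteq> ?P" using U(1) by (auto simp: I_def)
        have "\<exists>e>0. \<forall>r. \<bar>r - \<delta> A\<bar> < e \<longrightarrow> r \<in> U A" if "A \<in> ?P" for A
        proof -
          have "open (U A)" "\<delta> A \<in> U A" using U(2,3) that by auto
          then show ?thesis unfolding open_dist by (auto simp: dist_real_def)
        qed
        then obtain e where e: "\<And>A. A \<in> ?P \<Longrightarrow> e A > 0"
          "\<And>A r. A \<in> ?P \<Longrightarrow> \<bar>r - \<delta> A\<bar> < e A \<Longrightarrow> r \<in> U A" by metis
        \<comment> \<open>The inserted 1 keeps the minimum meaningful when I is empty.\<close>
        define \<epsilon> where "\<epsilon> = Min (insert 1 (e ` I))"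
        have "\<epsilon> > 0" using I e(1) by (auto simp: \<epsilon>_def)
        then obtain l where l: "l \<in> LDF" "\<forall>A\<in>I. \<bar>l A - \<delta> A\<bar> < \<epsilon>" using LDF_approx[OF assms \<delta> I] by
            blast
        then have lD: "l \<in> DF" using LDF_subset_DF by blast
        have "l A \<in> U A" if A: "A \<in> ?P" for A
        proof (cases "A \<in> I")
          case True
          then have "\<epsilon> \<le> e A" using I(1) by (auto simp: \<epsilon>_def)
          then show ?thesis using l(2) True e(2)[OF A, of "l A"] by fastforce
        next
          case False
          then show ?thesis using A by (simp add: I_def)
        qed
        then have "l \<in> Pi\<^sub>E ?P U" using DF_D(1)[OF lD] by (auto simp: PiE_def)
        then show ?thesis using l(1) lD U(4) T'(2) by blast
      qed
      then show "\<delta> \<in> DF_topology closure_of LDF" unfolding in_closure_of top using \<delta> by blast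
    qed
  qed
qed

end
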